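(* Consider the linear-quadratic problem with Wasserstein penalty described in the context. Suppose that there exists a symmetric positive semidefinite matrix $P\in\mathbb{R}^{n\times n}$ that solves $$P=Q+\alpha A^\top PA+\alpha^2A^\top SA$$ with $$\begin{aligned}S:={}&P\Xi(\lambda I-\alpha\Xi^\top P\Xi)^{-1}\Xi^\top P\\&-[I+\alpha\Xi(\lambda I-\alpha\Xi^\top P\Xi)^{-1}\Xi^\top P]^\top PB\\&\quad\times[R+\alpha B^\top\{P+\alpha P\Xi(\lambda I-\alpha\Xi^\top P\Xi)^{-1}\Xi^\top P\}B]^{-1}\\&\quad\times B^\top P[I+\alpha\Xi(\lambda I-\alpha\Xi^\top P\Xi)^{-1}\Xi^\top P]\end{aligned}$$ for a sufficiently large $\lambda$, in the sense that $\lambda I-\alpha\Xi^\top P\Xi$ is positive definite. Then $v'(\boldsymbol{x}):=\boldsymbol{x}^\top P\boldsymbol{x}+z$ solves the Bellman equation $v'=T'_\lambda v'$, where $z:=\frac{\lambda}{1-\alpha}\mathrm{tr}[\{\lambda(\lambda I-\alpha\Xi^\top P\Xi)^{-1}-I\}\Sigma]$. If, in addition, $v'$ is the optimal value function, then the unique optimal policy $\pi'$ is given by $\pi'(\boldsymbol{x})=K\boldsymbol{x}$ for all $\boldsymbol{x}\in\mathbb{R}^n$, where $$\begin{aligned}K:={}&-[R+\alpha B^\top\{P+\alpha P\Xi(\lambda I-\alpha\Xi^\top P\Xi)^{-1}\Xi^\top P\}B]^{-1}\\&\times\alpha B^\top P^\top[I+\alpha\Xi(\lambda I-\alpha\Xi^\top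 P\Xi)^{-1}\Xi^\top P]A.\end{aligned}$$ Furthermore, if we let $$w_{\boldsymbol{x}}'^{(i)}:=(\lambda I-\alpha\Xi^\top P\Xi)^{-1}[\alpha\Xi^\top P(A+BK)\boldsymbol{x}+\lambda\hat w^{(i)}],\qquad i=1,\ldots,N,$$ then the deterministic stationary policy $\gamma'\in\Gamma'$ defined by $\gamma'(\boldsymbol{x})=\frac1N\sum_{i=1}^N\delta_{w_{\boldsymbol{x}}'^{(i)}}$ for all $\boldsymbol{x}\in\mathbb{R}^n$ is an optimal policy for Player II that generates a worst-case distribution for each $\boldsymbol{x}\in\mathbb{R}^n$.
   Context: Setting. $\mathcal{X}=\mathbb{R}^n$, $\mathcal{U}(\boldsymbol{x})\equiv\mathcal{U}=\mathbb{R}^m$, $\mathcal{W}=\mathbb{R}^l$. The system is $x_{t+1}=f(x_t,u_t,w_t)=Ax_t+Bu_t+\Xi w_t$ with $A\in\mathbb{R}^{n\times n}$, $B\in\mathbb{R}^{n\times m}$, $\Xi\in\mathbb{R}^{n\times l}$. The stage cost is $c(\boldsymbol{x},\boldsymbol{u})=\boldsymbol{x}^\top Q\boldsymbol{x}+\boldsymbol{u}^\top R\boldsymbol{u}$ with $Q=Q^\top$ positive semidefinite and $R=R^\top$ positive definite. $\alpha\in(0,1)$ is the discount factor and $\lambda>0$ the penalty parameter. Data. $\hat w^{(1)},\ldots,\hat w^{(N)}\in\mathbb{R}^l$ are samples with $\frac1N\sum_{i=1}^N\hat w^{(i)}=0$; $\nu_N:=\frac1N\sum_{i=1}^N\delta_{\hat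 w^{(i)}}$; $\Sigma:=\frac1N\sum_{i=1}^N\hat w^{(i)}(\hat w^{(i)})^\top$. The transport cost is $d(w,w')^p=\|w-w'\|^2$ (Euclidean norm), so $W_p(\mu,\nu_N)^p=W_2(\mu,\nu_N)^2$ is the minimum of $\int\|w-w'\|^2\kappa(\mathrm{d}w,\mathrm{d}w')$ over couplings $\kappa$ of $\mu$ and $\nu_N$. $\mathcal{P}(\mathbb{R}^l)$ is the set of Borel probability measures on $\mathbb{R}^l$. Wasserstein penalty problem. Let $H_t$ be the set of histories $h_t=(x_0,u_0,\ldots,x_{t-1},u_{t-1},x_t)$ and $H_t^e$ the set of extended histories $h_t^e=(x_0,u_0,\mu_0,\ldots,x_{t-1},u_{t-1},\mu_{t-1},x_t,u_t)$. $\Pi$ is the set of sequences $\pi=(\pi_0,\pi_1,\ldots)$ of stochastic kernels $\pi_t$ from $H_t$ to $\mathbb{R}^m$ with $\pi_t(\mathcal{U}(x_t)|h_t)=1$; $\Gamma'$ is the set of sequences $\gamma=(\gamma_0,\gamma_1,\ldots)$ of stochastic kernels $\gamma_t$ from $H_t^e$ to $\mathcal{P}(\mathcal{W})$ (Player II chooses the law $\mu_t$ of $w_t$). The problem is $$\inf_{\pi\in\Pi}\sup_{\gamma\in\Gamma'}\mathbb{E}^{\pi,\gamma}\Big[\sum_{t=0}^\infty\alpha^t\big(c(x_t,u_t)-\lambda W_p(\mu_t,\nu_N)^p\big)\ \Big|\ x_0=\boldsymbol{x}\Big];$$ the optimal value function is its value as a function of $\boldsymbol{x}$, and an optimal policy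 (of Player I) attains the infimum. The Bellman operator is $$(T'_\lambda v)(\boldsymbol{x}):=\inf_{\boldsymbol{u}\in\mathcal{U}(\boldsymbol{x})}\sup_{\boldsymbol{\mu}\in\mathcal{P}(\mathcal{W})}\mathbb{E}_{w\sim\boldsymbol{\mu}}\big[c(\boldsymbol{x},\boldsymbol{u})-\lambda W_p(\boldsymbol{\mu},\nu_N)^p+\alpha v(f(\boldsymbol{x},\boldsymbol{u},w))\big].$$ An optimal policy for Player II (worst-case distribution policy) is one attaining the supremum over $\gamma\in\Gamma'$ when Player I's policy is fixed to be $\pi'(\boldsymbol{x})=K\boldsymbol{x}$; a worst-case distribution at $\boldsymbol{x}$ is one attaining the supremum over $\boldsymbol{\mu}$ in the expression defining $T'_\lambda v'$ with $\boldsymbol{u}=\pi'(\boldsymbol{x})$.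
   Formalization: Optimality of γ' for Player II is claimed at those x where the supremum over Γ' against π' is attained (it can fail otherwise). Uniqueness of π' is among stationary policies, plus the first decision of every optimal policy in Π, since uniqueness over all of Π fails off the played path. *)

theory Defs
  imports "HOL-Probability.Probability"
begin

section \<open>Expectations with values in the extended reals\<close>

text \<open>
  Difference of the expected positive and negative parts. An undefined \<open>\<infinity> - \<infinity>\<close> is given the
  value \<open>-\<infinity>\<close>: every expectation below is maximised by Player II, who may not profit
  from an undefined payoff.
\<close>

definition gain_minus_loss :: "ennreal \<Rightarrow> ennreal \<Rightarrow> ereal" where
  "gain_minus_loss g l = (if l = \<infinity> then - \<infinity> else enn2ereal g - enn2ereal l)"

definition ext_expectation :: "'a measure \<Rightarrow> ('a \<Rightarrow> ereal) \<Rightarrow> ereal" where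
  "ext_expectation M Y =
     gain_minus_loss (\<integral>\<^sup>+ \<omega>. e2ennreal (Y \<omega>) \<partial>M) (\<integral>\<^sup>+ \<omega>. e2ennreal (- Y \<omega>) \<partial>M)"

text \<open>
  \<open>E [\<Sum>t. \<alpha>\<^sup>t Y\<^sub>t]\<close>, where positive and negative parts are taken stage by stage, as is usual for
  total-reward Markov decision processes. Whenever one of the two parts is finite, Tonelli's theorem
  shows that the series has an almost surely well-defined sum, and this is its expectation.
\<close>

definition ext_discounted_expectation ::
    "real \<Rightarrow> 'a measure \<Rightarrow> (nat \<Rightarrow> 'a \<Rightarrow> ereal) \<Rightarrow> ereal" where
  "ext_discounted_expectation \<alpha> M Y =
     gain_minus_loss (\<integral>\<^sup>+ \<omega>. (\<Sum>t. ennreal (\<alpha> ^ t) * e2ennreal (Y t \<omega>)) \<partial>M)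
                     (\<integral>\<^sup>+ \<omega>. (\<Sum>t. ennreal (\<alpha> ^ t) * e2ennreal (- Y t \<omega>)) \<partial>M)"


section \<open>Empirical measures and the Wasserstein distance\<close>

definition empirical_measure :: "nat \<Rightarrow> (nat \<Rightarrow> 'w :: euclidean_space) \<Rightarrow> 'w measure" where
  "empirical_measure N wh = distr (uniform_count_measure {1..N}) borel wh"

lemma emeasure_empirical_measure:
  assumes "N \<ge> 1" and "E \<in> sets borel"
  shows "emeasure (empirical_measure N wh) E = ennreal (1 / N * (\<Sum>i = 1..N. indicator E (wh i)))"
proof -
  have "emeasure (empirical_measure N wh) E =
      emeasure (uniform_count_measure {1..N}) (wh -` E \<inter> {1..N})"
    using assms unfolding empirical_measure_def
    by (subst emeasure_distr) (auto simp: space_uniform_count_measure measurable_def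
        sets_uniform_count_measure)
  also have "\<dots> = ennreal (card (wh -` E \<inter> {1..N}) / N)"
    using assms by (subst emeasure_uniform_count_measure) auto
  also have "real (card (wh -` E \<inter> {1..N})) = (\<Sum>i = 1..N. indicator E (wh i))"
    by (simp add: indicator_def sum.If_cases Int_def vimage_def conj_commute)
  finally show ?thesis by simp
qed

abbreviation prob_measures :: "'w :: euclidean_space measure set" where
  "prob_measures \<equiv> space (prob_algebra borel)"

definition couplings ::
    "'w :: euclidean_space measure \<Rightarrow> 'w measure \<Rightarrow> ('w \<times> 'w) measure set" where
  "couplings \<mu> \<nu> = {\<kappa> \<in> space (prob_algebra (borel \<Otimes>\<^sub>M borel)).
     distr \<kappa> borel fst = \<mu> \<and> distr \<kappa> borel snd = \<nu>}"

text \<open>\<open>W\<^sub>p(\<mu>, \<nu>)\<^sup>p\<close> for the transport cost \<open>d(w, w')\<^sup>p = \<parallel>w - w'\<parallel>\<^sup>2\<close>.\<close>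

definition wasserstein_cost :: "'w :: euclidean_space measure \<Rightarrow> 'w measure \<Rightarrow> ennreal" where
  "wasserstein_cost \<mu> \<nu> = (INF \<kappa>\<in>couplings \<mu> \<nu>. \<integral>\<^sup>+ (w, w'). ennreal ((norm (w - w'))\<^sup>2) \<partial>\<kappa>)"


section \<open>The control problem with Wasserstein penalty\<close>

text \<open>
  States, controls and disturbances range over whole Euclidean spaces \<open>'x\<close>, \<open>'u\<close>, \<open>'w\<close>; in
  particular every control is admissible in every state. The set of Borel probability measures on
  \<open>'w\<close> is measurable via \<^term>\<open>prob_algebra borel\<close>, which is the Borel \<open>\<sigma>\<close>-algebra of weak
  convergence.

  A history \<open>(x\<^sub>0, u\<^sub>0, \<dots>, x\<^sub>t)\<close> is a pair of a sequence on \<open>{0..<t}\<close> and the current state; an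
  extended history \<open>(x\<^sub>0, u\<^sub>0, \<mu>\<^sub>0, \<dots>, x\<^sub>t, u\<^sub>t)\<close> is a triple of a sequence on \<open>{0..<t}\<close>, the current
  state and the current control. Player I does not see the measures chosen by Player II.
\<close>

type_synonym ('x, 'u) hist = "(nat \<Rightarrow> 'x \<times> 'u) \<times> 'x"
type_synonym ('x, 'u, 'w) stage = "'x \<times> 'u \<times> 'w measure"
type_synonym ('x, 'u, 'w) ext_hist = "(nat \<Rightarrow> ('x, 'u, 'w) stage) \<times> 'x \<times> 'u"
type_synonym ('x, 'u) policyI = "nat \<Rightarrow> ('x, 'u) hist \<Rightarrow> 'u measure"
type_synonym ('x, 'u, 'w) policyII = "nat \<Rightarrow> ('x, 'u, 'w) ext_hist \<Rightarrow> 'w measure measure"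

definition stage_space ::
    "('x :: euclidean_space, 'u :: euclidean_space, 'w :: euclidean_space) stage measure" where
  "stage_space = borel \<Otimes>\<^sub>M borel \<Otimes>\<^sub>M prob_algebra borel"

definition hist_space ::
    "nat \<Rightarrow> ('x :: euclidean_space, 'u :: euclidean_space) hist measure" where
  "hist_space t = (\<Pi>\<^sub>M s\<in>{0..<t}. borel \<Otimes>\<^sub>M borel) \<Otimes>\<^sub>M borel"

definition ext_hist_space ::
    "nat \<Rightarrow> ('x :: euclidean_space, 'u :: euclidean_space, 'w :: euclidean_space) ext_hist measure" where
  "ext_hist_space t = (\<Pi>\<^sub>M s\<in>{0..<t}. stage_space) \<Otimes>\<^sub>M borel \<Otimes>\<^sub>M borel"

definition policiesI :: "('x :: euclidean_space, 'u :: euclidean_space) policyI set" where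
  "policiesI = {\<pi>. \<forall>t. \<pi> t \<in> hist_space t \<rightarrow>\<^sub>M prob_algebra borel}"

definition policiesII ::
    "('x :: euclidean_space, 'u :: euclidean_space, 'w :: euclidean_space) policyII set" where
  "policiesII = {\<gamma>. \<forall>t. \<gamma> t \<in> ext_hist_space t \<rightarrow>\<^sub>M prob_algebra (prob_algebra borel)}"

definition forget_measures :: "nat \<Rightarrow> (nat \<Rightarrow> ('x, 'u, 'w) stage) \<Rightarrow> nat \<Rightarrow> 'x \<times> 'u" where
  "forget_measures t \<omega> = (\<lambda>s\<in>{0..<t}. case \<omega> s of (x, u, \<mu>) \<Rightarrow> (x, u))"

definition state_law ::
    "('x :: euclidean_space \<Rightarrow> 'u \<Rightarrow> 'w :: euclidean_space \<Rightarrow> 'x) \<Rightarrow> 'x \<Rightarrow> nat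
      \<Rightarrow> (nat \<Rightarrow> ('x, 'u, 'w) stage) \<Rightarrow> 'x measure" where
  "state_law f x0 t \<omega> =
     (case t of 0 \<Rightarrow> return borel x0
      | Suc s \<Rightarrow> (case \<omega> s of (x, u, \<mu>) \<Rightarrow> distr \<mu> borel (f x u)))"

definition stage_kernel ::
    "('x :: euclidean_space \<Rightarrow> 'u :: euclidean_space \<Rightarrow> 'w :: euclidean_space \<Rightarrow> 'x)
      \<Rightarrow> ('x, 'u) policyI \<Rightarrow> ('x, 'u, 'w) policyII \<Rightarrow> 'x \<Rightarrow> nat
      \<Rightarrow> (nat \<Rightarrow> ('x, 'u, 'w) stage) \<Rightarrow> ('x, 'u, 'w) stage measure" where
  "stage_kernel f \<pi> \<gamma> x0 t \<omega> =
     state_law f x0 t \<omega> \<bind> (\<lambda>x.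
     \<pi> t (forget_measures t \<omega>, x) \<bind> (\<lambda>u.
     \<gamma> t (\<omega>, x, u) \<bind> (\<lambda>\<mu>.
     return stage_space (x, u, \<mu>))))"

text \<open>The Ionescu-Tulcea measure on the infinite sequences \<open>(x\<^sub>t, u\<^sub>t, \<mu>\<^sub>t)\<^sub>t\<close>.\<close>

definition path_law ::
    "('x :: euclidean_space \<Rightarrow> 'u :: euclidean_space \<Rightarrow> 'w :: euclidean_space \<Rightarrow> 'x)
      \<Rightarrow> ('x, 'u) policyI \<Rightarrow> ('x, 'u, 'w) policyII \<Rightarrow> 'x
      \<Rightarrow> (nat \<Rightarrow> ('x, 'u, 'w) stage) measure" where
  "path_law f \<pi> \<gamma> x0 =
     projective_family.lim UNIV (Ionescu_Tulcea.CI (stage_kernel f \<pi> \<gamma> x0) (\<lambda>_. stage_space))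
       (\<lambda>_. stage_space)"

lemma Ionescu_Tulcea_stage_kernel:
  fixes f :: "'x :: euclidean_space \<Rightarrow> 'u :: euclidean_space \<Rightarrow> 'w :: euclidean_space \<Rightarrow> 'x"
  assumes f [measurable]: "(\<lambda>(x, u, w). f x u w) \<in> borel \<Otimes>\<^sub>M borel \<Otimes>\<^sub>M borel \<rightarrow>\<^sub>M borel"
    and \<pi>: "\<pi> \<in> policiesI" and \<gamma>: "\<gamma> \<in> policiesII"
  shows "Ionescu_Tulcea (stage_kernel f \<pi> \<gamma> x0) (\<lambda>_. stage_space)"
proof -
  have state: "state_law f x0 t \<in> (\<Pi>\<^sub>M s\<in>{0..<t}. stage_space) \<rightarrow>\<^sub>M prob_algebra borel" for t
  proof (cases t)
    case 0
    then have "state_law f x0 t = (\<lambda>_. return borel x0 :: 'x measure)"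
      by (simp add: state_law_def fun_eq_iff)
    then show ?thesis
      by (auto intro!: measurable_const simp: space_prob_algebra prob_space_return)
  next
    case (Suc s)
    have comp: "(\<lambda>\<omega>. \<omega> s) \<in> (\<Pi>\<^sub>M s\<in>{0..<t}. stage_space) \<rightarrow>\<^sub>M
        (borel \<Otimes>\<^sub>M borel \<Otimes>\<^sub>M prob_algebra borel :: ('x, 'u, 'w) stage measure)"
      using Suc unfolding stage_space_def by (intro measurable_component_singleton) auto
    have "(\<lambda>p. (fst (fst p), fst (snd (fst p)), snd p)) \<in>
        (borel \<Otimes>\<^sub>M borel \<Otimes>\<^sub>M prob_algebra borel) \<Otimes>\<^sub>M borel \<rightarrow>\<^sub>M borel \<Otimes>\<^sub>M borel \<Otimes>\<^sub>M borel"
      by measurable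
    from measurable_compose[OF this f]
    have "(\<lambda>p. f (fst (fst p)) (fst (snd (fst p))) (snd p)) \<in>
        (borel \<Otimes>\<^sub>M borel \<Otimes>\<^sub>M prob_algebra borel) \<Otimes>\<^sub>M borel \<rightarrow>\<^sub>M borel"
      by simp
    then have "(\<lambda>q. distr (snd (snd q)) borel (f (fst q) (fst (snd q)))) \<in>
        (borel \<Otimes>\<^sub>M borel \<Otimes>\<^sub>M prob_algebra borel) \<rightarrow>\<^sub>M prob_algebra borel"
      by (intro measurable_distr_prob_space2[where M = borel]) (auto simp: split_beta')
    then have "(\<lambda>(x, u, \<mu>). distr \<mu> borel (f x u)) \<in>
        (borel \<Otimes>\<^sub>M borel \<Otimes>\<^sub>M prob_algebra borel) \<rightarrow>\<^sub>M prob_algebra borel"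
      by (simp add: split_beta')
    from measurable_compose[OF comp this] show ?thesis
      using Suc by (simp add: state_law_def[abs_def])
  qed
  have forget: "forget_measures t \<in> (\<Pi>\<^sub>M s\<in>{0..<t}. stage_space) \<rightarrow>\<^sub>M
      (\<Pi>\<^sub>M s\<in>{0..<t}. borel \<Otimes>\<^sub>M borel :: ('x \<times> 'u) measure)" for t
    unfolding forget_measures_def stage_space_def by measurable
  have \<pi>t [measurable]: "\<pi> t \<in> (\<Pi>\<^sub>M s\<in>{0..<t}. borel \<Otimes>\<^sub>M borel) \<Otimes>\<^sub>M borel \<rightarrow>\<^sub>M prob_algebra borel" for t
    using \<pi> by (auto simp: policiesI_def hist_space_def)
  have \<gamma>t [measurable]: "\<gamma> t \<in> (\<Pi>\<^sub>M s\<in>{0..<t}. stage_space) \<Otimes>\<^sub>M borel \<Otimes>\<^sub>M borel \<rightarrow>\<^sub>M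
      prob_algebra (prob_algebra borel)" for t
    using \<gamma> by (auto simp: policiesII_def ext_hist_space_def)
  note state [measurable] forget [measurable]
  have ret [measurable]: "(\<lambda>p. (snd (fst (fst p)), snd (fst p), snd p)) \<in>
      (((\<Pi>\<^sub>M s\<in>{0..<t}. stage_space) \<Otimes>\<^sub>M borel) \<Otimes>\<^sub>M borel) \<Otimes>\<^sub>M prob_algebra borel \<rightarrow>\<^sub>M
      (stage_space :: ('x, 'u, 'w) stage measure)" for t
    unfolding stage_space_def by measurable
  have kernel: "stage_kernel f \<pi> \<gamma> x0 t \<in>
      (\<Pi>\<^sub>M s\<in>{0..<t}. stage_space) \<rightarrow>\<^sub>M prob_algebra stage_space" for t
    unfolding stage_kernel_def by measurable
  show ?thesis
  proof (rule Ionescu_Tulcea.intro)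
    show "stage_kernel f \<pi> \<gamma> x0 t \<in>
        (\<Pi>\<^sub>M s\<in>{0..<t}. stage_space) \<rightarrow>\<^sub>M subprob_algebra stage_space" for t
      using kernel by (rule measurable_prob_algebraD)
    show "prob_space (stage_kernel f \<pi> \<gamma> x0 t \<omega>)"
      if \<omega>: "\<omega> \<in> space (\<Pi>\<^sub>M s\<in>{0..<t}. stage_space)" for t \<omega>
      using measurable_space[OF kernel \<omega>] by (simp add: space_prob_algebra)
  qed
qed

definition stage_payoff ::
    "('x \<Rightarrow> 'u \<Rightarrow> real) \<Rightarrow> real \<Rightarrow> 'w :: euclidean_space measure \<Rightarrow> ('x, 'u, 'w) stage \<Rightarrow> ereal" where
  "stage_payoff c lam \<nu> = (\<lambda>(x, u, \<mu>). ereal (c x u) - ereal lam * enn2ereal (wasserstein_cost \<mu> \<nu>))"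

text \<open>
  In the following definitions, \<open>f\<close> is the system function, \<open>c\<close> the stage cost, \<open>\<alpha>\<close> the discount
  factor, \<open>lam\<close> the penalty parameter and \<open>\<nu>\<close> the nominal disturbance distribution.
\<close>

definition total_payoff ::
    "('x :: euclidean_space \<Rightarrow> 'u :: euclidean_space \<Rightarrow> 'w :: euclidean_space \<Rightarrow> 'x)
      \<Rightarrow> ('x \<Rightarrow> 'u \<Rightarrow> real) \<Rightarrow> real \<Rightarrow> real \<Rightarrow> 'w measure
      \<Rightarrow> ('x, 'u) policyI \<Rightarrow> ('x, 'u, 'w) policyII \<Rightarrow> 'x \<Rightarrow> ereal" where
  "total_payoff f c \<alpha> lam \<nu> \<pi> \<gamma> x =
     ext_discounted_expectation \<alpha> (path_law f \<pi> \<gamma> x) (\<lambda>t \<omega>. stage_payoff c lam \<nu> (\<omega> t))"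

definition worst_payoff ::
    "('x :: euclidean_space \<Rightarrow> 'u :: euclidean_space \<Rightarrow> 'w :: euclidean_space \<Rightarrow> 'x)
      \<Rightarrow> ('x \<Rightarrow> 'u \<Rightarrow> real) \<Rightarrow> real \<Rightarrow> real \<Rightarrow> 'w measure
      \<Rightarrow> ('x, 'u) policyI \<Rightarrow> 'x \<Rightarrow> ereal" where
  "worst_payoff f c \<alpha> lam \<nu> \<pi> x = (SUP \<gamma>\<in>policiesII. total_payoff f c \<alpha> lam \<nu> \<pi> \<gamma> x)"

definition optimal_value ::
    "('x :: euclidean_space \<Rightarrow> 'u :: euclidean_space \<Rightarrow> 'w :: euclidean_space \<Rightarrow> 'x)
      \<Rightarrow> ('x \<Rightarrow> 'u \<Rightarrow> real) \<Rightarrow> real \<Rightarrow> real \<Rightarrow> 'w measure \<Rightarrow> 'x \<Rightarrow> ereal" where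
  "optimal_value f c \<alpha> lam \<nu> x = (INF \<pi>\<in>policiesI. worst_payoff f c \<alpha> lam \<nu> \<pi> x)"

definition optimal_policyI ::
    "('x :: euclidean_space \<Rightarrow> 'u :: euclidean_space \<Rightarrow> 'w :: euclidean_space \<Rightarrow> 'x)
      \<Rightarrow> ('x \<Rightarrow> 'u \<Rightarrow> real) \<Rightarrow> real \<Rightarrow> real \<Rightarrow> 'w measure
      \<Rightarrow> ('x, 'u) policyI \<Rightarrow> bool" where
  "optimal_policyI f c \<alpha> lam \<nu> \<pi> \<longleftrightarrow>
     \<pi> \<in> policiesI \<and> (\<forall>x. worst_payoff f c \<alpha> lam \<nu> \<pi> x = optimal_value f c \<alpha> lam \<nu> x)"

text \<open>A policy of Player II that is optimal, from the initial state \<open>x\<close>, against the fixed \<open>\<pi>\<close>.\<close>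

definition optimal_policyII_at ::
    "('x :: euclidean_space \<Rightarrow> 'u :: euclidean_space \<Rightarrow> 'w :: euclidean_space \<Rightarrow> 'x)
      \<Rightarrow> ('x \<Rightarrow> 'u \<Rightarrow> real) \<Rightarrow> real \<Rightarrow> real \<Rightarrow> 'w measure
      \<Rightarrow> ('x, 'u) policyI \<Rightarrow> ('x, 'u, 'w) policyII \<Rightarrow> 'x \<Rightarrow> bool" where
  "optimal_policyII_at f c \<alpha> lam \<nu> \<pi> \<gamma> x \<longleftrightarrow>
     \<gamma> \<in> policiesII \<and> total_payoff f c \<alpha> lam \<nu> \<pi> \<gamma> x = worst_payoff f c \<alpha> lam \<nu> \<pi> x"

definition stationary_policyI ::
    "('x :: euclidean_space, 'u :: euclidean_space) policyI \<Rightarrow> bool" where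
  "stationary_policyI \<pi> \<longleftrightarrow>
     (\<exists>\<phi>. \<phi> \<in> borel \<rightarrow>\<^sub>M prob_algebra borel \<and> (\<forall>t. \<forall>(h, x)\<in>space (hist_space t). \<pi> t (h, x) = \<phi> x))"

definition det_stationary_policyI ::
    "('x \<Rightarrow> 'u :: euclidean_space) \<Rightarrow> ('x, 'u) policyI" where
  "det_stationary_policyI k = (\<lambda>t (h, x). return borel (k x))"

definition det_stationary_policyII ::
    "('x \<Rightarrow> 'w :: euclidean_space measure) \<Rightarrow> ('x, 'u, 'w) policyII" where
  "det_stationary_policyII g = (\<lambda>t (h, x, u). return (prob_algebra borel) (g x))"

definition bellman_payoff ::
    "('x \<Rightarrow> 'u \<Rightarrow> 'w :: euclidean_space \<Rightarrow> 'x)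
      \<Rightarrow> ('x \<Rightarrow> 'u \<Rightarrow> real) \<Rightarrow> real \<Rightarrow> real \<Rightarrow> 'w measure
      \<Rightarrow> ('x \<Rightarrow> ereal) \<Rightarrow> 'x \<Rightarrow> 'u \<Rightarrow> 'w measure \<Rightarrow> ereal" where
  "bellman_payoff f c \<alpha> lam \<nu> v x u \<mu> =
     ext_expectation \<mu> (\<lambda>w. stage_payoff c lam \<nu> (x, u, \<mu>) + ereal \<alpha> * v (f x u w))"

definition bellman_operator ::
    "('x \<Rightarrow> 'u \<Rightarrow> 'w :: euclidean_space \<Rightarrow> 'x)
      \<Rightarrow> ('x \<Rightarrow> 'u \<Rightarrow> real) \<Rightarrow> real \<Rightarrow> real \<Rightarrow> 'w measure
      \<Rightarrow> ('x \<Rightarrow> ereal) \<Rightarrow> 'x \<Rightarrow> ereal" where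
  "bellman_operator f c \<alpha> lam \<nu> v x =
     (INF u. SUP \<mu>\<in>prob_measures. bellman_payoff f c \<alpha> lam \<nu> v x u \<mu>)"

definition worst_case_distribution ::
    "('x \<Rightarrow> 'u \<Rightarrow> 'w :: euclidean_space \<Rightarrow> 'x)
      \<Rightarrow> ('x \<Rightarrow> 'u \<Rightarrow> real) \<Rightarrow> real \<Rightarrow> real \<Rightarrow> 'w measure
      \<Rightarrow> ('x \<Rightarrow> ereal) \<Rightarrow> 'x \<Rightarrow> 'u \<Rightarrow> 'w measure \<Rightarrow> bool" where
  "worst_case_distribution f c \<alpha> lam \<nu> v x u \<mu> \<longleftrightarrow>
     \<mu> \<in> prob_measures \<and>
     bellman_payoff f c \<alpha> lam \<nu> v x u \<mu> = (SUP \<mu>'\<in>prob_measures. bellman_payoff f c \<alpha> lam \<nu> v x u \<mu>')"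


section \<open>The linear-quadratic data\<close>

definition pos_semidef :: "real ^ 'n ^ 'n \<Rightarrow> bool" where
  "pos_semidef M \<longleftrightarrow> transpose M = M \<and> (\<forall>x. 0 \<le> x \<bullet> (M *v x))"

definition pos_def :: "real ^ 'n ^ 'n \<Rightarrow> bool" where
  "pos_def M \<longleftrightarrow> transpose M = M \<and> (\<forall>x. x \<noteq> 0 \<longrightarrow> 0 < x \<bullet> (M *v x))"

definition linear_system ::
    "real ^ 'n ^ 'n \<Rightarrow> real ^ 'm ^ 'n \<Rightarrow> real ^ 'l ^ 'n
      \<Rightarrow> real ^ 'n \<Rightarrow> real ^ 'm \<Rightarrow> real ^ 'l \<Rightarrow> real ^ 'n" where
  "linear_system A B \<Xi> x u w = A *v x + B *v u + \<Xi> *v w"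

definition quadratic_cost ::
    "real ^ 'n ^ 'n \<Rightarrow> real ^ 'm ^ 'm \<Rightarrow> real ^ 'n \<Rightarrow> real ^ 'm \<Rightarrow> real" where
  "quadratic_cost Q R x u = x \<bullet> (Q *v x) + u \<bullet> (R *v u)"

definition sample_covariance :: "nat \<Rightarrow> (nat \<Rightarrow> real ^ 'l) \<Rightarrow> real ^ 'l ^ 'l" where
  "sample_covariance N wh = (\<chi> a b. 1 / N * (\<Sum>i = 1..N. wh i $ a * wh i $ b))"

text \<open>\<open>\<lambda> I - \<alpha> \<Xi>\<^sup>T P \<Xi>\<close>\<close>

definition penalty_matrix :: "real \<Rightarrow> real \<Rightarrow> real ^ 'l ^ 'n \<Rightarrow> real ^ 'n ^ 'n \<Rightarrow> real ^ 'l ^ 'l" where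
  "penalty_matrix \<alpha> lam \<Xi> P = lam *\<^sub>R mat 1 - \<alpha> *\<^sub>R (transpose \<Xi> ** P ** \<Xi>)"

text \<open>\<open>I + \<alpha> \<Xi> (\<lambda> I - \<alpha> \<Xi>\<^sup>T P \<Xi>)\<^sup>-\<^sup>1 \<Xi>\<^sup>T P\<close>\<close>

definition amplification_matrix ::
    "real \<Rightarrow> real \<Rightarrow> real ^ 'l ^ 'n \<Rightarrow> real ^ 'n ^ 'n \<Rightarrow> real ^ 'n ^ 'n" where
  "amplification_matrix \<alpha> lam \<Xi> P =
     mat 1 + \<alpha> *\<^sub>R (\<Xi> ** matrix_inv (penalty_matrix \<alpha> lam \<Xi> P) ** transpose \<Xi> ** P)"

text \<open>\<open>R + \<alpha> B\<^sup>T {P + \<alpha> P \<Xi> (\<lambda> I - \<alpha> \<Xi>\<^sup>T P \<Xi>)\<^sup>-\<^sup>1 \<Xi>\<^sup>T P} B\<close>\<close>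

definition control_matrix ::
    "real \<Rightarrow> real \<Rightarrow> real ^ 'm ^ 'n \<Rightarrow> real ^ 'l ^ 'n \<Rightarrow> real ^ 'm ^ 'm \<Rightarrow> real ^ 'n ^ 'n
      \<Rightarrow> real ^ 'm ^ 'm" where
  "control_matrix \<alpha> lam B \<Xi> R P =
     R + \<alpha> *\<^sub>R (transpose B **
           (P + \<alpha> *\<^sub>R (P ** \<Xi> ** matrix_inv (penalty_matrix \<alpha> lam \<Xi> P) ** transpose \<Xi> ** P)) ** B)"

definition riccati_S ::
    "real \<Rightarrow> real \<Rightarrow> real ^ 'm ^ 'n \<Rightarrow> real ^ 'l ^ 'n \<Rightarrow> real ^ 'm ^ 'm \<Rightarrow> real ^ 'n ^ 'n
      \<Rightarrow> real ^ 'n ^ 'n" where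
  "riccati_S \<alpha> lam B \<Xi> R P =
     P ** \<Xi> ** matrix_inv (penalty_matrix \<alpha> lam \<Xi> P) ** transpose \<Xi> ** P
     - transpose (amplification_matrix \<alpha> lam \<Xi> P) ** P ** B
       ** matrix_inv (control_matrix \<alpha> lam B \<Xi> R P)
       ** transpose B ** P ** amplification_matrix \<alpha> lam \<Xi> P"

definition riccati_equation ::
    "real \<Rightarrow> real \<Rightarrow> real ^ 'n ^ 'n \<Rightarrow> real ^ 'm ^ 'n \<Rightarrow> real ^ 'l ^ 'n \<Rightarrow> real ^ 'n ^ 'n
      \<Rightarrow> real ^ 'm ^ 'm \<Rightarrow> real ^ 'n ^ 'n \<Rightarrow> bool" where
  "riccati_equation \<alpha> lam A B \<Xi> Q R P \<longleftrightarrow>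
     P = Q + \<alpha> *\<^sub>R (transpose A ** P ** A)
         + \<alpha>\<^sup>2 *\<^sub>R (transpose A ** riccati_S \<alpha> lam B \<Xi> R P ** A)"

definition gain_matrix ::
    "real \<Rightarrow> real \<Rightarrow> real ^ 'n ^ 'n \<Rightarrow> real ^ 'm ^ 'n \<Rightarrow> real ^ 'l ^ 'n \<Rightarrow> real ^ 'm ^ 'm
      \<Rightarrow> real ^ 'n ^ 'n \<Rightarrow> real ^ 'n ^ 'm" where
  "gain_matrix \<alpha> lam A B \<Xi> R P =
     - (matrix_inv (control_matrix \<alpha> lam B \<Xi> R P)
        ** (\<alpha> *\<^sub>R (transpose B ** transpose P)) ** amplification_matrix \<alpha> lam \<Xi> P ** A)"

definition value_offset ::
    "real \<Rightarrow> real \<Rightarrow> real ^ 'l ^ 'n \<Rightarrow> real ^ 'l ^ 'l \<Rightarrow> real ^ 'n ^ 'n \<Rightarrow> real" where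
  "value_offset \<alpha> lam \<Xi> \<Sigma> P =
     lam / (1 - \<alpha>) * trace ((lam *\<^sub>R matrix_inv (penalty_matrix \<alpha> lam \<Xi> P) - mat 1) ** \<Sigma>)"

definition worst_sample ::
    "real \<Rightarrow> real \<Rightarrow> real ^ 'n ^ 'n \<Rightarrow> real ^ 'm ^ 'n \<Rightarrow> real ^ 'l ^ 'n \<Rightarrow> real ^ 'n ^ 'n
      \<Rightarrow> real ^ 'n ^ 'm \<Rightarrow> (nat \<Rightarrow> real ^ 'l) \<Rightarrow> real ^ 'n \<Rightarrow> nat \<Rightarrow> real ^ 'l" where
  "worst_sample \<alpha> lam A B \<Xi> P K wh x i =
     matrix_inv (penalty_matrix \<alpha> lam \<Xi> P) *v
       (\<alpha> *\<^sub>R ((transpose \<Xi> ** P ** (A + B ** K)) *v x) + lam *\<^sub>R wh i)"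

end

theory Submission
  imports Defs
begin

text \<open>
  Write \<open>M = \<lambda>I - \<alpha>\<Xi>\<^sup>TP\<Xi>\<close>. For a fixed post-control state \<open>y = Ax + Bu\<close>, the function
  \<open>w \<mapsto> \<alpha>(y + \<Xi>w)\<^sup>TP(y + \<Xi>w) - \<lambda>\<parallel>w - a\<parallel>\<^sup>2\<close> equals its maximum minus \<open>(w - w\<^sup>*)\<^sup>TM(w - w\<^sup>*)\<close>. Integrated over a
  coupling of \<open>\<mu>\<close> and \<open>\<nu>\<close>, this identity gives weak duality with a quantitative slack, and completing the
  square in \<open>u\<close> then yields the Bellman equation.

  Since \<open>V(x) = x\<^sup>TPx + z\<close> is nonnegative, telescoping the Bellman inequality along the path shows that the
  linear feedback never pays more than \<open>V\<close>. If some \<open>\<gamma>\<close> attains \<open>V\<close> against it, the slack vanishes along the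
  path, so \<open>\<gamma>\<close> plays the worst-case distributions almost surely and generates the same stage laws as \<open>\<gamma>'\<close>.

  For uniqueness, Player II plays the worst-case answers of the problem with horizon \<open>T\<close>, whose values are the
  value iterates \<open>v\<^sub>T\<close> started from 0. These increase to a quadratic supersolution below \<open>V\<close>, which bounds the
  optimal value from above and hence equals \<open>V\<close> if \<open>V\<close> is the optimal value. In the limit, an optimal policy
  cannot lose the strictly positive excess that any control other than \<open>Kx\<close> causes at time 0.
\<close>

section \<open>Quadratic forms and the Riccati map\<close>

text \<open>Against the infinite-horizon answer \<gamma>' the telescoped Bellman equation keeps a
  remainder \<alpha>^T E V(x_T), and nothing forces it to vanish. So lower bounds come from finite
  horizons, where the iterates start at 0 and leave no remainder, and \<gamma>' is claimed optimal
  only where some answer attains the supremum. Undefined payoffs count as -\<infinity>, hence a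
  lower bound also requires losses of finite expectation; gains and losses are kept on opposite
  sides of inequalities in \<open>ennreal\<close>. The slack is an integral over a coupling, which
  is neither a function of \<mu> nor visibly measurable in it. It is replaced by the squared
  difference of the integrals of one bounded Lipschitz function against \<mu> and the worst-case
  distribution; countably many such functions determine \<mu>. A general optimal policy is pinned
  down only at time 0, since later kernels are free on histories that it does not reach;
  stationarity carries the time-0 kernel to all times.\<close>

abbreviation quad :: "real ^ 'n ^ 'n \<Rightarrow> real ^ 'n \<Rightarrow> real" where
  "quad M x \<equiv> x \<bullet> (M *v x)"

lemma inner_transpose_mult:
  fixes A :: "real ^ 'n ^ 'm"
  shows "(transpose A *v x) \<bullet> y = x \<bullet> (A *v y)"
  by (simp add: dot_lmul_matrix)

lemma inner_symmetric_mult: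
  fixes M :: "real ^ 'n ^ 'n"
  assumes "transpose M = M"
  shows "x \<bullet> (M *v y) = y \<bullet> (M *v x)"
  using inner_transpose_mult[of M x y] assms by (simp add: inner_commute)

lemma symmetric_if_inner:
  fixes M :: "real ^ 'n ^ 'n"
  assumes "\<And>x y. x \<bullet> (M *v y) = y \<bullet> (M *v x)"
  shows "transpose M = M"
proof -
  have "(transpose M *v x) \<bullet> y = (M *v x) \<bullet> y" for x y
    by (rule trans[OF inner_transpose_mult trans[OF assms inner_commute]])
  then have "transpose M *v x = M *v x" for x
    using vector_eq_rdot[of "transpose M *v x" "M *v x"] by blast
  then show ?thesis by (subst matrix_eq) blast
qed

lemma quad_diff:
  fixes M :: "real ^ 'n ^ 'n"
  assumes "transpose M = M"
  shows "quad M (x - y) = quad M x - 2 * (y \<bullet> (M *v x)) + quad M y"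
  using inner_symmetric_mult[OF assms, of x y]
  by (simp add: algebra_simps matrix_vector_mult_diff_distrib)

lemma quad_add:
  fixes M :: "real ^ 'n ^ 'n"
  assumes "transpose M = M"
  shows "quad M (x + y) = quad M x + 2 * (y \<bullet> (M *v x)) + quad M y"
  using inner_symmetric_mult[OF assms, of x y]
  by (simp add: algebra_simps)

lemma quad_scaleR: "quad M (s *\<^sub>R x) = s\<^sup>2 * quad M x"
  by (simp add: matrix_vector_mult_scaleR power2_eq_square)

lemma pos_def_symmetric: "pos_def M \<Longrightarrow> transpose M = M"
  and pos_semidef_symmetric: "pos_semidef M \<Longrightarrow> transpose M = M"
  by (auto simp: pos_def_def pos_semidef_def)

lemma pos_semidef_nonneg: "pos_semidef M \<Longrightarrow> 0 \<le> quad M x"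
  by (auto simp: pos_semidef_def)

lemma pos_def_nonneg: "pos_def M \<Longrightarrow> 0 \<le> quad M x"
  by (cases "x = 0") (auto simp: pos_def_def less_imp_le)

lemma pos_def_matrix_inv:
  fixes M :: "real ^ 'n ^ 'n"
  assumes "pos_def M"
  shows "M *v (matrix_inv M *v x) = x" and "matrix_inv M *v (M *v x) = x"
proof -
  have "x = 0" if "M *v x = 0" for x
    using assms that by (cases "x = 0") (auto simp: pos_def_def dest: spec[of _ x])
  then have "invertible M"
    by (simp add: invertible_left_inverse matrix_left_invertible_ker)
  then have "M ** matrix_inv M = mat 1 \<and> matrix_inv M ** M = mat 1"
    unfolding matrix_inv_def invertible_def by (rule someI_ex)
  then show "M *v (matrix_inv M *v x) = x" and "matrix_inv M *v (M *v x) = x"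
    unfolding matrix_vector_mul_assoc by simp_all
qed

lemma symmetric_matrix_inv:
  fixes M :: "real ^ 'n ^ 'n"
  assumes "pos_def M"
  shows "transpose (matrix_inv M) = matrix_inv M"
proof (rule symmetric_if_inner)
  fix x y
  have "x \<bullet> (matrix_inv M *v y) = (M *v (matrix_inv M *v x)) \<bullet> (matrix_inv M *v y)"
    by (simp add: pos_def_matrix_inv[OF assms])
  also have "\<dots> = (matrix_inv M *v x) \<bullet> (M *v (matrix_inv M *v y))"
    using inner_symmetric_mult[OF pos_def_symmetric[OF assms]] by (metis inner_commute)
  also have "\<dots> = y \<bullet> (matrix_inv M *v x)"
    by (simp add: pos_def_matrix_inv[OF assms] inner_commute)
  finally show "x \<bullet> (matrix_inv M *v y) = y \<bullet> (matrix_inv M *v x)" .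
qed

lemma complete_square:
  fixes M :: "real ^ 'n ^ 'n"
  assumes "pos_def M"
  shows "quad M w - 2 * (b \<bullet> w) = quad M (w - matrix_inv M *v b) - quad (matrix_inv M) b"
  using quad_diff[OF pos_def_symmetric[OF assms], of w "matrix_inv M *v b"]
    inner_symmetric_mult[OF pos_def_symmetric[OF assms], of "matrix_inv M *v b" w]
  by (simp add: pos_def_matrix_inv[OF assms] inner_commute)

text \<open>The minimum over the compact unit sphere is positive and extends to all vectors by
  homogeneity. Applied to \<open>pen P\<close> it quantifies the slack, applied to \<open>R\<close>
  it confines controls of bounded cost.\<close>

lemma pos_def_coercive:
  fixes M :: "real ^ 'n ^ 'n"
  assumes "pos_def M"
  obtains m where "0 < m" and "\<And>x. m * (norm x)\<^sup>2 \<le> quad M x"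
proof -
  have "continuous_on (sphere 0 1) (quad M)"
    by (intro continuous_intros linear_continuous_on matrix_vector_mul_bounded_linear)
  moreover have "sphere (0 :: real ^ 'n) 1 \<noteq> {}" by simp
  ultimately obtain e where e: "e \<in> sphere 0 1" "\<And>x. x \<in> sphere 0 1 \<Longrightarrow> quad M e \<le> quad M x"
    using continuous_attains_inf[of "sphere (0 :: real ^ 'n) 1" "quad M"] by auto
  show ?thesis
  proof
    have "e \<noteq> 0" using e(1) by auto
    then show "0 < quad M e" using assms unfolding pos_def_def by blast
    show "quad M e * (norm x)\<^sup>2 \<le> quad M x" for x
    proof (cases "x = 0")
      case False
      then have "quad M e * (norm x)\<^sup>2 \<le> quad M ((1 / norm x) *\<^sub>R x) * (norm x)\<^sup>2"
        by (intro mult_right_mono e(2)) auto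
      also have "\<dots> = quad M x" using False by (simp only: quad_scaleR) (simp add: field_simps)
      finally show ?thesis .
    qed simp
  qed
qed

lemma quad_borel [measurable]: "quad M \<in> borel_measurable borel"
  by (intro borel_measurable_continuous_onI continuous_intros linear_continuous_on
      matrix_vector_mul_bounded_linear)

lemma borel_measurable_mult_vector [measurable]: "(\<lambda>x. M *v x) \<in> borel \<rightarrow>\<^sub>M borel"
  for M :: "real ^ 'a ^ 'b"
  by (intro borel_measurable_continuous_onI linear_continuous_on matrix_vector_mul_bounded_linear)

lemma continuous_on_mult_vector [continuous_intros]:
  fixes M :: "real ^ 'i ^ 'j"
  shows "continuous_on S g \<Longrightarrow> continuous_on S (\<lambda>x. M *v g x)"
  by (rule bounded_linear.continuous_on[OF matrix_vector_mul_bounded_linear])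

lemma transpose_add_matrix: "transpose (X + Y :: real ^ 'a ^ 'b) = transpose X + transpose Y"
  by (simp add: transpose_def vec_eq_iff)

text \<open>Turns the trace in \<open>value_offset\<close> into a sample average, the form in which
  the maximised objectives produce it.\<close>

lemma trace_mult_sample_covariance:
  "trace (X ** sample_covariance N wh) = 1 / N * (\<Sum>i = 1..N. quad X (wh i))"
proof -
  have "trace (X ** sample_covariance N wh)
      = (\<Sum>a\<in>UNIV. \<Sum>b\<in>UNIV. \<Sum>i = 1..N. 1 / N * (X $ a $ b * (wh i $ b * wh i $ a)))"
    by (simp add: trace_def matrix_matrix_mult_def sample_covariance_def sum_distrib_left
        mult_ac)
  also have "\<dots> = (\<Sum>a\<in>UNIV. \<Sum>i = 1..N. \<Sum>b\<in>UNIV. 1 / N * (X $ a $ b * (wh i $ b * wh i $ a)))"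
    by (intro sum.cong refl sum.swap)
  also have "\<dots> = (\<Sum>i = 1..N. \<Sum>a\<in>UNIV. \<Sum>b\<in>UNIV. 1 / N * (X $ a $ b * (wh i $ b * wh i $ a)))"
    by (rule sum.swap)
  also have "\<dots> = 1 / N * (\<Sum>i = 1..N. quad X (wh i))"
    by (simp add: inner_vec_def matrix_vector_mult_def sum_distrib_left mult_ac)
  finally show ?thesis .
qed

section \<open>The one-stage problem for a fixed quadratic continuation\<close>

locale wasserstein_lq =
  fixes A :: "real ^ 'n ^ 'n" and B :: "real ^ 'm ^ 'n" and \<Xi> :: "real ^ 'l ^ 'n"
    and Q :: "real ^ 'n ^ 'n" and R :: "real ^ 'm ^ 'm" and \<alpha> lam :: real
    and N :: nat and wh :: "nat \<Rightarrow> real ^ 'l"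
  assumes \<alpha>: "0 < \<alpha>" "\<alpha> < 1" and lam: "0 < lam"
    and Q: "pos_semidef Q" and R: "pos_def R"
    and N: "1 \<le> N" and mean: "(\<Sum>i = 1..N. wh i) = 0"
begin

abbreviation "pen \<equiv> penalty_matrix \<alpha> lam \<Xi>"
abbreviation "ctl \<equiv> control_matrix \<alpha> lam B \<Xi> R"
abbreviation "gain \<equiv> gain_matrix \<alpha> lam A B \<Xi> R"
abbreviation "f \<equiv> linear_system A B \<Xi>"
abbreviation "c \<equiv> quadratic_cost Q R"

text \<open>Positive definiteness of \<open>pen P\<close> is strict concavity of
  \<open>objective P y a\<close> in the disturbance, so that the inner supremum is finite and
  attained at a single point.\<close>

definition admissible :: "real ^ 'n ^ 'n \<Rightarrow> bool" where
  "admissible P \<longleftrightarrow> pos_semidef P \<and> pos_def (pen P)"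

text \<open>The maximiser of \<open>objective P y a\<close>, from its gradient condition. For y = (A
  + BK)x and a = \<open>wh i\<close> it is the \<open>worst_sample\<close> of the theorem.\<close>

definition response :: "real ^ 'n ^ 'n \<Rightarrow> real ^ 'n \<Rightarrow> real ^ 'l \<Rightarrow> real ^ 'l" where
  "response P y a = matrix_inv (pen P) *v (\<alpha> *\<^sub>R (transpose \<Xi> *v (P *v y)) + lam *\<^sub>R a)"

text \<open>Player II's gain from moving unit mass from the sample a to w, where y is the next state
  without disturbance; the constant part of the value is left out.\<close>

definition objective :: "real ^ 'n ^ 'n \<Rightarrow> real ^ 'n \<Rightarrow> real ^ 'l \<Rightarrow> real ^ 'l \<Rightarrow> real" where
  "objective P y a w = \<alpha> * quad P (y + \<Xi> *v w) - lam * (norm (w - a))\<^sup>2"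

text \<open>The maximum of \<open>objective P y 0\<close> over disturbances is \<alpha> times this
  form at y: it is the cost matrix after Player II's best answer to a zero sample.\<close>

definition robust_matrix :: "real ^ 'n ^ 'n \<Rightarrow> real ^ 'n ^ 'n" where
  "robust_matrix P = P + \<alpha> *\<^sub>R (P ** \<Xi> ** matrix_inv (pen P) ** transpose \<Xi> ** P)"

text \<open>The part of the averaged maxima that does not depend on the state; it equals (1 -
  \<alpha>) z for the z of the theorem.\<close>

definition noise_value :: "real ^ 'n ^ 'n \<Rightarrow> real" where
  "noise_value P = lam * trace ((lam *\<^sub>R matrix_inv (pen P) - mat 1) ** sample_covariance N wh)"

definition worst_gain :: "real ^ 'n ^ 'n \<Rightarrow> real ^ 'n \<Rightarrow> real" where
  "worst_gain P y = \<alpha> * quad (robust_matrix P) y + noise_value P"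

definition riccati :: "real ^ 'n ^ 'n \<Rightarrow> real ^ 'n ^ 'n" where
  "riccati P = Q + \<alpha> *\<^sub>R (transpose A ** P ** A)
     + \<alpha>\<^sup>2 *\<^sub>R (transpose A ** riccati_S \<alpha> lam B \<Xi> R P ** A)"

lemma pen_mult: "pen P *v w = lam *\<^sub>R w - \<alpha> *\<^sub>R (transpose \<Xi> *v (P *v (\<Xi> *v w)))"
  unfolding penalty_matrix_def
  by (simp add: matrix_vector_mult_diff_rdistrib scaleR_matrix_vector_assoc[symmetric]
      matrix_vector_mul_assoc[symmetric] del: transpose_matrix_vector)

lemma objective_response:
  assumes "admissible P"
  shows "objective P y a w = objective P y a (response P y a) - quad (pen P) (w - response P y a)"
proof -
  have P: "transpose P = P" and M: "pos_def (pen P)"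
    using assms by (auto simp: admissible_def pos_semidef_def)
  define b where "b = \<alpha> *\<^sub>R (transpose \<Xi> *v (P *v y)) + lam *\<^sub>R a"
  have *: "objective P y a w = \<alpha> * quad P y - lam * (norm a)\<^sup>2 - (quad (pen P) w - 2 * (b \<bullet> w))" for w
  proof -
    have "(norm (w - a))\<^sup>2 = w \<bullet> w - 2 * (a \<bullet> w) + (norm a)\<^sup>2"
      by (simp add: power2_norm_eq_inner algebra_simps inner_commute)
    moreover have "w \<bullet> (transpose \<Xi> *v (P *v (\<Xi> *v w))) = quad P (\<Xi> *v w)"
      using inner_transpose_mult[of \<Xi> "P *v (\<Xi> *v w)" w] by (metis inner_commute)
    moreover have "b \<bullet> w = \<alpha> * ((\<Xi> *v w) \<bullet> (P *v y)) + lam * (a \<bullet> w)"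
      using inner_transpose_mult[of \<Xi> "P *v y" w]
      by (simp add: b_def inner_add_left inner_add_right inner_commute del: transpose_matrix_vector)
    moreover have "quad (pen P) w
        = lam * (w \<bullet> w) - \<alpha> * (w \<bullet> (transpose \<Xi> *v (P *v (\<Xi> *v w))))"
      by (simp add: pen_mult inner_diff_right del: transpose_matrix_vector)
    ultimately show ?thesis
      unfolding objective_def quad_add[OF P] by algebra
  qed
  show ?thesis
    unfolding *[of w] *[of "response P y a"] complete_square[OF M, of _ b]
    by (simp add: response_def b_def)
qed

text \<open>The expansion of \<open>objective_response\<close> evaluated at w = 0, where the
  objective is explicit and the square becomes the inverse form.\<close>

lemma objective_max:
  assumes "admissible P"
  shows "objective P y a (response P y a) =
    \<alpha> * quad P y - lam * (norm a)\<^sup>2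
      + quad (matrix_inv (pen P)) (\<alpha> *\<^sub>R (transpose \<Xi> *v (P *v y)) + lam *\<^sub>R a)"
proof -
  have M: "pos_def (pen P)" and P: "transpose P = P"
    using assms by (auto simp: admissible_def pos_semidef_def)
  let ?b = "\<alpha> *\<^sub>R (transpose \<Xi> *v (P *v y)) + lam *\<^sub>R a"
  have "objective P y a 0 = \<alpha> * quad P y - lam * (norm a)\<^sup>2"
    by (simp add: objective_def)
  moreover have "quad (pen P) (0 - response P y a) = quad (matrix_inv (pen P)) ?b"
    using complete_square[OF M, of 0 ?b] by (simp add: response_def)
  ultimately show ?thesis
    using objective_response[OF assms, of y a 0] by simp
qed

lemma robust_matrix_mult:
  "robust_matrix P *v y =
    P *v y + \<alpha> *\<^sub>R (P *v (\<Xi> *v (matrix_inv (pen P) *v (transpose \<Xi> *v (P *v y)))))"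
  unfolding robust_matrix_def
  by (simp add: matrix_vector_mult_add_rdistrib scaleR_matrix_vector_assoc[symmetric]
      matrix_vector_mul_assoc[symmetric] del: transpose_matrix_vector)

lemma quad_robust_matrix:
  assumes "transpose P = P"
  shows "quad (robust_matrix P) y
    = quad P y + \<alpha> * quad (matrix_inv (pen P)) (transpose \<Xi> *v (P *v y))"
proof -
  have "y \<bullet> (P *v (\<Xi> *v w)) = (transpose \<Xi> *v (P *v y)) \<bullet> w" for w
    using inner_symmetric_mult[OF assms, of y "\<Xi> *v w"] inner_transpose_mult[of \<Xi> "P *v y" w]
    by (simp add: inner_commute del: transpose_matrix_vector)
  then show ?thesis
    by (simp add: robust_matrix_mult inner_add_right del: transpose_matrix_vector)
qed

lemma symmetric_robust_matrix:
  assumes "admissible P"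
  shows "transpose (robust_matrix P) = robust_matrix P"
proof (rule symmetric_if_inner)
  have M: "pos_def (pen P)" and P: "transpose P = P"
    using assms by (auto simp: admissible_def pos_semidef_def)
  have *: "x \<bullet> (robust_matrix P *v y) = x \<bullet> (P *v y)
      + \<alpha> * ((transpose \<Xi> *v (P *v x)) \<bullet> (matrix_inv (pen P) *v (transpose \<Xi> *v (P *v y))))" for x y
  proof -
    have "x \<bullet> (P *v (\<Xi> *v w)) = (transpose \<Xi> *v (P *v x)) \<bullet> w" for w
      using inner_symmetric_mult[OF P, of x "\<Xi> *v w"] inner_transpose_mult[of \<Xi> "P *v x" w]
      by (simp add: inner_commute del: transpose_matrix_vector)
    then show ?thesis
      by (simp add: robust_matrix_mult inner_add_right del: transpose_matrix_vector)
  qed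
  show "x \<bullet> (robust_matrix P *v y) = y \<bullet> (robust_matrix P *v x)" for x y
    unfolding * using inner_symmetric_mult[OF P] inner_symmetric_mult[OF symmetric_matrix_inv[OF M]]
    by metis
qed

lemma noise_value_eq:
  "noise_value P = 1 / N * (\<Sum>i = 1..N. lam\<^sup>2 * quad (matrix_inv (pen P)) (wh i) - lam * (norm (wh i))\<^sup>2)"
proof -
  have "lam * quad (lam *\<^sub>R matrix_inv (pen P) - mat 1) a
      = lam\<^sup>2 * quad (matrix_inv (pen P)) a - lam * (norm a)\<^sup>2" for a
    by (simp add: matrix_vector_mult_diff_rdistrib scaleR_matrix_vector_assoc[symmetric]
        inner_diff_right dot_square_norm right_diff_distrib) (simp add: power2_eq_square)
  then have "(\<Sum>i = 1..N. lam * quad (lam *\<^sub>R matrix_inv (pen P) - mat 1) (wh i))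
      = (\<Sum>i = 1..N. lam\<^sup>2 * quad (matrix_inv (pen P)) (wh i) - lam * (norm (wh i))\<^sup>2)"
    by simp
  then show ?thesis
    unfolding noise_value_def trace_mult_sample_covariance by (simp add: sum_distrib_left[symmetric])
qed

text \<open>State and sample interact only through a term linear in the sample, which averages to
  zero by \<open>mean\<close>. What remains splits into a form in y and the constant
  \<open>noise_value P\<close>.\<close>

lemma average_objective_max:
  assumes "admissible P"
  shows "1 / N * (\<Sum>i = 1..N. objective P y (wh i) (response P y (wh i))) = worst_gain P y"
proof -
  have M: "pos_def (pen P)" and P: "transpose P = P"
    using assms by (auto simp: admissible_def pos_semidef_def)
  define b where "b = transpose \<Xi> *v (P *v y)"
  let ?I = "matrix_inv (pen P)"
  have "objective P y a (response P y a) = \<alpha> * quad (robust_matrix P) y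
      + 2 * \<alpha> * lam * (a \<bullet> (?I *v b)) + (lam\<^sup>2 * quad ?I a - lam * (norm a)\<^sup>2)" for a
    unfolding objective_max[OF assms] b_def[symmetric] quad_robust_matrix[OF P]
      quad_add[OF symmetric_matrix_inv[OF M]] quad_scaleR
    by (simp add: algebra_simps power2_eq_square matrix_vector_mult_scaleR)
  then have "(\<Sum>i = 1..N. objective P y (wh i) (response P y (wh i)))
      = N * (\<alpha> * quad (robust_matrix P) y) + (\<Sum>i = 1..N. 2 * \<alpha> * lam * (wh i \<bullet> (?I *v b)))
        + (\<Sum>i = 1..N. lam\<^sup>2 * quad ?I (wh i) - lam * (norm (wh i))\<^sup>2)"
    by (simp only: sum.distrib) simp
  moreover have "(\<Sum>i = 1..N. 2 * \<alpha> * lam * (wh i \<bullet> (?I *v b))) = 0"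
    using mean unfolding sum_distrib_left[symmetric] inner_sum_left[symmetric] by simp
  ultimately show ?thesis
    using N by (simp add: worst_gain_def noise_value_eq distrib_left)
qed

text \<open>Links the bracket in the formulas for K and S with the matrix that the maximisation over
  disturbances produces.\<close>

lemma mult_amplification_matrix: "P ** amplification_matrix \<alpha> lam \<Xi> P = robust_matrix P"
  by (simp add: amplification_matrix_def robust_matrix_def matrix_add_ldistrib matrix_mul_assoc
      matrix_scalar_ac scalar_matrix_assoc[symmetric] matrix_mul_rid)

lemma amplification_matrix_mult:
  "P *v (amplification_matrix \<alpha> lam \<Xi> P *v x) = robust_matrix P *v x"
  by (simp only: matrix_vector_mul_assoc mult_amplification_matrix)

lemma ctl_mult: "ctl P *v u = R *v u + \<alpha> *\<^sub>R (transpose B *v (robust_matrix P *v (B *v u)))"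
  unfolding control_matrix_def robust_matrix_def
  by (simp add: matrix_vector_mult_add_rdistrib scaleR_matrix_vector_assoc[symmetric]
      matrix_vector_mul_assoc[symmetric] del: transpose_matrix_vector)

lemma quad_robust_matrix_nonneg:
  assumes "admissible P"
  shows "0 \<le> quad (robust_matrix P) y"
proof -
  have M: "pos_def (pen P)" and P: "pos_semidef P"
    using assms by (auto simp: admissible_def)
  have "quad (matrix_inv (pen P)) b = quad (pen P) (matrix_inv (pen P) *v b)" for b
    by (simp add: pos_def_matrix_inv[OF M] inner_commute)
  with pos_def_nonneg[OF M] pos_semidef_nonneg[OF P] \<alpha> show ?thesis
    by (simp add: quad_robust_matrix[OF pos_semidef_symmetric[OF P]])
qed

lemma inner_ctl: "v \<bullet> (ctl P *v u) = v \<bullet> (R *v u) + \<alpha> * ((B *v v) \<bullet> (robust_matrix P *v (B *v u)))"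
  using inner_transpose_mult[of B "robust_matrix P *v (B *v u)" v]
  by (simp add: ctl_mult inner_add_right inner_commute del: transpose_matrix_vector)

lemma pos_def_ctl:
  assumes "admissible P"
  shows "pos_def (ctl P)"
  unfolding pos_def_def
proof (intro conjI allI impI)
  show "transpose (ctl P) = ctl P"
    using inner_symmetric_mult[OF pos_def_symmetric[OF R]]
      inner_symmetric_mult[OF symmetric_robust_matrix[OF assms]]
    by (intro symmetric_if_inner) (metis inner_ctl)
  show "0 < quad (ctl P) u" if "u \<noteq> 0" for u
    using R that quad_robust_matrix_nonneg[OF assms, of "B *v u"] \<alpha>
    by (auto simp: inner_ctl pos_def_def intro: add_pos_nonneg)
qed

lemma gain_mult:
  assumes "admissible P"
  shows "gain P *v x
    = - (matrix_inv (ctl P) *v (\<alpha> *\<^sub>R (transpose B *v (robust_matrix P *v (A *v x)))))"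
proof -
  have P: "transpose P = P" using assms by (auto simp: admissible_def pos_semidef_def)
  have "(- X :: real ^ 'n ^ 'm) *v x = - (X *v x)" for X
    by (metis (no_types) add.right_inverse add_eq_0_iff matrix_vector_mult_0 matrix_vector_mult_add_rdistrib)
  then show ?thesis
    unfolding gain_matrix_def
    by (simp add: scaleR_matrix_vector_assoc[symmetric] matrix_vector_mul_assoc[symmetric] P
        amplification_matrix_mult matrix_vector_mult_scaleR del: transpose_matrix_vector)
qed

text \<open>Completing the square in u: \<open>gain P *v x\<close> is the minimiser and
  \<open>riccati P\<close> the matrix of the minimum. Any admissible P is allowed, not just a fixed
  point, because value iteration applies this to each iterate.\<close>

lemma quad_riccati:
  assumes "admissible P"
  shows "c x u + \<alpha> * quad (robust_matrix P) (A *v x + B *v u)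
    = quad (riccati P) x + quad (ctl P) (u - gain P *v x)"
proof -
  have P: "transpose P = P" using assms by (auto simp: admissible_def pos_semidef_def)
  note G = symmetric_robust_matrix[OF assms]
  note C = pos_def_ctl[OF assms]
  let ?G = "robust_matrix P" and ?I = "matrix_inv (ctl P)" and ?E = "amplification_matrix \<alpha> lam \<Xi> P"
  define b where "b = transpose B *v (?G *v (A *v x))"
  have inner_E: "(transpose ?E *v (P *v y)) \<bullet> v = y \<bullet> (?G *v v)" for y v
    using inner_symmetric_mult[OF P, of y] unfolding inner_transpose_mult
    by (metis amplification_matrix_mult inner_commute)
  have inner_B: "(transpose B *v y) \<bullet> v = y \<bullet> (B *v v)" for y v
    by (rule inner_transpose_mult)
  have "quad (transpose A ** riccati_S \<alpha> lam B \<Xi> R P ** A) x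
      = quad (riccati_S \<alpha> lam B \<Xi> R P) (A *v x)"
    using inner_transpose_mult[of A "riccati_S \<alpha> lam B \<Xi> R P *v (A *v x)" x]
    by (simp add: matrix_vector_mul_assoc[symmetric] inner_commute del: transpose_matrix_vector)
  also have "\<alpha> * \<dots> = quad ?G (A *v x) - quad P (A *v x) - \<alpha> * quad ?I b"
  proof -
    let ?y = "A *v x"
    \<comment> \<open>P times the amplification matrix is \<open>robust_matrix P\<close>, so both
      outer factors of the subtracted product in S reduce to b.\<close>
    have "riccati_S \<alpha> lam B \<Xi> R P *v ?y
        = P *v (\<Xi> *v (matrix_inv (pen P) *v (transpose \<Xi> *v (P *v ?y))))
          - transpose ?E *v (P *v (B *v (?I *v b)))"
      unfolding riccati_S_def b_def
      by (simp add: matrix_vector_mult_diff_rdistrib matrix_vector_mul_assoc[symmetric]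
          amplification_matrix_mult del: transpose_matrix_vector)
    moreover have "?y \<bullet> (transpose ?E *v (P *v (B *v (?I *v b)))) = quad ?I b"
      using inner_E[of "B *v (?I *v b)" ?y] inner_B[of "?G *v ?y" "?I *v b"]
      by (simp add: b_def inner_commute del: transpose_matrix_vector)
    ultimately show ?thesis
      by (simp add: robust_matrix_mult inner_add_right inner_diff_right right_diff_distrib
          del: transpose_matrix_vector)
  qed
  finally have S: "\<alpha> * quad (transpose A ** riccati_S \<alpha> lam B \<Xi> R P ** A) x
      = quad ?G (A *v x) - quad P (A *v x) - \<alpha> * quad ?I b" .
  have "quad (transpose A ** P ** A) x = quad P (A *v x)"
    using inner_transpose_mult[of A "P *v (A *v x)" x]
    by (simp add: matrix_vector_mul_assoc[symmetric] inner_commute del: transpose_matrix_vector)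
  then have "quad (riccati P) x = quad Q x + \<alpha> * quad P (A *v x)
      + \<alpha> * (\<alpha> * quad (transpose A ** riccati_S \<alpha> lam B \<Xi> R P ** A) x)"
    unfolding riccati_def
    by (simp add: matrix_vector_mult_add_rdistrib scaleR_matrix_vector_assoc[symmetric]
        inner_add_right power2_eq_square)
  also have "\<dots> = quad Q x + \<alpha> * quad ?G (A *v x) - \<alpha>\<^sup>2 * quad ?I b"
    unfolding S by (simp add: algebra_simps power2_eq_square)
  finally have ric: "quad (riccati P) x = quad Q x + \<alpha> * quad ?G (A *v x) - \<alpha>\<^sup>2 * quad ?I b" .
  \<comment> \<open>With the linear term d, \<open>complete_square\<close> puts the vertex at
    \<open>?I *v d\<close>, which is \<open>gain P *v x\<close>.\<close>
  define d where "d = (- \<alpha>) *\<^sub>R b"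
  have "gain P *v x = - (\<alpha> *\<^sub>R (?I *v b))"
    by (simp only: gain_mult[OF assms] b_def[symmetric] matrix_vector_mult_scaleR)
  moreover have "?I *v d = (- \<alpha>) *\<^sub>R (?I *v b)"
    unfolding d_def by (rule matrix_vector_mult_scaleR)
  ultimately have "u - gain P *v x = u - ?I *v d"
    by simp
  moreover have "quad ?I d = \<alpha>\<^sup>2 * quad ?I b"
    unfolding d_def quad_scaleR by simp
  moreover have "d \<bullet> u = - \<alpha> * (b \<bullet> u)"
    by (simp add: d_def)
  ultimately have "quad (ctl P) (u - gain P *v x)
      = quad (ctl P) u + 2 * \<alpha> * (b \<bullet> u) + \<alpha>\<^sup>2 * quad ?I b"
    using complete_square[OF C, of u d] by simp
  moreover have "b \<bullet> u = (B *v u) \<bullet> (?G *v (A *v x))"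
    using inner_B[of "?G *v (A *v x)" u] by (simp add: b_def inner_commute del: transpose_matrix_vector)
  ultimately have "quad (ctl P) (u - gain P *v x) = quad R u + \<alpha> * quad ?G (B *v u)
      + 2 * \<alpha> * ((B *v u) \<bullet> (?G *v (A *v x))) + \<alpha>\<^sup>2 * quad ?I b"
    unfolding inner_ctl by algebra
  then show ?thesis
    unfolding ric quadratic_cost_def quad_add[OF G] by algebra
qed

end

section \<open>Weak duality for the transport penalty\<close>

text \<open>The additive form of the bound also covers l = \<infinity>, where the convention gives
  -\<infinity>.\<close>

lemma gain_minus_loss_le:
  assumes "g \<le> ennreal r + l" and "0 \<le> r"
  shows "gain_minus_loss g l \<le> ereal r"
proof (cases l rule: ennreal_cases)
  case (real b)
  then have "g \<le> ennreal (r + b)" using assms by (simp add: ennreal_plus)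
  then obtain a where "g = ennreal a" "0 \<le> a" "a \<le> r + b"
    using real assms
    by (cases g rule: ennreal_cases) (auto simp: top_unique simp del: ennreal_plus)
  then show ?thesis using real by (simp add: gain_minus_loss_def enn2ereal_ennreal)
qed (simp add: gain_minus_loss_def)

text \<open>Finiteness of the loss is essential: an infinite loss would give -\<infinity> whatever
  the gain.\<close>

lemma gain_minus_loss_ge:
  assumes "ennreal r + l \<le> g" and "0 \<le> r" and "l < \<infinity>"
  shows "ereal r \<le> gain_minus_loss g l"
proof -
  obtain b where b: "l = ennreal b" "0 \<le> b"
    using assms(3) by (cases l rule: ennreal_cases) auto
  show ?thesis
  proof (cases g rule: ennreal_cases)
    case (real a)
    then have "ennreal (r + b) \<le> ennreal a" using assms b by (simp add: ennreal_plus)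
    then show ?thesis using real b by (simp add: gain_minus_loss_def enn2ereal_ennreal)
  qed (simp add: gain_minus_loss_def b enn2ereal_ennreal)
qed

lemma gain_minus_loss_mono:
  assumes "g \<le> g'" and "l' \<le> l"
  shows "gain_minus_loss g l \<le> gain_minus_loss g' l'"
  using assms
  by (auto simp: gain_minus_loss_def top_unique less_eq_ennreal.rep_eq intro!: ereal_minus_mono)

text \<open>Positive part plus r equals negative part plus d plus \<phi>, pointwise. All terms are
  nonnegative, so the integrated identity stays valid if \<phi> has an infinite integral.\<close>

lemma nn_integral_pos_neg_part:
  fixes \<phi> :: "'a \<Rightarrow> real"
  assumes "prob_space M" and [measurable]: "\<phi> \<in> borel_measurable M"
    and "\<And>w. 0 \<le> \<phi> w" and "0 \<le> d" and "0 \<le> r"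
  shows "(\<integral>\<^sup>+ w. ennreal (d - r + \<phi> w) \<partial>M) + ennreal r
    = (\<integral>\<^sup>+ w. ennreal (- (d - r + \<phi> w)) \<partial>M) + ennreal d + (\<integral>\<^sup>+ w. ennreal (\<phi> w) \<partial>M)"
proof -
  interpret prob_space M by fact
  have const: "ennreal b = (\<integral>\<^sup>+ w. ennreal b \<partial>M)" for b
    by (simp add: emeasure_space_1)
  have "(\<integral>\<^sup>+ w. ennreal (d - r + \<phi> w) \<partial>M) + ennreal r
      = (\<integral>\<^sup>+ w. ennreal (d - r + \<phi> w) + ennreal r \<partial>M)"
    by (subst (2) const, rule nn_integral_add[symmetric]) auto
  also have "\<dots> = (\<integral>\<^sup>+ w. ennreal (- (d - r + \<phi> w)) + ennreal d + ennreal (\<phi> w) \<partial>M)"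
  proof (rule nn_integral_cong)
    fix w
    show "ennreal (d - r + \<phi> w) + ennreal r
        = ennreal (- (d - r + \<phi> w)) + ennreal d + ennreal (\<phi> w)"
      using assms(3)[of w] assms(4,5)
      by (cases "0 \<le> d - r + \<phi> w")
        (simp_all add: ennreal_neg ennreal_plus[symmetric] del: ennreal_plus)
  qed
  also have "\<dots> = (\<integral>\<^sup>+ w. ennreal (- (d - r + \<phi> w)) \<partial>M) + ennreal d + (\<integral>\<^sup>+ w. ennreal (\<phi> w) \<partial>M)"
    by (subst (4) const) (simp add: nn_integral_add)
  finally show ?thesis .
qed

section \<open>Empirical measures and their transport cost\<close>

lemma prob_space_empirical_measure: "1 \<le> N \<Longrightarrow> prob_space (empirical_measure N a)"
  unfolding empirical_measure_def
  by (intro prob_space.prob_space_distr prob_space_uniform_count_measure)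
    (auto simp: measurable_def space_uniform_count_measure sets_uniform_count_measure)

lemma empirical_measure_in_prob_measures: "1 \<le> N \<Longrightarrow> empirical_measure N a \<in> prob_measures"
  using prob_space_empirical_measure[of N a]
  by (simp add: space_prob_algebra) (simp add: empirical_measure_def)

lemma nn_integral_empirical_measure:
  fixes h :: "'w :: euclidean_space \<Rightarrow> ennreal"
  assumes "h \<in> borel_measurable borel"
  shows "(\<integral>\<^sup>+ w. h w \<partial>empirical_measure N a) = ennreal (1 / N) * (\<Sum>i = 1..N. h (a i))"
  unfolding empirical_measure_def using assms
  by (subst nn_integral_distr)
    (auto simp: measurable_def space_uniform_count_measure sets_uniform_count_measure
      uniform_count_measure_def nn_integral_point_measure_finite sum_distrib_left)

lemma nn_integral_empirical_measure_real:
  fixes h :: "'w :: euclidean_space \<Rightarrow> real"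
  assumes [measurable]: "h \<in> borel_measurable borel" and "\<And>w. 0 \<le> h w"
  shows "(\<integral>\<^sup>+ w. ennreal (h w) \<partial>empirical_measure N a) = ennreal (1 / N * (\<Sum>i = 1..N. h (a i)))"
  using assms
  by (subst nn_integral_empirical_measure) (simp_all add: ennreal_mult[symmetric] sum_nonneg)

lemma distr_empirical_measure:
  fixes r :: "'v :: euclidean_space \<Rightarrow> 'w :: euclidean_space"
  assumes "r \<in> borel_measurable borel"
  shows "distr (empirical_measure N a) borel r = empirical_measure N (\<lambda>i. r (a i))"
  unfolding empirical_measure_def using assms
  by (subst distr_distr)
    (auto simp: measurable_def space_uniform_count_measure sets_uniform_count_measure comp_def)

lemma measurable_empirical_measure:
  assumes "1 \<le> N" and [measurable]: "\<And>i. (\<lambda>y. a y i) \<in> M \<rightarrow>\<^sub>M borel"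
  shows "(\<lambda>y. empirical_measure N (a y)) \<in> M \<rightarrow>\<^sub>M prob_algebra borel"
proof (intro measurable_prob_algebraI measurable_subprob_algebra)
  show ps: "prob_space (empirical_measure N (a y))" for y
    using assms by (simp add: prob_space_empirical_measure)
  show "subprob_space (empirical_measure N (a y))" for y
    by (intro prob_space_imp_subprob_space ps)
  show "sets (empirical_measure N (a y)) = sets borel" for y
    by (simp add: empirical_measure_def)
  show "(\<lambda>y. emeasure (empirical_measure N (a y)) E) \<in> borel_measurable M" if "E \<in> sets borel" for E
    using that assms by (simp add: emeasure_empirical_measure)
qed

text \<open>Pairing the i-th atoms is a coupling, so its cost bounds the infimum.\<close>

lemma wasserstein_cost_empirical_measure:
  fixes a b :: "nat \<Rightarrow> 'w :: euclidean_space"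
  assumes "1 \<le> N"
  shows "wasserstein_cost (empirical_measure N a) (empirical_measure N b)
    \<le> ennreal (1 / N * (\<Sum>i = 1..N. (norm (a i - b i))\<^sup>2))"
proof -
  let ?U = "uniform_count_measure {1..N}"
  define \<kappa> where "\<kappa> = distr ?U (borel \<Otimes>\<^sub>M borel) (\<lambda>i. (a i, b i))"
  have mab: "(\<lambda>i. (a i, b i)) \<in> ?U \<rightarrow>\<^sub>M borel \<Otimes>\<^sub>M borel"
    by (auto simp: measurable_def space_pair_measure space_uniform_count_measure
        sets_uniform_count_measure)
  have "prob_space \<kappa>"
    unfolding \<kappa>_def using assms
    by (intro prob_space.prob_space_distr prob_space_uniform_count_measure mab) auto
  moreover have "distr \<kappa> borel fst = empirical_measure N a"
    unfolding \<kappa>_def empirical_measure_def distr_distr[OF measurable_fst mab] by (simp add: comp_def)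
  moreover have "distr \<kappa> borel snd = empirical_measure N b"
    unfolding \<kappa>_def empirical_measure_def distr_distr[OF measurable_snd mab] by (simp add: comp_def)
  ultimately have "\<kappa> \<in> couplings (empirical_measure N a) (empirical_measure N b)"
    by (simp add: couplings_def space_prob_algebra) (simp add: \<kappa>_def)
  then have "wasserstein_cost (empirical_measure N a) (empirical_measure N b)
      \<le> (\<integral>\<^sup>+ (w, w'). ennreal ((norm (w - w'))\<^sup>2) \<partial>\<kappa>)"
    unfolding wasserstein_cost_def by (rule INF_lower)
  also have "\<dots> = (\<integral>\<^sup>+ i. ennreal ((norm (a i - b i))\<^sup>2) \<partial>?U)"
    unfolding \<kappa>_def by (subst nn_integral_distr[OF mab]) (simp_all add: split_beta')
  also have "\<dots> = ennreal (1 / N * (\<Sum>i = 1..N. (norm (a i - b i))\<^sup>2))"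
    by (simp add: uniform_count_measure_def nn_integral_point_measure_finite
        ennreal_mult[symmetric] sum_distrib_left)
  finally show ?thesis .
qed

text \<open>Nonnegativity of the variance; this is the Jensen step of
  \<open>weak_duality\<close>.\<close>

lemma (in prob_space) expectation_square_le:
  fixes X :: "'a \<Rightarrow> real"
  assumes [measurable]: "random_variable borel X" and "\<And>\<omega>. \<bar>X \<omega>\<bar> \<le> b"
  shows "ennreal ((expectation X)\<^sup>2) \<le> (\<integral>\<^sup>+ \<omega>. ennreal ((X \<omega>)\<^sup>2) \<partial>M)"
proof -
  have int: "integrable M X"
    by (rule integrable_const_bound[where B = b]) (use assms in auto)
  have "(X \<omega>)\<^sup>2 \<le> b\<^sup>2" for \<omega>
    using assms(2)[of \<omega>] by (intro abs_le_square_iff[THEN iffD1]) simp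
  then have int2: "integrable M (\<lambda>\<omega>. (X \<omega>)\<^sup>2)"
    by (intro integrable_const_bound[where B = "b\<^sup>2"]) auto
  have "(expectation X)\<^sup>2 \<le> expectation (\<lambda>\<omega>. (X \<omega>)\<^sup>2)"
    using variance_eq[OF int int2] variance_positive[of X] by simp
  then show ?thesis
    by (simp add: nn_integral_eq_integral[OF int2])
qed

section \<open>Duality between couplings and samplewise maxima\<close>

context wasserstein_lq
begin

abbreviation "\<nu> \<equiv> empirical_measure N wh"

definition worst_distribution :: "real ^ 'n ^ 'n \<Rightarrow> real ^ 'n \<Rightarrow> (real ^ 'l) measure" where
  "worst_distribution P y = empirical_measure N (\<lambda>i. response P y (wh i))"

text \<open>The cost of the pairing that sends each sample to its response. It bounds the
  Wasserstein cost of the worst-case distribution; equality follows from weak duality in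
  \<open>stage_payoff_worst_distribution\<close>.\<close>

definition transport :: "real ^ 'n ^ 'n \<Rightarrow> real ^ 'n \<Rightarrow> real" where
  "transport P y = 1 / N * (\<Sum>i = 1..N. (norm (response P y (wh i) - wh i))\<^sup>2)"

lemma transport_nonneg: "0 \<le> transport P y"
  by (simp add: transport_def sum_nonneg)

lemma wasserstein_cost_worst_distribution:
  "wasserstein_cost (worst_distribution P y) \<nu> \<le> ennreal (transport P y)"
  unfolding worst_distribution_def transport_def by (rule wasserstein_cost_empirical_measure[OF N])

lemma worst_distribution_in_prob_measures: "worst_distribution P y \<in> prob_measures"
  unfolding worst_distribution_def by (rule empirical_measure_in_prob_measures[OF N])

lemma objective_max_nonneg:
  assumes "admissible P"
  shows "0 \<le> objective P y a (response P y a)"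
proof -
  have "0 \<le> objective P y a a"
    using assms \<alpha> by (auto simp: objective_def admissible_def pos_semidef_def)
  also have "\<dots> \<le> objective P y a (response P y a)"
    using assms pos_def_nonneg by (subst objective_response) (auto simp: admissible_def)
  finally show ?thesis .
qed

lemma worst_gain_nonneg: "admissible P \<Longrightarrow> 0 \<le> worst_gain P y"
  by (simp add: average_objective_max[symmetric] sum_nonneg objective_max_nonneg)

text \<open>Under any coupling the slack is the integral of the form \<open>pen P\<close> at w -
  r(a), with a the sample and r the response. It is at least m times the mean squared distance,
  hence m / k^2 times the mean square of h(w) - h(r(a)), and Jensen moves the square outside. Since
  r(a) is distributed by the worst-case distribution, the resulting difference of integrals no
  longer mentions the coupling.\<close>

lemma weak_duality:
  assumes P: "admissible P" and z: "0 \<le> z" and \<mu>: "\<mu> \<in> prob_measures"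
    and m: "0 \<le> m" "\<And>w. m * (norm w)\<^sup>2 \<le> quad (pen P) w"
    and h [measurable]: "h \<in> borel_measurable borel" and bound: "\<And>w. \<bar>h w\<bar> \<le> 1"
    and k: "0 < k" and lipschitz: "\<And>w w'. \<bar>h w - h w'\<bar> \<le> k * norm (w - w')"
  shows "ennreal \<alpha> * (\<integral>\<^sup>+ w. ennreal (quad P (y + \<Xi> *v w) + z) \<partial>\<mu>)
      + ennreal (m / k\<^sup>2 * ((\<integral>w. h w \<partial>\<mu>) - (\<integral>w. h w \<partial>worst_distribution P y))\<^sup>2)
    \<le> ennreal (worst_gain P y + \<alpha> * z) + ennreal lam * wasserstein_cost \<mu> \<nu>"
proof -
  let ?r = "response P y"
  have r [measurable]: "?r \<in> borel \<rightarrow>\<^sub>M borel"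
    unfolding response_def by (simp del: transpose_matrix_vector) measurable
  have Pnn: "0 \<le> quad P x" for x
    using P by (auto simp: admissible_def pos_semidef_def)
  define L where "L = ennreal \<alpha> * (\<integral>\<^sup>+ w. ennreal (quad P (y + \<Xi> *v w) + z) \<partial>\<mu>)
      + ennreal (m / k\<^sup>2 * ((\<integral>w. h w \<partial>\<mu>) - (\<integral>w. h w \<partial>worst_distribution P y))\<^sup>2)"
  define J where "J = ennreal (worst_gain P y + \<alpha> * z)"
  have main: "L \<le> J + ennreal lam * (\<integral>\<^sup>+ (w, w'). ennreal ((norm (w - w'))\<^sup>2) \<partial>\<kappa>)"
    if "\<kappa> \<in> couplings \<mu> \<nu>" for \<kappa>
  proof -
    have sets [measurable_cong]: "sets \<kappa> = sets (borel \<Otimes>\<^sub>M borel)" and "prob_space \<kappa>"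
      and fst: "\<mu> = distr \<kappa> borel fst" and snd: "\<nu> = distr \<kappa> borel snd"
      using that by (auto simp: couplings_def space_prob_algebra)
    interpret \<kappa>: prob_space \<kappa> by fact
    have mf [measurable]: "fst \<in> \<kappa> \<rightarrow>\<^sub>M borel" and ms [measurable]: "snd \<in> \<kappa> \<rightarrow>\<^sub>M borel" by measurable
    define X where "X = (\<lambda>p. h (fst p) - h (?r (snd p)))"
    have X [measurable]: "X \<in> borel_measurable \<kappa>" unfolding X_def by measurable
    have hb: "integrable \<kappa> (\<lambda>p. h (q p))" if "q \<in> \<kappa> \<rightarrow>\<^sub>M borel" for q
      using that bound by (intro \<kappa>.integrable_const_bound[where B = 1]) auto
    have "worst_distribution P y = distr \<kappa> borel (\<lambda>p. ?r (snd p))"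
      unfolding worst_distribution_def
      by (subst distr_empirical_measure[symmetric, OF r], subst snd)
        (simp add: distr_distr comp_def)
    then have "(\<integral>w. h w \<partial>worst_distribution P y) = (\<integral>p. h (?r (snd p)) \<partial>\<kappa>)"
      by (simp add: integral_distr)
    moreover have "(\<integral>w. h w \<partial>\<mu>) = (\<integral>p. h (fst p) \<partial>\<kappa>)"
      unfolding fst by (simp add: integral_distr)
    ultimately have EX: "(\<integral>w. h w \<partial>\<mu>) - (\<integral>w. h w \<partial>worst_distribution P y) = \<kappa>.expectation X"
      unfolding X_def by (simp add: hb)
    have "ennreal (m / k\<^sup>2 * (\<kappa>.expectation X)\<^sup>2)
        = ennreal (m / k\<^sup>2) * ennreal ((\<kappa>.expectation X)\<^sup>2)"
      using m by (intro ennreal_mult) simp_all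
    also have "\<dots> \<le> ennreal (m / k\<^sup>2) * (\<integral>\<^sup>+ p. ennreal ((X p)\<^sup>2) \<partial>\<kappa>)"
    proof (intro mult_left_mono \<kappa>.expectation_square_le[where b = 2])
      show "\<bar>X p\<bar> \<le> 2" for p
        using bound[of "fst p"] bound[of "?r (snd p)"] by (simp add: X_def)
    qed auto
    also have "\<dots> = (\<integral>\<^sup>+ p. ennreal (m / k\<^sup>2) * ennreal ((X p)\<^sup>2) \<partial>\<kappa>)"
      by (rule nn_integral_cmult[symmetric]) simp
    also have "\<dots> \<le> (\<integral>\<^sup>+ p. ennreal (quad (pen P) (fst p - ?r (snd p))) \<partial>\<kappa>)"
    proof (rule nn_integral_mono)
      fix p
      have "(X p)\<^sup>2 \<le> (k * norm (fst p - ?r (snd p)))\<^sup>2"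
        using lipschitz[of "fst p" "?r (snd p)"] k unfolding X_def
        by (intro abs_le_square_iff[THEN iffD1]) (simp add: abs_mult)
      then have "m / k\<^sup>2 * (X p)\<^sup>2 \<le> m / k\<^sup>2 * (k * norm (fst p - ?r (snd p)))\<^sup>2"
        using m k by (intro mult_left_mono) auto
      also have "\<dots> = m * (norm (fst p - ?r (snd p)))\<^sup>2"
        using k by (simp add: power_mult_distrib)
      also have "\<dots> \<le> quad (pen P) (fst p - ?r (snd p))" by (rule m)
      finally show "ennreal (m / k\<^sup>2) * ennreal ((X p)\<^sup>2) \<le> ennreal (quad (pen P) (fst p - ?r (snd p)))"
        using m(1) by (subst ennreal_mult[symmetric]) (auto intro: ennreal_leI)
    qed
    finally have S: "ennreal (m / k\<^sup>2 * (\<kappa>.expectation X)\<^sup>2)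
        \<le> (\<integral>\<^sup>+ p. ennreal (quad (pen P) (fst p - ?r (snd p))) \<partial>\<kappa>)" .
    have "ennreal \<alpha> * (\<integral>\<^sup>+ w. ennreal (quad P (y + \<Xi> *v w) + z) \<partial>\<mu>)
        = ennreal \<alpha> * (\<integral>\<^sup>+ p. ennreal (quad P (y + \<Xi> *v fst p) + z) \<partial>\<kappa>)"
      unfolding fst by (subst nn_integral_distr) auto
    also have "\<dots> = (\<integral>\<^sup>+ p. ennreal (\<alpha> * (quad P (y + \<Xi> *v fst p) + z)) \<partial>\<kappa>)"
      using \<alpha> z Pnn by (simp add: nn_integral_cmult[symmetric] ennreal_mult)
    finally have "L \<le> (\<integral>\<^sup>+ p. ennreal (\<alpha> * (quad P (y + \<Xi> *v fst p) + z)) \<partial>\<kappa>)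
        + (\<integral>\<^sup>+ p. ennreal (quad (pen P) (fst p - ?r (snd p))) \<partial>\<kappa>)"
      unfolding L_def EX by (intro add_mono S) simp
    also have "\<dots> = (\<integral>\<^sup>+ p. ennreal (\<alpha> * (quad P (y + \<Xi> *v fst p) + z))
        + ennreal (quad (pen P) (fst p - ?r (snd p))) \<partial>\<kappa>)"
      by (rule nn_integral_add[symmetric]) auto
    also have "\<dots> = (\<integral>\<^sup>+ p. ennreal (objective P y (snd p) (?r (snd p)) + \<alpha> * z)
        + ennreal lam * ennreal ((norm (fst p - snd p))\<^sup>2) \<partial>\<kappa>)"
    proof (rule nn_integral_cong)
      fix p
      have "\<alpha> * (quad P (y + \<Xi> *v fst p) + z) + quad (pen P) (fst p - ?r (snd p))
          = objective P y (snd p) (?r (snd p)) + \<alpha> * z + lam * (norm (fst p - snd p))\<^sup>2"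
        using objective_response[OF P, of y "snd p" "fst p"] objective_def[of P y "snd p" "fst p"]
        unfolding distrib_left by linarith
      moreover have "0 \<le> quad (pen P) (fst p - ?r (snd p))"
        using P pos_def_nonneg by (auto simp: admissible_def)
      ultimately show "ennreal (\<alpha> * (quad P (y + \<Xi> *v fst p) + z))
          + ennreal (quad (pen P) (fst p - ?r (snd p)))
          = ennreal (objective P y (snd p) (?r (snd p)) + \<alpha> * z)
            + ennreal lam * ennreal ((norm (fst p - snd p))\<^sup>2)"
        using \<alpha> z lam Pnn objective_max_nonneg[OF P, of y "snd p"]
        by (simp add: ennreal_plus[symmetric] ennreal_mult[symmetric] del: ennreal_plus)
    qed
    also have "\<dots> = (\<integral>\<^sup>+ p. ennreal (objective P y (snd p) (?r (snd p)) + \<alpha> * z) \<partial>\<kappa>)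
        + ennreal lam * (\<integral>\<^sup>+ p. ennreal ((norm (fst p - snd p))\<^sup>2) \<partial>\<kappa>)"
      unfolding objective_def by (simp add: nn_integral_add nn_integral_cmult)
    also have "(\<integral>\<^sup>+ p. ennreal (objective P y (snd p) (?r (snd p)) + \<alpha> * z) \<partial>\<kappa>)
        = (\<integral>\<^sup>+ a. ennreal (objective P y a (?r a) + \<alpha> * z) \<partial>\<nu>)"
      unfolding snd objective_def by (subst nn_integral_distr) auto
    also have "\<dots> = ennreal (1 / N * (\<Sum>i = 1..N. objective P y (wh i) (?r (wh i)) + \<alpha> * z))"
    proof (rule nn_integral_empirical_measure_real)
      show "(\<lambda>a. objective P y a (?r a) + \<alpha> * z) \<in> borel_measurable borel"
        unfolding objective_def by measurable
    qed (use \<alpha> z objective_max_nonneg[OF P] in auto)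
    also have "\<dots> = J"
      unfolding J_def average_objective_max[OF P, symmetric] using N
      by (simp add: sum.distrib distrib_left)
    finally show ?thesis by (simp add: split_beta')
  qed
  \<comment> \<open>J is finite, so the bound can be solved for the transport cost. The infimum over
    couplings is taken only then, which spares the existence of an optimal coupling.\<close>
  have "(L - J) / ennreal lam \<le> wasserstein_cost \<mu> \<nu>"
    unfolding wasserstein_cost_def
  proof (rule INF_greatest)
    fix \<kappa> assume "\<kappa> \<in> couplings \<mu> \<nu>"
    from main[OF this] have "L - J \<le> ennreal lam * (\<integral>\<^sup>+ (w, w'). ennreal ((norm (w - w'))\<^sup>2) \<partial>\<kappa>)"
      by (simp add: ennreal_minus_le_iff J_def)
    then show "(L - J) / ennreal lam \<le> (\<integral>\<^sup>+ (w, w'). ennreal ((norm (w - w'))\<^sup>2) \<partial>\<kappa>)"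
      using lam by (simp add: divide_le_posI_ennreal mult.commute)
  qed
  then have "ennreal lam * ((L - J) / ennreal lam) \<le> ennreal lam * wasserstein_cost \<mu> \<nu>"
    by (rule mult_left_mono) simp
  also have "ennreal lam * ((L - J) / ennreal lam) = L - J"
    using lam by (simp add: ennreal_times_divide mult_divide_eq_ennreal mult.commute[of "ennreal lam"])
  finally show ?thesis
    unfolding L_def[symmetric] J_def[symmetric] by (simp add: ennreal_minus_le_iff J_def)
qed

end

section \<open>The Bellman equation\<close>

lemma stage_payoff_antimono:
  assumes "0 < lam" and "wasserstein_cost \<mu> \<nu> \<le> ennreal r" and "0 \<le> r"
  shows "ereal (c x u - lam * r) \<le> stage_payoff c lam \<nu> (x, u, \<mu>)"
proof -
  obtain b where "wasserstein_cost \<mu> \<nu> = ennreal b" "0 \<le> b" "b \<le> r"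
    using assms by (cases "wasserstein_cost \<mu> \<nu>" rule: ennreal_cases) (auto simp: top_unique)
  then show ?thesis using assms(1) by (simp add: stage_payoff_def enn2ereal_ennreal)
qed

context wasserstein_lq
begin

text \<open>Player II's supremum for the control u and the continuation x^T P x + z, as a real
  number; see \<open>SUP_bellman_payoff\<close>.\<close>

definition q_value :: "real ^ 'n ^ 'n \<Rightarrow> real \<Rightarrow> real ^ 'n \<Rightarrow> real ^ 'm \<Rightarrow> real" where
  "q_value P z x u = c x u + worst_gain P (A *v x + B *v u) + \<alpha> * z"

lemma q_value_eq:
  assumes "admissible P"
  shows "q_value P z x u
    = quad (riccati P) x + noise_value P + \<alpha> * z + quad (ctl P) (u - gain P *v x)"
  using quad_riccati[OF assms, of x u] by (simp add: q_value_def worst_gain_def)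

lemma noise_value_nonneg: "admissible P \<Longrightarrow> 0 \<le> noise_value P"
  using worst_gain_nonneg[of P 0] by (simp add: worst_gain_def)

lemma cost_nonneg: "0 \<le> c x u"
  using pos_semidef_nonneg[OF Q] pos_def_nonneg[OF R] by (simp add: quadratic_cost_def)

lemma q_value_nonneg: "admissible P \<Longrightarrow> 0 \<le> z \<Longrightarrow> 0 \<le> q_value P z x u"
  using worst_gain_nonneg cost_nonneg[of x u] \<alpha> by (simp add: q_value_def)

lemma system_eq: "f x u w = (A *v x + B *v u) + \<Xi> *v w"
  by (simp add: linear_system_def)

text \<open>Solving the definition of \<open>objective\<close> at each response for the continuation
  gives the maximum plus a penalty; averaged, the penalties are \<open>lam * transport P y\<close>.
  This is the equality case of weak duality.\<close>

lemma continuation_worst_distribution: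
  assumes P: "admissible P" and z: "0 \<le> z"
  shows "ennreal \<alpha> * (\<integral>\<^sup>+ w. ennreal (quad P (y + \<Xi> *v w) + z) \<partial>worst_distribution P y)
    = ennreal (worst_gain P y + \<alpha> * z + lam * transport P y)"
proof -
  have nn: "0 \<le> quad P x" for x
    using P by (auto simp: admissible_def pos_semidef_def)
  have "ennreal \<alpha> * (\<integral>\<^sup>+ w. ennreal (quad P (y + \<Xi> *v w) + z) \<partial>worst_distribution P y)
      = ennreal (\<alpha> * (1 / N * (\<Sum>i = 1..N. quad P (y + \<Xi> *v response P y (wh i)) + z)))"
    unfolding worst_distribution_def using nn z \<alpha>
    by (subst nn_integral_empirical_measure_real) (auto simp: ennreal_mult[symmetric] sum_nonneg)
  also have "\<alpha> * (1 / N * (\<Sum>i = 1..N. quad P (y + \<Xi> *v response P y (wh i)) + z))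
      = 1 / N * (\<Sum>i = 1..N. objective P y (wh i) (response P y (wh i))
          + (\<alpha> * z + lam * (norm (response P y (wh i) - wh i))\<^sup>2))"
    by (simp add: objective_def sum_distrib_left distrib_left mult_ac)
  also have "\<dots> = worst_gain P y + \<alpha> * z + lam * transport P y"
    unfolding average_objective_max[OF P, symmetric] transport_def using N
    by (simp add: sum.distrib distrib_left sum_distrib_left)
  finally show ?thesis .
qed

text \<open>The choice m = 0 and h = 0 discards the slack.\<close>

lemma weak_duality_cost:
  assumes P: "admissible P" and z: "0 \<le> z" and \<mu>: "\<mu> \<in> prob_measures"
  shows "ennreal \<alpha> * (\<integral>\<^sup>+ w. ennreal (quad P (y + \<Xi> *v w) + z) \<partial>\<mu>)
    \<le> ennreal (worst_gain P y + \<alpha> * z) + ennreal lam * wasserstein_cost \<mu> \<nu>"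
  using weak_duality[OF P z \<mu>, where m = 0 and h = "\<lambda>_. 0" and k = 1] P
  by (simp add: admissible_def pos_def_nonneg)

lemma bellman_payoff_le:
  assumes P: "admissible P" and z: "0 \<le> z" and \<mu>: "\<mu> \<in> prob_measures"
  shows "bellman_payoff f c \<alpha> lam \<nu> (\<lambda>x. ereal (quad P x + z)) x u \<mu> \<le> ereal (q_value P z x u)"
proof -
  let ?y = "A *v x + B *v u"
  have sets: "sets \<mu> = sets borel" and ps: "prob_space \<mu>"
    using \<mu> by (auto simp: space_prob_algebra)
  note [measurable_cong] = sets
  interpret prob_space \<mu> by fact
  show ?thesis
  proof (cases "wasserstein_cost \<mu> \<nu>" rule: ennreal_cases)
    case (real r)
    define \<phi> where "\<phi> = (\<lambda>w. \<alpha> * (quad P (?y + \<Xi> *v w) + z))"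
    have [measurable]: "\<phi> \<in> borel_measurable \<mu>" unfolding \<phi>_def by measurable
    have \<phi>: "0 \<le> \<phi> w" for w
      using P z \<alpha> by (auto simp: \<phi>_def admissible_def pos_semidef_def)
    have Y: "stage_payoff c lam \<nu> (x, u, \<mu>) + ereal \<alpha> * ereal (quad P (f x u w) + z)
        = ereal (c x u - lam * r + \<phi> w)" for w
      using real by (simp add: stage_payoff_def \<phi>_def system_eq)
    have "(\<integral>\<^sup>+ w. ennreal (\<phi> w) \<partial>\<mu>)
        = ennreal \<alpha> * (\<integral>\<^sup>+ w. ennreal (quad P (?y + \<Xi> *v w) + z) \<partial>\<mu>)"
      unfolding \<phi>_def using \<alpha> P z
      by (subst nn_integral_cmult[symmetric])
        (auto simp: ennreal_mult admissible_def pos_semidef_def)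
    also have "\<dots> \<le> ennreal (worst_gain P ?y + \<alpha> * z) + ennreal (lam * r)"
      using weak_duality_cost[OF P z \<mu>, of ?y] lam real by (simp add: ennreal_mult)
    finally have cont: "(\<integral>\<^sup>+ w. ennreal (\<phi> w) \<partial>\<mu>)
        \<le> ennreal (worst_gain P ?y + \<alpha> * z) + ennreal (lam * r)" .
    have "(\<integral>\<^sup>+ w. ennreal (c x u - lam * r + \<phi> w) \<partial>\<mu>) + ennreal (lam * r)
        = (\<integral>\<^sup>+ w. ennreal (- (c x u - lam * r + \<phi> w)) \<partial>\<mu>) + ennreal (c x u)
          + (\<integral>\<^sup>+ w. ennreal (\<phi> w) \<partial>\<mu>)"
      using \<phi> lam real cost_nonneg by (intro nn_integral_pos_neg_part ps) auto
    also have "\<dots> \<le> (\<integral>\<^sup>+ w. ennreal (- (c x u - lam * r + \<phi> w)) \<partial>\<mu>) + ennreal (c x u)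
          + (ennreal (worst_gain P ?y + \<alpha> * z) + ennreal (lam * r))"
      by (intro add_left_mono cont)
    also have "\<dots> = ennreal (q_value P z x u)
        + (\<integral>\<^sup>+ w. ennreal (- (c x u - lam * r + \<phi> w)) \<partial>\<mu>) + ennreal (lam * r)"
      using cost_nonneg[of x u] worst_gain_nonneg[OF P, of ?y] \<alpha> z
      by (simp add: q_value_def ac_simps)
    finally have "(\<integral>\<^sup>+ w. ennreal (c x u - lam * r + \<phi> w) \<partial>\<mu>)
        \<le> ennreal (q_value P z x u) + (\<integral>\<^sup>+ w. ennreal (- (c x u - lam * r + \<phi> w)) \<partial>\<mu>)"
      by (simp add: add.commute[of _ "ennreal (lam * r)"] ennreal_add_left_cancel_le)
    then show ?thesis
      unfolding bellman_payoff_def ext_expectation_def Y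
      using q_value_nonneg[OF P z] by (intro gain_minus_loss_le) (simp_all add: e2ennreal_ereal)
  next
    \<comment> \<open>Infinite transport cost makes the integrand -\<infinity> everywhere, so the
      expected loss is infinite.\<close>
    case top
    then have "stage_payoff c lam \<nu> (x, u, \<mu>) + ereal \<alpha> * ereal (quad P (f x u w) + z) = - \<infinity>" for w
      using lam by (simp add: stage_payoff_def)
    then show ?thesis
      by (simp add: bellman_payoff_def ext_expectation_def gain_minus_loss_def emeasure_space_1)
  qed
qed

lemma bellman_payoff_worst_distribution:
  assumes P: "admissible P" and z: "0 \<le> z"
  shows "bellman_payoff f c \<alpha> lam \<nu> (\<lambda>x. ereal (quad P x + z)) x u
    (worst_distribution P (A *v x + B *v u)) = ereal (q_value P z x u)"
proof (rule antisym)
  let ?y = "A *v x + B *v u"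
  let ?\<mu> = "worst_distribution P ?y" and ?r = "transport P ?y"
  show "bellman_payoff f c \<alpha> lam \<nu> (\<lambda>x. ereal (quad P x + z)) x u ?\<mu> \<le> ereal (q_value P z x u)"
    by (intro bellman_payoff_le P z worst_distribution_in_prob_measures)
  have sets: "sets ?\<mu> = sets borel" and ps: "prob_space ?\<mu>"
    using worst_distribution_in_prob_measures[of P ?y] by (auto simp: space_prob_algebra)
  note [measurable_cong] = sets
  interpret prob_space ?\<mu> by fact
  define \<phi> where "\<phi> = (\<lambda>w. \<alpha> * (quad P (?y + \<Xi> *v w) + z))"
  have [measurable]: "\<phi> \<in> borel_measurable ?\<mu>" unfolding \<phi>_def by measurable
  have \<phi>: "0 \<le> \<phi> w" for w
    using P z \<alpha> by (auto simp: \<phi>_def admissible_def pos_semidef_def)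
  let ?Y = "\<lambda>w. stage_payoff c lam \<nu> (x, u, ?\<mu>) + ereal \<alpha> * ereal (quad P (f x u w) + z)"
  let ?Z = "\<lambda>w. c x u - lam * ?r + \<phi> w"
  \<comment> \<open>The pairing cost is at least the Wasserstein cost, so \<open>?Z\<close>
    underestimates the payoff. That suffices, since the upper bound holds for every measure.\<close>
  have Y: "ereal (?Z w) \<le> ?Y w" for w
  proof -
    have "ereal (c x u - lam * ?r) + ereal (\<phi> w) \<le> ?Y w"
      using stage_payoff_antimono[OF lam wasserstein_cost_worst_distribution transport_nonneg]
      by (intro add_mono) (auto simp: \<phi>_def system_eq)
    then show ?thesis by simp
  qed
  have "(\<integral>\<^sup>+ w. ennreal (\<phi> w) \<partial>?\<mu>)
      = ennreal \<alpha> * (\<integral>\<^sup>+ w. ennreal (quad P (?y + \<Xi> *v w) + z) \<partial>?\<mu>)"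
    unfolding \<phi>_def using \<alpha> P z
    by (subst nn_integral_cmult[symmetric])
      (auto simp: ennreal_mult admissible_def pos_semidef_def)
  also have "\<dots> = ennreal (worst_gain P ?y + \<alpha> * z) + ennreal (lam * ?r)"
    unfolding continuation_worst_distribution[OF P z] using lam transport_nonneg
      worst_gain_nonneg[OF P] \<alpha> z by (simp add: ennreal_plus[symmetric] del: ennreal_plus)
  finally have cont: "(\<integral>\<^sup>+ w. ennreal (\<phi> w) \<partial>?\<mu>)
      = ennreal (worst_gain P ?y + \<alpha> * z) + ennreal (lam * ?r)" .
  have "(\<integral>\<^sup>+ w. ennreal (?Z w) \<partial>?\<mu>) + ennreal (lam * ?r)
      = (\<integral>\<^sup>+ w. ennreal (- ?Z w) \<partial>?\<mu>) + ennreal (c x u) + (\<integral>\<^sup>+ w. ennreal (\<phi> w) \<partial>?\<mu>)"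
    using \<phi> lam transport_nonneg cost_nonneg by (intro nn_integral_pos_neg_part ps) auto
  also have "\<dots> = ennreal (q_value P z x u) + (\<integral>\<^sup>+ w. ennreal (- ?Z w) \<partial>?\<mu>) + ennreal (lam * ?r)"
    unfolding cont using cost_nonneg[of x u] worst_gain_nonneg[OF P, of ?y] \<alpha> z
    by (simp add: q_value_def ac_simps)
  finally have Z: "(\<integral>\<^sup>+ w. ennreal (?Z w) \<partial>?\<mu>)
      = ennreal (q_value P z x u) + (\<integral>\<^sup>+ w. ennreal (- ?Z w) \<partial>?\<mu>)"
    by (simp add: ennreal_add_left_cancel add.commute[of _ "ennreal (lam * ?r)"])
  \<comment> \<open>Cost and continuation are nonnegative, so the loss is at most the transport
    penalty, a finite constant.\<close>
  have "(\<integral>\<^sup>+ w. ennreal (- ?Z w) \<partial>?\<mu>) \<le> (\<integral>\<^sup>+ w. ennreal (lam * ?r) \<partial>?\<mu>)"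
  proof (intro nn_integral_mono ennreal_leI)
    show "- ?Z w \<le> lam * ?r" for w using \<phi>[of w] cost_nonneg[of x u] by simp
  qed
  also have "\<dots> < \<infinity>" by (simp add: emeasure_space_1)
  finally have fin: "(\<integral>\<^sup>+ w. ennreal (- ?Z w) \<partial>?\<mu>) < \<infinity>" .
  have "ereal (q_value P z x u)
      \<le> gain_minus_loss (\<integral>\<^sup>+ w. ennreal (?Z w) \<partial>?\<mu>) (\<integral>\<^sup>+ w. ennreal (- ?Z w) \<partial>?\<mu>)"
    using q_value_nonneg[OF P z] fin Z by (intro gain_minus_loss_ge) auto
  also have "\<dots> \<le> bellman_payoff f c \<alpha> lam \<nu> (\<lambda>x. ereal (quad P x + z)) x u ?\<mu>"
    unfolding bellman_payoff_def ext_expectation_def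
  proof (intro gain_minus_loss_mono nn_integral_mono)
    show "ennreal (?Z w) \<le> e2ennreal (?Y w)" for w
      using e2ennreal_mono[OF Y[of w]] by (simp add: e2ennreal_ereal)
    have "- ?Y w \<le> ereal (- ?Z w)" for w
      using Y[of w] unfolding uminus_ereal.simps(1)[symmetric] by (simp only: ereal_minus_le_minus)
    from e2ennreal_mono[OF this] show "e2ennreal (- ?Y w) \<le> ennreal (- ?Z w)" for w
      by (simp only: e2ennreal_ereal)
  qed
  finally show "ereal (q_value P z x u)
      \<le> bellman_payoff f c \<alpha> lam \<nu> (\<lambda>x. ereal (quad P x + z)) x u ?\<mu>" .
qed

lemma SUP_bellman_payoff:
  assumes P: "admissible P" and z: "0 \<le> z"
  shows "(SUP \<mu>\<in>prob_measures. bellman_payoff f c \<alpha> lam \<nu> (\<lambda>x. ereal (quad P x + z)) x u \<mu>)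
    = ereal (q_value P z x u)"
proof (intro antisym SUP_least bellman_payoff_le P z)
  show "ereal (q_value P z x u)
      \<le> (SUP \<mu>\<in>prob_measures. bellman_payoff f c \<alpha> lam \<nu> (\<lambda>x. ereal (quad P x + z)) x u \<mu>)"
    unfolding bellman_payoff_worst_distribution[OF P z, symmetric]
    by (rule SUP_upper[OF worst_distribution_in_prob_measures])
qed

lemma bellman_operator_eq:
  assumes P: "admissible P" and z: "0 \<le> z"
  shows "bellman_operator f c \<alpha> lam \<nu> (\<lambda>x. ereal (quad P x + z)) x
    = ereal (quad (riccati P) x + noise_value P + \<alpha> * z)"
  unfolding bellman_operator_def SUP_bellman_payoff[OF assms]
proof (rule antisym)
  show "(INF u. ereal (q_value P z x u)) \<le> ereal (quad (riccati P) x + noise_value P + \<alpha> * z)"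
    by (rule INF_lower2[where i = "gain P *v x"]) (simp_all add: q_value_eq[OF P])
  show "ereal (quad (riccati P) x + noise_value P + \<alpha> * z) \<le> (INF u. ereal (q_value P z x u))"
    using pos_def_nonneg[OF pos_def_ctl[OF P]] by (intro INF_greatest) (simp add: q_value_eq[OF P])
qed

end

section \<open>Path laws\<close>

lemma telescoping_upper:
  fixes a :: ennreal and p q s v :: "nat \<Rightarrow> ennreal"
  assumes step: "\<And>t. p t + s t + a * v (Suc t) \<le> v t + q t"
  shows "(\<Sum>t. a ^ t * p t) + (\<Sum>t. a ^ t * s t) \<le> v 0 + (\<Sum>t. a ^ t * q t)"
proof -
  have *: "(\<Sum>t<T. a ^ t * (p t + s t)) + a ^ T * v T \<le> v 0 + (\<Sum>t<T. a ^ t * q t)" for T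
  proof (induction T)
    case (Suc T)
    have "(\<Sum>t<Suc T. a ^ t * (p t + s t)) + a ^ Suc T * v (Suc T)
        = (\<Sum>t<T. a ^ t * (p t + s t)) + a ^ T * (p T + s T + a * v (Suc T))"
      by (simp add: algebra_simps)
    also have "\<dots> \<le> (\<Sum>t<T. a ^ t * (p t + s t)) + a ^ T * (v T + q T)"
      by (intro add_left_mono mult_left_mono step) simp
    also have "\<dots> = ((\<Sum>t<T. a ^ t * (p t + s t)) + a ^ T * v T) + a ^ T * q T"
      by (simp add: algebra_simps)
    also have "\<dots> \<le> (v 0 + (\<Sum>t<T. a ^ t * q t)) + a ^ T * q T"
      by (intro add_right_mono Suc.IH)
    finally show ?case by (simp add: algebra_simps)
  qed simp
  have "(\<Sum>t. a ^ t * p t) + (\<Sum>t. a ^ t * s t) = (\<Sum>t. a ^ t * (p t + s t))"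
    by (simp add: suminf_add distrib_left)
  also have "\<dots> \<le> v 0 + (\<Sum>t. a ^ t * q t)"
  proof (rule suminf_le_const)
    fix T
    have "(\<Sum>t<T. a ^ t * (p t + s t)) \<le> (\<Sum>t<T. a ^ t * (p t + s t)) + a ^ T * v T"
      by simp
    also have "\<dots> \<le> v 0 + (\<Sum>t<T. a ^ t * q t)" by (rule *)
    also have "\<dots> \<le> v 0 + (\<Sum>t. a ^ t * q t)"
      by (intro add_left_mono sum_le_suminf) auto
    finally show "(\<Sum>t<T. a ^ t * (p t + s t)) \<le> v 0 + (\<Sum>t. a ^ t * q t)" .
  qed simp
  finally show ?thesis .
qed

text \<open>Here the remainder sits on the larger side and cannot be dropped; it disappears because
  the values vanish from time T on.\<close>

lemma telescoping_lower:
  fixes a :: ennreal and p q v :: "nat \<Rightarrow> ennreal"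
  assumes step: "\<And>t. v t + q t \<le> p t + a * v (Suc t)" and final: "\<And>t. T \<le> t \<Longrightarrow> v t = 0"
  shows "v 0 + (\<Sum>t. a ^ t * q t) \<le> (\<Sum>t. a ^ t * p t)"
proof -
  have *: "v 0 + (\<Sum>t<n. a ^ t * q t) \<le> (\<Sum>t<n. a ^ t * p t) + a ^ n * v n" for n
  proof (induction n)
    case (Suc n)
    have "v 0 + (\<Sum>t<Suc n. a ^ t * q t) = (v 0 + (\<Sum>t<n. a ^ t * q t)) + a ^ n * q n"
      by (simp add: algebra_simps)
    also have "\<dots> \<le> ((\<Sum>t<n. a ^ t * p t) + a ^ n * v n) + a ^ n * q n"
      by (intro add_right_mono Suc.IH)
    also have "\<dots> = (\<Sum>t<n. a ^ t * p t) + a ^ n * (v n + q n)"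
      by (simp add: algebra_simps)
    also have "\<dots> \<le> (\<Sum>t<n. a ^ t * p t) + a ^ n * (p n + a * v (Suc n))"
      by (intro add_left_mono mult_left_mono step) simp
    finally show ?case by (simp add: algebra_simps)
  qed simp
  have **: "v 0 + (\<Sum>t<n. a ^ t * q t) \<le> (\<Sum>t. a ^ t * p t)" if "T \<le> n" for n
  proof -
    have "v 0 + (\<Sum>t<n. a ^ t * q t) \<le> (\<Sum>t<n. a ^ t * p t)"
      using *[of n] final[OF that] by simp
    also have "\<dots> \<le> (\<Sum>t. a ^ t * p t)" by (intro sum_le_suminf) auto
    finally show ?thesis .
  qed
  have "(\<lambda>n. v 0 + (\<Sum>t<n. a ^ t * q t)) \<longlonglongrightarrow> v 0 + (\<Sum>t. a ^ t * q t)"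
    by (intro tendsto_add tendsto_const summable_LIMSEQ) simp
  then show ?thesis
    by (rule LIMSEQ_le_const2) (use ** in blast)
qed

text \<open>Finite intersections of a countable basis form a countable Int-stable generator of the
  Borel sets. Countability lets almost sure equality of random measures be tested one set at a
  time.\<close>

lemma countable_determining_family:
  obtains \<B> :: "'w :: euclidean_space set set"
  where "countable \<B>" and "\<And>U. U \<in> \<B> \<Longrightarrow> open U"
    and "\<And>\<mu> \<nu>. \<mu> \<in> prob_measures \<Longrightarrow> \<nu> \<in> prob_measures \<Longrightarrow>
      (\<And>U. U \<in> \<B> \<Longrightarrow> emeasure \<mu> U = emeasure \<nu> U) \<Longrightarrow> \<mu> = \<nu>"
proof -
  obtain \<C> :: "'w set set" where \<C>: "countable \<C>" "topological_basis \<C>"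
    using ex_countable_basis by auto
  define \<B> where "\<B> = Inter ` {F. finite F \<and> F \<subseteq> \<C>}"
  have "countable \<B>"
    unfolding \<B>_def by (intro countable_image countable_Collect_finite_subset \<C>)
  moreover have op: "open U" if "U \<in> \<B>" for U
    using that topological_basis_open[OF \<C>(2)] unfolding \<B>_def by (blast intro: open_Inter)
  moreover have "\<mu> = \<nu>"
    if \<mu>: "\<mu> \<in> prob_measures" and \<nu>: "\<nu> \<in> prob_measures"
      and eq: "\<And>U. U \<in> \<B> \<Longrightarrow> emeasure \<mu> U = emeasure \<nu> U" for \<mu> \<nu>
  proof (rule measure_eqI_generator_eq[where E = \<B> and \<Omega> = UNIV and A = "\<lambda>_. UNIV"])
    show "Int_stable \<B>"
    proof (rule Int_stableI)
      fix a b assume "a \<in> \<B>" "b \<in> \<B>"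
      then obtain F G where "a = \<Inter>F" "b = \<Inter>G" "finite (F \<union> G)" "F \<union> G \<subseteq> \<C>"
        by (auto simp: \<B>_def)
      moreover from this have "a \<inter> b = \<Inter>(F \<union> G)" by auto
      ultimately show "a \<inter> b \<in> \<B>" unfolding \<B>_def by blast
    qed
    have sub: "\<C> \<subseteq> \<B>"
    proof
      fix a assume "a \<in> \<C>"
      then show "a \<in> \<B>" unfolding \<B>_def by (intro image_eqI[of _ _ "{a}"]) auto
    qed
    have "sets (borel :: 'w measure) = sigma_sets UNIV \<C>"
      unfolding borel_eq_countable_basis[OF \<C>] by (rule sets_measure_of) simp
    moreover have "sigma_sets UNIV \<C> \<subseteq> sigma_sets UNIV \<B>"
      by (rule sigma_sets_mono'[OF sub])
    moreover have "sigma_sets UNIV \<B> \<subseteq> sets (borel :: 'w measure)"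
      using op sets.sigma_sets_subset[of \<B> "borel :: 'w measure"] by (auto simp: subset_eq)
    ultimately have s: "sets (borel :: 'w measure) = sigma_sets UNIV \<B>" by auto
    show "sets \<mu> = sigma_sets UNIV \<B>" "sets \<nu> = sigma_sets UNIV \<B>"
      using \<mu> \<nu> s by (simp_all add: space_prob_algebra)
    \<comment> \<open>UNIV is the intersection of the empty family.\<close>
    show "range (\<lambda>_. UNIV) \<subseteq> \<B>"
      unfolding \<B>_def by (auto intro!: image_eqI[of _ _ "{}"])
    have "emeasure \<mu> UNIV = 1"
      using \<mu> prob_space.emeasure_space_1[of \<mu>] sets_eq_imp_space_eq[of \<mu> borel]
      by (simp add: space_prob_algebra)
    then show "emeasure \<mu> UNIV \<noteq> \<infinity>" by simp
  qed (auto intro: eq)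
  ultimately show ?thesis by (rule that)
qed

text \<open>Equality of the two measures amounts to countably many equalities of measurable
  evaluations.\<close>

lemma sets_prob_measures_eq:
  fixes F G :: "'a \<Rightarrow> 'w :: euclidean_space measure"
  assumes [measurable]: "F \<in> M \<rightarrow>\<^sub>M prob_algebra borel" "G \<in> M \<rightarrow>\<^sub>M prob_algebra borel"
  shows "{s \<in> space M. F s = G s} \<in> sets M"
proof -
  obtain \<B> :: "'w set set" where \<B>: "countable \<B>" "\<And>U. U \<in> \<B> \<Longrightarrow> open U"
    "\<And>\<mu> \<nu>. \<mu> \<in> prob_measures \<Longrightarrow> \<nu> \<in> prob_measures \<Longrightarrow>
      (\<And>U. U \<in> \<B> \<Longrightarrow> emeasure \<mu> U = emeasure \<nu> U) \<Longrightarrow> \<mu> = \<nu>"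
    using countable_determining_family by metis
  have "{s \<in> space M. F s = G s} = {s \<in> space M. \<forall>U\<in>\<B>. emeasure (F s) U = emeasure (G s) U}"
    using measurable_space[OF assms(1)] measurable_space[OF assms(2)] \<B>(3) by auto
  moreover have "(\<lambda>s. emeasure (H s) U) \<in> borel_measurable M"
    if "H \<in> M \<rightarrow>\<^sub>M prob_algebra borel" "U \<in> \<B>" for H :: "'a \<Rightarrow> 'w measure" and U
    using that \<B>(2) measurable_prob_algebraD[OF that(1)]
    by (intro measurable_compose[OF _ measurable_emeasure_subprob_algebra]) auto
  ultimately show ?thesis
    using \<B>(1) assms by (auto intro!: sets.sets_Collect_countable_Ball borel_measurable_eq)
qed

section \<open>One-stage marginals of the path law\<close>

locale controlled_process =
  fixes f :: "'x :: euclidean_space \<Rightarrow> 'u :: euclidean_space \<Rightarrow> 'w :: euclidean_space \<Rightarrow> 'x"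
    and \<pi> :: "('x, 'u) policyI" and \<gamma> :: "('x, 'u, 'w) policyII" and x0 :: 'x
  assumes f: "(\<lambda>(x, u, w). f x u w) \<in> borel \<Otimes>\<^sub>M borel \<Otimes>\<^sub>M borel \<rightarrow>\<^sub>M borel"
    and \<pi>: "\<pi> \<in> policiesI" and \<gamma>: "\<gamma> \<in> policiesII"
begin

abbreviation "law \<equiv> path_law f \<pi> \<gamma> x0"
abbreviation "past t \<equiv> (\<Pi>\<^sub>M s\<in>{0..<t}. stage_space) :: (nat \<Rightarrow> ('x, 'u, 'w) stage) measure"

definition stage_expectation :: "nat \<Rightarrow> (('x, 'u, 'w) stage \<Rightarrow> ennreal) \<Rightarrow> ennreal" where
  "stage_expectation t \<phi> = (\<integral>\<^sup>+ \<omega>. \<phi> (\<omega> t) \<partial>law)"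

sublocale IT: Ionescu_Tulcea "stage_kernel f \<pi> \<gamma> x0" "\<lambda>_. stage_space"
  by (rule Ionescu_Tulcea_stage_kernel[OF f \<pi> \<gamma>])

lemma law_eq: "law = IT.PF.lim"
  by (simp add: path_law_def)

lemma sets_law [measurable_cong]: "sets law = sets (\<Pi>\<^sub>M t\<in>UNIV. stage_space)"
  unfolding law_eq by (rule IT.PF.sets_lim)

lemma prob_space_law: "prob_space law"
proof -
  \<comment> \<open>The projection to the empty index set already carries the total mass.\<close>
  have "prob_space (distr IT.PF.lim (PiM {} (\<lambda>_. stage_space)) (\<lambda>x. restrict x {}))"
    unfolding IT.distr_lim[OF finite.emptyI] by (rule IT.PF.prob_space_P) auto
  then show ?thesis
    unfolding law_eq by (rule prob_space_distrD[rotated]) (auto simp: measurable_cong_sets[OF IT.PF.sets_lim])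
qed

text \<open>On the first n stages the projective limit agrees with the composed kernel
  \<open>IT.C\<close>, from which the last stage can be split off.\<close>

lemma nn_integral_law_restrict:
  assumes [measurable]: "F \<in> borel_measurable (past n)"
  shows "(\<integral>\<^sup>+ \<omega>. F (restrict \<omega> {0..<n}) \<partial>law) = (\<integral>\<^sup>+ \<omega>. F \<omega> \<partial>IT.C 0 n (\<lambda>_. undefined))"
proof -
  have s: "(\<lambda>_. undefined) \<in> space (past 0)" by (simp add: space_PiM)
  have "IT.up_to {0..<n} = n"
    unfolding IT.up_to_def by (rule Least_equality) (auto simp: not_le[symmetric])
  then have "IT.CI {0..<n} = distr (IT.C 0 n (\<lambda>_. undefined)) (past n) (\<lambda>\<omega>. restrict \<omega> {0..<n})"
    by (simp add: IT.CI_def)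
  also have "\<dots> = distr (IT.C 0 n (\<lambda>_. undefined)) (past n) (\<lambda>\<omega>. \<omega>)"
    using IT.space_C[OF s, of n] by (intro distr_cong) (auto simp: space_PiM)
  also have "\<dots> = IT.C 0 n (\<lambda>_. undefined)"
    using IT.sets_C[OF s, of n] by (intro distr_id2) simp
  finally have "distr law (past n) (\<lambda>\<omega>. restrict \<omega> {0..<n}) = IT.C 0 n (\<lambda>_. undefined)"
    unfolding law_eq by (subst IT.distr_lim) auto
  moreover have "(\<lambda>\<omega>. restrict \<omega> {0..<n}) \<in> law \<rightarrow>\<^sub>M past n"
    by measurable
  ultimately show ?thesis
    using nn_integral_distr[of "\<lambda>\<omega>. restrict \<omega> {0..<n}" law "past n" F] assms IT.sets_C[OF s, of n]
    by (simp cong: measurable_cong_sets)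
qed

lemma stage_expectation_kernel:
  assumes [measurable]: "\<phi> \<in> borel_measurable stage_space"
  shows "stage_expectation t \<phi>
    = (\<integral>\<^sup>+ \<omega>. (\<integral>\<^sup>+ s. \<phi> s \<partial>stage_kernel f \<pi> \<gamma> x0 t (restrict \<omega> {0..<t})) \<partial>law)"
proof -
  have s: "(\<lambda>_. undefined) \<in> space (past 0)" by (simp add: space_PiM)
  have F: "(\<lambda>\<omega>. \<phi> (\<omega> t)) \<in> borel_measurable (past (Suc t))"
    by measurable
  have "stage_expectation t \<phi> = (\<integral>\<^sup>+ \<omega>. \<phi> (restrict \<omega> {0..<Suc t} t) \<partial>law)"
    by (simp add: stage_expectation_def)
  also have "\<dots> = (\<integral>\<^sup>+ \<omega>. \<phi> (\<omega> t) \<partial>IT.C 0 (Suc t) (\<lambda>_. undefined))"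
    by (rule nn_integral_law_restrict[OF F])
  also have "\<dots> = (\<integral>\<^sup>+ \<omega>. (\<integral>\<^sup>+ \<omega>'. \<phi> (\<omega>' t) \<partial>IT.eP t \<omega>) \<partial>IT.C 0 t (\<lambda>_. undefined))"
    using IT.measurable_eP[of t] IT.sets_C[OF s, of t] F
    by (simp, subst nn_integral_bind[where B = "past (Suc t)"]) (simp_all cong: measurable_cong_sets)
  also have "\<dots> = (\<integral>\<^sup>+ \<omega>. (\<integral>\<^sup>+ s. \<phi> s \<partial>stage_kernel f \<pi> \<gamma> x0 t \<omega>) \<partial>IT.C 0 t (\<lambda>_. undefined))"
    using IT.space_C[OF s, of t]
    by (intro nn_integral_cong) (simp add: IT.nn_integral_eP[OF _ F])
  also have "\<dots> = (\<integral>\<^sup>+ \<omega>. (\<integral>\<^sup>+ s. \<phi> s \<partial>stage_kernel f \<pi> \<gamma> x0 t (restrict \<omega> {0..<t})) \<partial>law)"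
    by (intro nn_integral_law_restrict[symmetric]
        measurable_compose[OF IT.P nn_integral_measurable_subprob_algebra] assms)
  finally show ?thesis .
qed

lemma state_law_in_prob_algebra:
  assumes \<omega>: "\<omega> \<in> space (past t)"
  shows "state_law f x0 t \<omega> \<in> space (prob_algebra borel)"
proof (cases t)
  case 0
  then show ?thesis by (simp add: state_law_def space_prob_algebra prob_space_return)
next
  case (Suc s)
  obtain x u \<mu> where s: "\<omega> s = (x, u, \<mu>)" by (cases "\<omega> s")
  have "\<omega> s \<in> space stage_space"
    using \<omega> Suc by (auto simp: space_PiM PiE_iff)
  then have \<mu>: "sets \<mu> = sets borel" "prob_space \<mu>"
    using s by (auto simp: stage_space_def space_pair_measure space_prob_algebra)
  have "(\<lambda>w. (x, u, w)) \<in> borel \<rightarrow>\<^sub>M borel \<Otimes>\<^sub>M borel \<Otimes>\<^sub>M borel"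
    by measurable
  from measurable_compose[OF this f] have "f x u \<in> \<mu> \<rightarrow>\<^sub>M borel"
    using \<mu>(1) by (simp cong: measurable_cong_sets)
  then show ?thesis
    using s Suc \<mu> by (simp add: state_law_def space_prob_algebra prob_space.prob_space_distr)
qed

lemma nn_integral_stage_kernel:
  assumes \<phi> [measurable]: "\<phi> \<in> borel_measurable stage_space" and \<omega>: "\<omega> \<in> space (past t)"
  shows "(\<integral>\<^sup>+ s. \<phi> s \<partial>stage_kernel f \<pi> \<gamma> x0 t \<omega>)
    = (\<integral>\<^sup>+ x. (\<integral>\<^sup>+ u. (\<integral>\<^sup>+ \<mu>. \<phi> (x, u, \<mu>) \<partial>\<gamma> t (\<omega>, x, u)) \<partial>\<pi> t (forget_measures t \<omega>, x)) \<partial>state_law f x0 t \<omega>)"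
proof -
  have forget: "forget_measures t \<omega> \<in> space (\<Pi>\<^sub>M s\<in>{0..<t}. borel \<Otimes>\<^sub>M borel)"
    by (auto simp: forget_measures_def space_PiM space_pair_measure)
  have \<pi>t: "\<pi> t \<in> (\<Pi>\<^sub>M s\<in>{0..<t}. borel \<Otimes>\<^sub>M borel) \<Otimes>\<^sub>M borel \<rightarrow>\<^sub>M prob_algebra borel"
    using \<pi> by (auto simp: policiesI_def hist_space_def)
  have \<gamma>t: "\<gamma> t \<in> past t \<Otimes>\<^sub>M borel \<Otimes>\<^sub>M borel \<rightarrow>\<^sub>M prob_algebra (prob_algebra borel)"
    using \<gamma> by (auto simp: policiesII_def ext_hist_space_def)
  have p [measurable]: "(\<lambda>x. \<pi> t (forget_measures t \<omega>, x)) \<in> borel \<rightarrow>\<^sub>M prob_algebra borel"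
    by (rule measurable_compose[OF measurable_Pair1'[OF forget] \<pi>t])
  have g [measurable]: "(\<lambda>y. \<gamma> t (\<omega>, y)) \<in> borel \<Otimes>\<^sub>M borel \<rightarrow>\<^sub>M prob_algebra (prob_algebra borel)"
    by (rule measurable_compose[OF measurable_Pair1'[OF \<omega>] \<gamma>t])
  have ret [measurable]: "(\<lambda>p. (fst (fst p), snd (fst p), snd p)) \<in>
      (borel \<Otimes>\<^sub>M borel) \<Otimes>\<^sub>M prob_algebra borel \<rightarrow>\<^sub>M (stage_space :: ('x, 'u, 'w) stage measure)"
    unfolding stage_space_def by measurable
  define k2 where "k2 = (\<lambda>y. \<gamma> t (\<omega>, y) \<bind> (\<lambda>\<mu>. return stage_space (fst y, snd y, \<mu>)))"
  have k2 [measurable]: "k2 \<in> borel \<Otimes>\<^sub>M borel \<rightarrow>\<^sub>M prob_algebra stage_space"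
    unfolding k2_def by measurable
  define k1 where "k1 = (\<lambda>x. \<pi> t (forget_measures t \<omega>, x) \<bind> (\<lambda>u. k2 (x, u)))"
  have k1 [measurable]: "k1 \<in> borel \<rightarrow>\<^sub>M prob_algebra stage_space"
    unfolding k1_def by measurable
  have sl: "sets (state_law f x0 t \<omega>) = sets borel"
    using state_law_in_prob_algebra[OF \<omega>] by (simp add: space_prob_algebra)
  have "stage_kernel f \<pi> \<gamma> x0 t \<omega> = state_law f x0 t \<omega> \<bind> k1"
    by (simp add: stage_kernel_def k1_def k2_def)
  also have "(\<integral>\<^sup>+ s. \<phi> s \<partial>\<dots>) = (\<integral>\<^sup>+ x. (\<integral>\<^sup>+ s. \<phi> s \<partial>k1 x) \<partial>state_law f x0 t \<omega>)"
    using measurable_prob_algebraD[OF k1] sl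
    by (intro nn_integral_bind[OF \<phi>]) (simp cong: measurable_cong_sets)
  also have "\<dots> = (\<integral>\<^sup>+ x. (\<integral>\<^sup>+ u. (\<integral>\<^sup>+ s. \<phi> s \<partial>k2 (x, u)) \<partial>\<pi> t (forget_measures t \<omega>, x)) \<partial>state_law f x0 t \<omega>)"
  proof (intro nn_integral_cong)
    fix x
    have "sets (\<pi> t (forget_measures t \<omega>, x)) = sets borel"
      using measurable_space[OF p, of x] by (simp add: space_prob_algebra)
    moreover have "(\<lambda>u. k2 (x, u)) \<in> borel \<rightarrow>\<^sub>M subprob_algebra stage_space"
      by (intro measurable_prob_algebraD) measurable
    ultimately show "(\<integral>\<^sup>+ s. \<phi> s \<partial>k1 x) = (\<integral>\<^sup>+ u. (\<integral>\<^sup>+ s. \<phi> s \<partial>k2 (x, u)) \<partial>\<pi> t (forget_measures t \<omega>, x))"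
      unfolding k1_def by (intro nn_integral_bind[OF \<phi>]) (simp cong: measurable_cong_sets)
  qed
  also have "\<dots> = (\<integral>\<^sup>+ x. (\<integral>\<^sup>+ u. (\<integral>\<^sup>+ \<mu>. \<phi> (x, u, \<mu>) \<partial>\<gamma> t (\<omega>, x, u)) \<partial>\<pi> t (forget_measures t \<omega>, x)) \<partial>state_law f x0 t \<omega>)"
  proof (intro nn_integral_cong)
    fix x u
    have sg: "sets (\<gamma> t (\<omega>, x, u)) = sets (prob_algebra borel)"
      using measurable_space[OF g, of "(x, u)"] by (simp add: space_prob_algebra space_pair_measure)
    have r: "(\<lambda>\<mu>. (x, u, \<mu>)) \<in> prob_algebra borel \<rightarrow>\<^sub>M (stage_space :: ('x, 'u, 'w) stage measure)"
      unfolding stage_space_def by measurable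
    have "(\<lambda>\<mu>. return (stage_space :: ('x, 'u, 'w) stage measure) (x, u, \<mu>)) \<in> prob_algebra borel
        \<rightarrow>\<^sub>M subprob_algebra stage_space"
      by (rule measurable_compose[OF r return_measurable])
    then have "(\<integral>\<^sup>+ s. \<phi> s \<partial>k2 (x, u))
        = (\<integral>\<^sup>+ \<mu>. (\<integral>\<^sup>+ s. \<phi> s \<partial>return stage_space (x, u, \<mu>)) \<partial>\<gamma> t (\<omega>, x, u))"
      unfolding k2_def using sg by (simp, intro nn_integral_bind[OF \<phi>]) (simp cong: measurable_cong_sets)
    also have "\<dots> = (\<integral>\<^sup>+ \<mu>. \<phi> (x, u, \<mu>) \<partial>\<gamma> t (\<omega>, x, u))"
      using sg sets_eq_imp_space_eq[OF sg] measurable_space[OF r]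
      by (intro nn_integral_cong nn_integral_return \<phi>) auto
    finally show "(\<integral>\<^sup>+ s. \<phi> s \<partial>k2 (x, u)) = (\<integral>\<^sup>+ \<mu>. \<phi> (x, u, \<mu>) \<partial>\<gamma> t (\<omega>, x, u))" .
  qed
  finally show ?thesis .
qed

lemma stage_expectation_iterated:
  assumes "\<phi> \<in> borel_measurable stage_space"
  shows "stage_expectation t \<phi> = (\<integral>\<^sup>+ \<omega>. (\<integral>\<^sup>+ x. (\<integral>\<^sup>+ u. (\<integral>\<^sup>+ \<mu>. \<phi> (x, u, \<mu>)
    \<partial>\<gamma> t (restrict \<omega> {0..<t}, x, u)) \<partial>\<pi> t (forget_measures t (restrict \<omega> {0..<t}), x))
    \<partial>state_law f x0 t (restrict \<omega> {0..<t})) \<partial>law)"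
  unfolding stage_expectation_kernel[OF assms]
  by (intro nn_integral_cong nn_integral_stage_kernel assms)
    (auto simp: space_PiM PiE_iff sets_eq_imp_space_eq[OF sets_law])

lemma space_law: "\<omega> \<in> space law \<Longrightarrow> \<omega> t \<in> space stage_space"
  by (auto simp: space_PiM PiE_iff sets_eq_imp_space_eq[OF sets_law])

lemma restrict_past: "\<omega> \<in> space law \<Longrightarrow> restrict \<omega> {0..<t} \<in> space (past t)"
  by (auto simp: space_PiM PiE_iff sets_eq_imp_space_eq[OF sets_law])

lemma policyI_in_prob_algebra:
  assumes "\<omega> \<in> space (past t)"
  shows "\<pi> t (forget_measures t \<omega>, x) \<in> space (prob_algebra borel)"
proof -
  have "(forget_measures t \<omega>, x) \<in> space (hist_space t)"
    by (auto simp: forget_measures_def hist_space_def space_PiM space_pair_measure)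
  then show ?thesis
    using \<pi> by (auto simp: policiesI_def dest: measurable_space)
qed

lemma policyII_in_prob_algebra:
  assumes "\<omega> \<in> space (past t)"
  shows "\<gamma> t (\<omega>, x, u) \<in> space (prob_algebra (prob_algebra borel))"
proof -
  have "(\<omega>, x, u) \<in> space (ext_hist_space t)"
    using assms by (auto simp: ext_hist_space_def space_pair_measure)
  then show ?thesis
    using \<gamma> by (auto simp: policiesII_def dest: measurable_space)
qed

lemma stage_expectation_control:
  assumes B: "(\<lambda>(x, u). B x u) \<in> borel_measurable (borel \<Otimes>\<^sub>M borel)"
  shows "stage_expectation t (\<lambda>(x, u, \<mu>). B x u) = (\<integral>\<^sup>+ \<omega>. (\<integral>\<^sup>+ x. (\<integral>\<^sup>+ u. B x u
    \<partial>\<pi> t (forget_measures t (restrict \<omega> {0..<t}), x))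
    \<partial>state_law f x0 t (restrict \<omega> {0..<t})) \<partial>law)"
proof -
  have "(\<lambda>s. (fst s, fst (snd s))) \<in> stage_space \<rightarrow>\<^sub>M borel \<Otimes>\<^sub>M borel"
    unfolding stage_space_def by measurable
  from measurable_compose[OF this B]
  have "(\<lambda>(x, u, \<mu>). B x u) \<in> borel_measurable stage_space" by (simp add: split_beta')
  from stage_expectation_iterated[OF this] show ?thesis
    using policyII_in_prob_algebra[OF restrict_past]
    by (auto simp: space_prob_algebra prob_space.emeasure_space_1 intro!: nn_integral_cong)
qed

lemma stage_expectation_state:
  assumes [measurable]: "b \<in> borel_measurable borel"
  shows "stage_expectation t (\<lambda>(x, u, \<mu>). b x)
    = (\<integral>\<^sup>+ \<omega>. (\<integral>\<^sup>+ x. b x \<partial>state_law f x0 t (restrict \<omega> {0..<t})) \<partial>law)"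
proof -
  have "(\<lambda>(x, u :: 'u). b x) \<in> borel_measurable (borel \<Otimes>\<^sub>M borel)" by measurable
  from stage_expectation_control[OF this] show ?thesis
    using policyI_in_prob_algebra[OF restrict_past]
    by (auto simp: space_prob_algebra prob_space.emeasure_space_1 intro!: nn_integral_cong)
qed

lemma stage_expectation_initial_state:
  assumes "b \<in> borel_measurable borel"
  shows "stage_expectation 0 (\<lambda>(x, u, \<mu>). b x) = b x0"
  using assms prob_space.emeasure_space_1[OF prob_space_law]
  by (simp add: stage_expectation_state state_law_def nn_integral_return)

lemma stage_expectation_initial_control:
  assumes B: "(\<lambda>(x, u). B x u) \<in> borel_measurable (borel \<Otimes>\<^sub>M borel)"
  shows "stage_expectation 0 (\<lambda>(x, u, \<mu>). B x u) = (\<integral>\<^sup>+ u. B x0 u \<partial>\<pi> 0 (\<lambda>_. undefined, x0))"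
proof -
  have "(\<lambda>_. undefined, x) \<in> space (hist_space 0)" for x :: 'x
    by (simp add: hist_space_def space_PiM space_pair_measure)
  have P: "(\<lambda>x. \<pi> 0 (\<lambda>_. undefined, x)) \<in> borel \<rightarrow>\<^sub>M prob_algebra borel"
  proof (rule measurable_compose[OF measurable_Pair1'])
    have "\<pi> 0 \<in> hist_space 0 \<rightarrow>\<^sub>M prob_algebra borel"
      using \<pi> by (simp add: policiesI_def)
    then show "\<pi> 0 \<in> (\<Pi>\<^sub>M s\<in>{0..<0}. borel \<Otimes>\<^sub>M borel) \<Otimes>\<^sub>M borel \<rightarrow>\<^sub>M prob_algebra borel"
      unfolding hist_space_def .
  qed (simp add: space_PiM)
  have "(\<lambda>x. \<integral>\<^sup>+ u. B x u \<partial>\<pi> 0 (\<lambda>_. undefined, x)) \<in> borel_measurable borel"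
    by (rule nn_integral_measurable_subprob_algebra2[OF B measurable_prob_algebraD[OF P]])
  then show ?thesis
    using prob_space.emeasure_space_1[OF prob_space_law]
    by (simp add: stage_expectation_control[OF B] state_law_def forget_measures_def nn_integral_return
        restrict_def)
qed

lemma continuation_measurable:
  assumes [measurable]: "b \<in> borel_measurable borel"
  shows "(\<lambda>(x, u, \<mu>). \<integral>\<^sup>+ w. b (f x u w) \<partial>\<mu>) \<in> borel_measurable stage_space"
proof -
  have "(\<lambda>p. (fst (fst p), fst (snd (fst p)), snd p)) \<in>
      (borel \<Otimes>\<^sub>M borel \<Otimes>\<^sub>M prob_algebra borel) \<Otimes>\<^sub>M borel \<rightarrow>\<^sub>M borel \<Otimes>\<^sub>M borel \<Otimes>\<^sub>M borel"
    by measurable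
  from measurable_compose[OF measurable_compose[OF this f] assms]
  have "(\<lambda>(s, w). b (f (fst s) (fst (snd s)) w)) \<in> borel_measurable (stage_space \<Otimes>\<^sub>M borel)"
    by (simp add: stage_space_def split_beta')
  moreover have "(\<lambda>s. snd (snd s)) \<in> stage_space \<rightarrow>\<^sub>M prob_algebra borel"
    unfolding stage_space_def by measurable
  ultimately have "(\<lambda>s. \<integral>\<^sup>+ w. b (f (fst s) (fst (snd s)) w) \<partial>snd (snd s)) \<in> borel_measurable stage_space"
    by (intro nn_integral_measurable_subprob_algebra2 measurable_prob_algebraD)
  then show ?thesis by (simp add: split_beta')
qed

text \<open>A stage records the measure chosen by Player II but not the disturbance. The next state
  is drawn from the image of that measure under f, so one integral against it is the whole
  transition.\<close>

lemma stage_expectation_Suc: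
  assumes b [measurable]: "b \<in> borel_measurable borel"
  shows "stage_expectation (Suc t) (\<lambda>(x, u, \<mu>). b x)
    = stage_expectation t (\<lambda>(x, u, \<mu>). \<integral>\<^sup>+ w. b (f x u w) \<partial>\<mu>)"
  unfolding stage_expectation_state[OF b] stage_expectation_def[of t]
proof (rule nn_integral_cong)
  fix \<omega> assume \<omega>: "\<omega> \<in> space law"
  obtain x u \<mu> where s: "\<omega> t = (x, u, \<mu>)" by (cases "\<omega> t")
  have "sets \<mu> = sets borel"
    using space_law[OF \<omega>, of t] s by (auto simp: stage_space_def space_pair_measure space_prob_algebra)
  moreover have "(\<lambda>w. (x, u, w)) \<in> borel \<rightarrow>\<^sub>M borel \<Otimes>\<^sub>M borel \<Otimes>\<^sub>M borel"
    by measurable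
  note measurable_compose[OF this f]
  ultimately have "f x u \<in> \<mu> \<rightarrow>\<^sub>M borel"
    by (simp cong: measurable_cong_sets)
  then show "(\<integral>\<^sup>+ x. b x \<partial>state_law f x0 (Suc t) (restrict \<omega> {0..<Suc t}))
      = (case \<omega> t of (x, u, \<mu>) \<Rightarrow> \<integral>\<^sup>+ w. b (f x u w) \<partial>\<mu>)"
    by (simp add: state_law_def s nn_integral_distr)
qed

lemma component_measurable:
  assumes "\<phi> \<in> stage_space \<rightarrow>\<^sub>M M"
  shows "(\<lambda>\<omega>. \<phi> (\<omega> t)) \<in> law \<rightarrow>\<^sub>M M"
proof -
  have "(\<lambda>\<omega>. \<omega> t) \<in> (\<Pi>\<^sub>M t\<in>UNIV. stage_space) \<rightarrow>\<^sub>M stage_space"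
    by (rule measurable_component_singleton) simp
  from measurable_compose[OF this assms] show ?thesis
    by (subst measurable_cong_sets[OF sets_law refl])
qed

lemma AE_law_if_null:
  assumes D: "D \<in> sets stage_space"
    and 0: "stage_expectation t (indicator (space stage_space - D)) = 0"
  shows "AE \<omega> in law. \<omega> t \<in> D"
proof -
  have "(\<lambda>\<omega>. indicator (space stage_space - D) (\<omega> t) :: ennreal) \<in> borel_measurable law"
    using D by (intro component_measurable borel_measurable_indicator) auto
  from nn_integral_0_iff_AE[OF this] 0
  have "AE \<omega> in law. (indicator (space stage_space - D) (\<omega> t) :: ennreal) = 0"
    by (simp add: stage_expectation_def)
  then show ?thesis
    by (rule AE_mp) (auto intro!: AE_I2 dest: space_law split: split_indicator_asm)
qed

text \<open>The path space contains all sequences, so following the feedback is an almost sure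
  statement: the complement of the graph of k has probability zero at every stage.\<close>

lemma AE_control:
  assumes \<pi>k: "\<pi> = det_stationary_policyI k" and k [measurable]: "k \<in> borel \<rightarrow>\<^sub>M borel"
  shows "AE \<omega> in law. fst (snd (\<omega> t)) = k (fst (\<omega> t))"
proof -
  define D where "D = {s \<in> space (stage_space :: ('x, 'u, 'w) stage measure). fst (snd s) = k (fst s)}"
  have D: "D \<in> sets stage_space"
    unfolding D_def stage_space_def by measurable
  define B where "B = (\<lambda>x u. indicator {p. snd p \<noteq> k (fst p)} (x, u) :: ennreal)"
  have "{p \<in> space (borel \<Otimes>\<^sub>M borel). snd p \<noteq> k (fst p)} \<in> sets (borel \<Otimes>\<^sub>M borel :: ('x \<times> 'u) measure)"
    by measurable
  then have B: "(\<lambda>(x, u). B x u) \<in> borel_measurable (borel \<Otimes>\<^sub>M borel)"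
    unfolding B_def by (simp add: space_pair_measure)
  have Bm: "B x \<in> borel_measurable borel" for x
    using measurable_compose[OF measurable_Pair1' B, of x] by simp
  have "stage_expectation t (indicator (space stage_space - D)) = stage_expectation t (\<lambda>(x, u, \<mu>). B x u)"
    unfolding stage_expectation_def
    by (intro nn_integral_cong)
      (auto simp: D_def B_def split_beta' indicator_def dest: space_law)
  also have "\<dots> = 0"
  proof -
    have "(\<integral>\<^sup>+ u. B x u \<partial>\<pi> t (h, x)) = 0" for h x
      by (simp add: \<pi>k det_stationary_policyI_def nn_integral_return Bm) (simp add: B_def)
    then show ?thesis
      by (simp add: stage_expectation_control[OF B])
  qed
  finally have "AE \<omega> in law. \<omega> t \<in> D" by (rule AE_law_if_null[OF D])
  then show ?thesis by (auto simp: D_def)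
qed

lemma AE_disturbance:
  assumes \<gamma>G: "\<And>h x u. \<gamma> t (h, x, u) = return (prob_algebra borel) (G x u)"
    and G: "(\<lambda>(x, u). G x u) \<in> borel \<Otimes>\<^sub>M borel \<rightarrow>\<^sub>M prob_algebra borel"
  shows "AE \<omega> in law. snd (snd (\<omega> t)) = G (fst (\<omega> t)) (fst (snd (\<omega> t)))"
proof -
  define D where "D = {s \<in> space stage_space. snd (snd s) = G (fst s) (fst (snd s))}"
  have "(\<lambda>s. (fst s, fst (snd s))) \<in> stage_space \<rightarrow>\<^sub>M borel \<Otimes>\<^sub>M borel"
    unfolding stage_space_def by measurable
  from measurable_compose[OF this G]
  have D: "D \<in> sets stage_space"
    unfolding D_def by (intro sets_prob_measures_eq) (auto simp: stage_space_def)
  have Gp: "G x u \<in> space (prob_algebra borel)" for x u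
    using measurable_space[OF G, of "(x, u)"] by (simp add: space_pair_measure)
  have m: "(\<lambda>\<mu>. indicator (space stage_space - D) (x, u, \<mu>) :: ennreal) \<in> borel_measurable (prob_algebra borel)" for x u
  proof (rule measurable_compose[OF _ borel_measurable_indicator])
    show "(\<lambda>\<mu>. (x, u, \<mu>)) \<in> prob_algebra borel \<rightarrow>\<^sub>M (stage_space :: ('x, 'u, 'w) stage measure)"
      unfolding stage_space_def by measurable
  qed (use D in auto)
  have "(x, u, G x u) \<in> D" for x u
    using Gp by (simp add: D_def stage_space_def space_pair_measure)
  then have "(\<integral>\<^sup>+ \<mu>. indicator (space stage_space - D) (x, u, \<mu>) \<partial>\<gamma> t (h, x, u)) = 0" for h x u
    unfolding \<gamma>G nn_integral_return[OF Gp m] by simp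
  then have "stage_expectation t (indicator (space stage_space - D)) = 0"
    using D by (subst stage_expectation_iterated) auto
  then have "AE \<omega> in law. \<omega> t \<in> D" by (rule AE_law_if_null[OF D])
  then show ?thesis by (auto simp: D_def)
qed

lemma stage_expectation_mono_AE:
  "AE \<omega> in law. \<phi> (\<omega> t) \<le> \<psi> (\<omega> t) \<Longrightarrow> stage_expectation t \<phi> \<le> stage_expectation t \<psi>"
  unfolding stage_expectation_def by (rule nn_integral_mono_AE)

lemma stage_expectation_add:
  assumes "\<phi> \<in> borel_measurable stage_space" "\<psi> \<in> borel_measurable stage_space"
  shows "stage_expectation t (\<lambda>s. \<phi> s + \<psi> s) = stage_expectation t \<phi> + stage_expectation t \<psi>"
  unfolding stage_expectation_def by (intro nn_integral_add component_measurable assms)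

lemma stage_expectation_cmult:
  assumes "\<phi> \<in> borel_measurable stage_space"
  shows "stage_expectation t (\<lambda>s. a * \<phi> s) = a * stage_expectation t \<phi>"
  unfolding stage_expectation_def by (intro nn_integral_cmult component_measurable assms)

lemma nn_integral_discounted:
  assumes "0 \<le> \<alpha>" and "\<And>t. p t \<in> borel_measurable stage_space"
  shows "(\<integral>\<^sup>+ \<omega>. (\<Sum>t. ennreal (\<alpha> ^ t) * p t (\<omega> t)) \<partial>law)
    = (\<Sum>t. ennreal \<alpha> ^ t * stage_expectation t (p t))"
proof -
  have m: "(\<lambda>\<omega>. p t (\<omega> t)) \<in> borel_measurable law" for t
    by (rule component_measurable[OF assms(2)])
  show ?thesis
    using m assms(1)
    by (subst nn_integral_suminf)
      (auto simp: nn_integral_cmult stage_expectation_def ennreal_power)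
qed

text \<open>\<open>nn_integral\<close> is monotone for arbitrary integrands, so measurability is a
  matter of the bounds p and q alone.\<close>

lemma total_payoff_le:
  assumes \<alpha>: "0 \<le> \<alpha>"
    and p: "\<And>t. p t \<in> borel_measurable stage_space" and q: "\<And>t. q t \<in> borel_measurable stage_space"
    and le: "\<And>t. AE \<omega> in law. e2ennreal (stage_payoff c lam \<nu> (\<omega> t)) \<le> p t (\<omega> t)
      \<and> q t (\<omega> t) \<le> e2ennreal (- stage_payoff c lam \<nu> (\<omega> t))"
  shows "total_payoff f c \<alpha> lam \<nu> \<pi> \<gamma> x0 \<le> gain_minus_loss
    (\<Sum>t. ennreal \<alpha> ^ t * stage_expectation t (p t)) (\<Sum>t. ennreal \<alpha> ^ t * stage_expectation t (q t))"
proof -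
  have "AE \<omega> in law. \<forall>t. e2ennreal (stage_payoff c lam \<nu> (\<omega> t)) \<le> p t (\<omega> t)
      \<and> q t (\<omega> t) \<le> e2ennreal (- stage_payoff c lam \<nu> (\<omega> t))"
    using le by (simp add: AE_all_countable)
  then show ?thesis
    unfolding total_payoff_def ext_discounted_expectation_def nn_integral_discounted[OF \<alpha> p, symmetric]
      nn_integral_discounted[OF \<alpha> q, symmetric]
    by (intro gain_minus_loss_mono nn_integral_mono_AE; elim AE_mp; intro AE_I2)
      (auto intro!: suminf_le mult_left_mono)
qed

lemma total_payoff_ge:
  assumes \<alpha>: "0 \<le> \<alpha>"
    and p: "\<And>t. p t \<in> borel_measurable stage_space" and q: "\<And>t. q t \<in> borel_measurable stage_space"
    and le: "\<And>t. AE \<omega> in law. p t (\<omega> t) \<le> e2ennreal (stage_payoff c lam \<nu> (\<omega> t))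
      \<and> e2ennreal (- stage_payoff c lam \<nu> (\<omega> t)) \<le> q t (\<omega> t)"
  shows "gain_minus_loss (\<Sum>t. ennreal \<alpha> ^ t * stage_expectation t (p t))
    (\<Sum>t. ennreal \<alpha> ^ t * stage_expectation t (q t)) \<le> total_payoff f c \<alpha> lam \<nu> \<pi> \<gamma> x0"
proof -
  have "AE \<omega> in law. \<forall>t. p t (\<omega> t) \<le> e2ennreal (stage_payoff c lam \<nu> (\<omega> t))
      \<and> e2ennreal (- stage_payoff c lam \<nu> (\<omega> t)) \<le> q t (\<omega> t)"
    using le by (simp add: AE_all_countable)
  then show ?thesis
    unfolding total_payoff_def ext_discounted_expectation_def nn_integral_discounted[OF \<alpha> p, symmetric]
      nn_integral_discounted[OF \<alpha> q, symmetric]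
    by (intro gain_minus_loss_mono nn_integral_mono_AE; elim AE_mp; intro AE_I2)
      (auto intro!: suminf_le mult_left_mono)
qed

end

section \<open>Upper bounds for the total payoff\<close>

lemma gain_minus_loss_leD:
  assumes "gain_minus_loss g l \<le> ereal r" and "l < \<infinity>" and "0 \<le> r"
  shows "g \<le> ennreal r + l"
proof -
  obtain b where b: "l = ennreal b" "0 \<le> b"
    using assms(2) by (cases l rule: ennreal_cases) auto
  show ?thesis
    using assms b
    by (cases g rule: ennreal_cases)
      (auto simp: gain_minus_loss_def enn2ereal_ennreal ennreal_plus[symmetric] simp del: ennreal_plus)
qed

lemma gain_minus_loss_geD:
  assumes "ereal r \<le> gain_minus_loss g l" and "0 \<le> r"
  shows "l < \<infinity>" and "ennreal r + l \<le> g"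
proof -
  show l: "l < \<infinity>"
    using assms(1) by (auto simp: gain_minus_loss_def less_top split: if_splits)
  obtain b where b: "l = ennreal b" "0 \<le> b"
    using l by (cases l rule: ennreal_cases) auto
  show "ennreal r + l \<le> g"
    using assms b
    by (cases g rule: ennreal_cases)
      (auto simp: gain_minus_loss_def enn2ereal_ennreal ennreal_plus[symmetric] simp del: ennreal_plus)
qed

text \<open>Both sides are the maximum of a and b. This trades \<open>gain_bound\<close> for
  \<open>loss_bound\<close> without a subtraction across an inequality.\<close>

lemma ennreal_minus_add_swap:
  fixes a b :: ennreal
  assumes "a < \<infinity>"
  shows "(a - b) + b = a + (b - a)"
proof (cases b rule: ennreal_cases)
  case (real r)
  obtain s where "a = ennreal s" "0 \<le> s" using assms by (cases a rule: ennreal_cases) auto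
  with real show ?thesis
    by (cases "s \<le> r") (simp_all add: ennreal_minus ennreal_plus[symmetric] ennreal_neg del: ennreal_plus)
qed (use assms in \<open>auto simp: less_top\<close>)

lemma suminf_geometric_ennreal_finite:
  assumes "0 \<le> a" and "a < 1" and "0 \<le> b"
  shows "(\<Sum>t. ennreal a ^ t * ennreal b) < \<infinity>"
proof -
  have "(\<Sum>t. ennreal a ^ t * ennreal b) = (\<Sum>t. ennreal (a ^ t * b))"
    using assms by (simp add: ennreal_mult ennreal_power)
  also have "\<dots> = ennreal (\<Sum>t. a ^ t * b)"
    using assms by (intro suminf_ennreal2 summable_mult2 summable_geometric) auto
  finally show ?thesis by simp
qed

section \<open>Lipschitz approximation of open sets\<close>

definition bump :: "'w :: euclidean_space set \<Rightarrow> nat \<Rightarrow> 'w \<Rightarrow> real" where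
  "bump U n w = min 1 (real (Suc n) * infdist w (- U))"

lemma bump_borel [measurable]: "bump U n \<in> borel_measurable borel"
  unfolding bump_def[abs_def] by (intro borel_measurable_continuous_onI continuous_intros)

lemma bump_bound: "\<bar>bump U n w\<bar> \<le> 1"
  by (simp add: bump_def infdist_nonneg abs_le_iff min_def)

lemma bump_lipschitz: "\<bar>bump U n w - bump U n w'\<bar> \<le> real (Suc n) * norm (w - w')"
proof -
  have "\<bar>bump U n w - bump U n w'\<bar> \<le> \<bar>real (Suc n) * infdist w (- U) - real (Suc n) * infdist w' (- U)\<bar>"
    unfolding bump_def by linarith
  also have "\<dots> = real (Suc n) * \<bar>infdist w (- U) - infdist w' (- U)\<bar>"
    unfolding right_diff_distrib[symmetric] abs_mult by simp
  also have "\<dots> \<le> real (Suc n) * norm (w - w')"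
    using infdist_triangle_abs[of w "- U" w'] by (intro mult_left_mono) (auto simp: dist_norm)
  finally show ?thesis .
qed

text \<open>For U = UNIV the complement is empty, \<open>infdist\<close> takes its default value 0
  and \<open>bump\<close> vanishes identically; hence the exclusion. Otherwise the distance to the
  closed complement is positive on U and the slope Suc n eventually lifts it above 1.\<close>

lemma bump_tendsto:
  assumes "open U" and "U \<noteq> UNIV"
  shows "(\<lambda>n. bump U n w) \<longlonglongrightarrow> indicator U w"
proof (cases "w \<in> U")
  case True
  have "0 < infdist w (- U)"
    using infdist_pos_not_in_closed[of "- U" w] assms True by auto
  then obtain m where m: "1 < real m * infdist w (- U)"
    using reals_Archimedean3 by blast
  have "\<forall>\<^sub>F n in sequentially. bump U n w = indicator U w"
    using eventually_ge_at_top[of m]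
  proof eventually_elim
    case (elim n)
    then have "real m * infdist w (- U) \<le> real (Suc n) * infdist w (- U)"
      by (intro mult_right_mono infdist_nonneg) auto
    with m True show ?case by (simp add: bump_def)
  qed
  then show ?thesis by (rule tendsto_eventually)
qed (simp add: bump_def)

lemma emeasure_eq_if_bump:
  fixes \<mu> \<mu>' :: "'w :: euclidean_space measure"
  assumes U: "open U" and \<mu>: "\<mu> \<in> prob_measures" and \<mu>': "\<mu>' \<in> prob_measures"
    and eq: "\<And>n. (\<integral>w. bump U n w \<partial>\<mu>) = (\<integral>w. bump U n w \<partial>\<mu>')"
  shows "emeasure \<mu> U = emeasure \<mu>' U"
proof (cases "U = UNIV")
  case True
  then show ?thesis
    using \<mu> \<mu>' prob_space.emeasure_space_1[of \<mu>] prob_space.emeasure_space_1[of \<mu>']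
    by (auto simp: space_prob_algebra dest!: sets_eq_imp_space_eq)
next
  case False
  have lim: "(\<lambda>n. \<integral>w. bump U n w \<partial>\<kappa>) \<longlonglongrightarrow> measure \<kappa> U" if "\<kappa> \<in> prob_measures" for \<kappa>
  proof -
    have [measurable_cong]: "sets \<kappa> = sets borel" and "prob_space \<kappa>"
      using that by (auto simp: space_prob_algebra)
    interpret prob_space \<kappa> by fact
    have [measurable]: "U \<in> sets \<kappa>"
      using U \<open>sets \<kappa> = sets borel\<close> by simp
    have "(\<lambda>n. \<integral>w. bump U n w \<partial>\<kappa>) \<longlonglongrightarrow> (\<integral>w. indicator U w \<partial>\<kappa>)"
      by (rule integral_dominated_convergence[where w = "\<lambda>_. 1"])
        (simp_all add: bump_tendsto[OF U False] bump_bound)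
    then show ?thesis
      using U sets_eq_imp_space_eq[of \<kappa> borel] \<open>sets \<kappa> = sets borel\<close> by simp
  qed
  have "measure \<mu> U = measure \<mu>' U"
    using LIMSEQ_unique[OF lim[OF \<mu>]] lim[OF \<mu>'] eq by simp
  then show ?thesis
    using \<mu> \<mu>' by (simp add: space_prob_algebra prob_space_def finite_measure.emeasure_eq_measure)
qed

section \<open>Supersolutions bound the payoff of the feedback\<close>

context wasserstein_lq
begin

lemma system_measurable: "(\<lambda>(x, u, w). f x u w) \<in> borel \<Otimes>\<^sub>M borel \<Otimes>\<^sub>M borel \<rightarrow>\<^sub>M borel"
  unfolding linear_system_def split_beta' by measurable

lemma controlled_process:
  "\<pi> \<in> policiesI \<Longrightarrow> \<gamma> \<in> policiesII \<Longrightarrow> controlled_process f \<pi> \<gamma>"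
  by (rule controlled_process.intro[OF system_measurable])

abbreviation "gain_policy P \<equiv> det_stationary_policyI (\<lambda>x. gain P *v x)"

lemma gain_policy_in_policiesI: "gain_policy P \<in> policiesI"
  unfolding policiesI_def det_stationary_policyI_def hist_space_def split_beta' by measurable

text \<open>The gain and loss parts of \<open>V(x) - \<alpha> \<integral> V(f(x, u, w)) d\<mu>(w) - s(x, u, \<mu>)\<close>. By weak duality this is a
  measurable upper bound of the stage payoff, whose own measurability in \<open>\<mu>\<close> is thus never needed.\<close>

definition continuation ::
    "real ^ 'n ^ 'n \<Rightarrow> real \<Rightarrow> (real ^ 'n, real ^ 'm, real ^ 'l) stage \<Rightarrow> ennreal" where
  "continuation P z = (\<lambda>(x, u, \<mu>). ennreal \<alpha> * (\<integral>\<^sup>+ w. ennreal (quad P (f x u w) + z) \<partial>\<mu>))"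

definition gain_bound where
  "gain_bound P z s = (\<lambda>\<sigma>. ennreal (quad P (fst \<sigma>) + z) - (continuation P z \<sigma> + s \<sigma>))"

definition loss_bound where
  "loss_bound P z s = (\<lambda>\<sigma>. (continuation P z \<sigma> + s \<sigma>) - ennreal (quad P (fst \<sigma>) + z))"

text \<open>The slack left by \<open>weak_duality\<close> for the test function h; the argument m
  stands for the quotient m / k^2 there.\<close>

definition slack ::
    "real ^ 'n ^ 'n \<Rightarrow> real \<Rightarrow> (real ^ 'l \<Rightarrow> real) \<Rightarrow> (real ^ 'n, real ^ 'm, real ^ 'l) stage \<Rightarrow> ennreal" where
  "slack P m h = (\<lambda>(x, u, \<mu>).
     ennreal (m * ((\<integral>w. h w \<partial>\<mu>) - (\<integral>w. h w \<partial>worst_distribution P (A *v x + B *v u)))\<^sup>2))"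

lemma worst_distribution_measurable:
  assumes "y \<in> M \<rightarrow>\<^sub>M borel"
  shows "(\<lambda>s. worst_distribution P (y s)) \<in> M \<rightarrow>\<^sub>M prob_algebra borel"
proof -
  have "(\<lambda>y. response P y a) \<in> borel \<rightarrow>\<^sub>M borel" for a
    unfolding response_def by (simp del: transpose_matrix_vector) measurable
  from measurable_compose[OF assms this] show ?thesis
    unfolding worst_distribution_def by (intro measurable_empirical_measure N)
qed

lemma continuation_measurable [measurable]: "continuation P z \<in> borel_measurable stage_space"
proof -
  have "\<nu> \<in> prob_measures" by (rule empirical_measure_in_prob_measures[OF N])
  then have "return (prob_algebra borel) \<nu> \<in> space (prob_algebra (prob_algebra borel))"
    by (rule measurable_space[OF measurable_return_prob_space])
  \<comment> \<open>Policies and initial state are dummies: the continuation depends on the system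
    alone, but its measurability is proved inside the locale
    \<open>controlled_process\<close>.\<close>
  then interpret controlled_process f "gain_policy P" "\<lambda>t s. return (prob_algebra borel) \<nu>" 0
    by (intro controlled_process gain_policy_in_policiesI) (auto simp: policiesII_def)
  have "(\<lambda>x. ennreal (quad P x + z)) \<in> borel_measurable borel" by measurable
  from continuation_measurable[OF this] have [measurable]:
    "(\<lambda>\<sigma>. \<integral>\<^sup>+ w. ennreal (quad P (f (fst \<sigma>) (fst (snd \<sigma>)) w) + z) \<partial>snd (snd \<sigma>))
      \<in> borel_measurable stage_space"
    by (simp add: split_beta')
  show ?thesis
    unfolding continuation_def split_beta' by measurable
qed

lemma slack_measurable [measurable]:
  assumes h: "h \<in> borel_measurable borel"
  shows "slack P m h \<in> borel_measurable stage_space"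
proof -
  have snd: "(\<lambda>\<sigma>. snd (snd \<sigma>)) \<in> stage_space \<rightarrow>\<^sub>M prob_algebra borel"
    and y: "(\<lambda>\<sigma>. A *v fst \<sigma> + B *v fst (snd \<sigma>)) \<in> stage_space \<rightarrow>\<^sub>M borel"
    unfolding stage_space_def by measurable
  have int: "(\<lambda>\<mu>. \<integral>w. h w \<partial>\<mu>) \<in> borel_measurable (subprob_algebra borel)"
    by (rule integral_measurable_subprob_algebra[OF h])
  have "(\<lambda>\<sigma>. \<integral>w. h w \<partial>K \<sigma>) \<in> borel_measurable stage_space"
    if "K \<in> stage_space \<rightarrow>\<^sub>M prob_algebra borel" for K
    by (rule measurable_compose[OF measurable_prob_algebraD[OF that] int])
  from this[OF snd] this[OF worst_distribution_measurable[OF y]] show ?thesis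
    unfolding slack_def split_beta' by measurable
qed

text \<open>The supersolution inequality bounds cost plus worst gain plus \<alpha> z by V, and weak
  duality bounds continuation plus slack by worst gain plus \<alpha> z plus penalty. Adding the two
  cancels the worst gain.\<close>

lemma stage_payoff_bound:
  assumes P: "admissible P" and z: "0 \<le> z" and \<mu>: "\<mu> \<in> prob_measures"
    and super: "q_value P z x u \<le> quad P x + z"
    and m: "0 \<le> m" "\<And>w. m * (norm w)\<^sup>2 \<le> quad (pen P) w"
    and h: "h \<in> borel_measurable borel" "\<And>w. \<bar>h w\<bar> \<le> 1"
    and k: "0 < k" and lipschitz: "\<And>w w'. \<bar>h w - h w'\<bar> \<le> k * norm (w - w')"
  defines "s \<equiv> slack P (m / k\<^sup>2) h"
  shows "e2ennreal (stage_payoff c lam \<nu> (x, u, \<mu>)) \<le> gain_bound P z s (x, u, \<mu>)"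
    and "loss_bound P z s (x, u, \<mu>) \<le> e2ennreal (- stage_payoff c lam \<nu> (x, u, \<mu>))"
proof -
  let ?y = "A *v x + B *v u" and ?V = "quad P x + z"
  let ?C = "continuation P z (x, u, \<mu>) + s (x, u, \<mu>)"
  have V: "0 \<le> ?V" using super q_value_nonneg[OF P z, of x u] by simp
  have C: "?C \<le> ennreal (worst_gain P ?y + \<alpha> * z) + ennreal lam * wasserstein_cost \<mu> \<nu>"
    using weak_duality[OF P z \<mu> m h k lipschitz, of ?y]
    by (simp add: continuation_def s_def slack_def system_eq)
  have "e2ennreal (stage_payoff c lam \<nu> (x, u, \<mu>)) \<le> ennreal ?V - ?C
      \<and> ?C - ennreal ?V \<le> e2ennreal (- stage_payoff c lam \<nu> (x, u, \<mu>))"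
  proof (cases "wasserstein_cost \<mu> \<nu>" rule: ennreal_cases)
    case (real r)
    have "?C \<le> ennreal (worst_gain P ?y + \<alpha> * z + lam * r)"
      using C real lam \<alpha> z worst_gain_nonneg[OF P, of ?y] by (simp add: ennreal_mult)
    then obtain b where b: "?C = ennreal b" "0 \<le> b" "b \<le> worst_gain P ?y + \<alpha> * z + lam * r"
      using real lam \<alpha> z worst_gain_nonneg[OF P, of ?y]
      by (cases ?C rule: ennreal_cases) (auto simp: top_unique simp del: ennreal_plus)
    then have "b + c x u \<le> ?V + lam * r"
      using super by (simp add: q_value_def)
    then show ?thesis
      using real b V by (auto simp: stage_payoff_def enn2ereal_ennreal ennreal_minus intro!: ennreal_leI)
  next
    \<comment> \<open>The payoff is -\<infinity>, with gain 0 and loss \<infinity>, so both bounds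
      are trivial.\<close>
    case top
    then have "stage_payoff c lam \<nu> (x, u, \<mu>) = - \<infinity>"
      using lam by (simp add: stage_payoff_def)
    then show ?thesis by (simp add: e2ennreal_neg)
  qed
  then show "e2ennreal (stage_payoff c lam \<nu> (x, u, \<mu>)) \<le> gain_bound P z s (x, u, \<mu>)"
    and "loss_bound P z s (x, u, \<mu>) \<le> e2ennreal (- stage_payoff c lam \<nu> (x, u, \<mu>))"
    by (simp_all add: gain_bound_def loss_bound_def)
qed


text \<open>The hypothesis is a supersolution along the feedback rather than a fixed point, because
  the bounds serve both P and the limit of the value iterates.\<close>

lemma gain_loss_bounds:
  fixes x0 :: "real ^ 'n"
  assumes P: "admissible P" and z: "0 \<le> z" and \<gamma>: "\<gamma> \<in> policiesII"
    and super: "\<And>x. q_value P z x (gain P *v x) \<le> quad P x + z"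
    and m: "0 \<le> m" "\<And>w. m * (norm w)\<^sup>2 \<le> quad (pen P) w"
    and h: "h \<in> borel_measurable borel" "\<And>w. \<bar>h w\<bar> \<le> 1"
    and k: "0 < k" and lipschitz: "\<And>w w'. \<bar>h w - h w'\<bar> \<le> k * norm (w - w')"
  defines "s \<equiv> slack P (m / k\<^sup>2) h"
    and "E \<equiv> controlled_process.stage_expectation f (gain_policy P) \<gamma> x0"
  defines "G \<equiv> \<Sum>t. ennreal \<alpha> ^ t * E t (gain_bound P z s)"
    and "L \<equiv> \<Sum>t. ennreal \<alpha> ^ t * E t (loss_bound P z s)"
  shows "total_payoff f c \<alpha> lam \<nu> (gain_policy P) \<gamma> x0 \<le> gain_minus_loss G L"
    and "G + (\<Sum>t. ennreal \<alpha> ^ t * E t s) \<le> ennreal (quad P x0 + z) + L"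
proof -
  interpret controlled_process f "gain_policy P" \<gamma> x0
    by (rule controlled_process[OF gain_policy_in_policiesI \<gamma>])
  have s [measurable]: "s \<in> borel_measurable stage_space"
    unfolding s_def by (rule slack_measurable[OF h(1)])
  have V [measurable]: "(\<lambda>\<sigma>. ennreal (quad P (fst \<sigma>) + z)) \<in> borel_measurable stage_space"
    unfolding stage_space_def by measurable
  have gb [measurable]: "gain_bound P z s \<in> borel_measurable stage_space"
    and lb [measurable]: "loss_bound P z s \<in> borel_measurable stage_space"
    unfolding gain_bound_def loss_bound_def by measurable
  have control: "AE \<omega> in law. fst (snd (\<omega> t)) = gain P *v fst (\<omega> t)" for t
    by (rule AE_control[OF refl]) measurable
  show "total_payoff f c \<alpha> lam \<nu> (gain_policy P) \<gamma> x0 \<le> gain_minus_loss G L"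
    unfolding G_def L_def E_def
  proof (rule total_payoff_le[OF _ gb lb])
    fix t
    show "AE \<omega> in law. e2ennreal (stage_payoff c lam \<nu> (\<omega> t)) \<le> gain_bound P z s (\<omega> t)
      \<and> loss_bound P z s (\<omega> t) \<le> e2ennreal (- stage_payoff c lam \<nu> (\<omega> t))"
      using control[of t] AE_space
    proof eventually_elim
      case (elim \<omega>)
      obtain x u \<mu> where \<omega>: "\<omega> t = (x, u, \<mu>)" by (cases "\<omega> t")
      then have "\<mu> \<in> prob_measures"
        using space_law[OF elim(2), of t] by (simp add: stage_space_def space_pair_measure)
      moreover have "u = gain P *v x" using elim(1) \<omega> by simp
      ultimately show ?case
        unfolding \<omega> s_def using super[of x]
        by (intro conjI stage_payoff_bound P z m h k lipschitz) auto
    qed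
  qed (use \<alpha> in simp)
  have E0: "E 0 (\<lambda>\<sigma>. ennreal (quad P (fst \<sigma>) + z)) = ennreal (quad P x0 + z)"
    using stage_expectation_initial_state[of "\<lambda>x. ennreal (quad P x + z)"]
    by (simp add: E_def split_beta')
  have "G + (\<Sum>t. ennreal \<alpha> ^ t * E t s) \<le> E 0 (\<lambda>\<sigma>. ennreal (quad P (fst \<sigma>) + z)) + L"
    unfolding G_def L_def
  proof (rule telescoping_upper)
    fix t
    have "E t (gain_bound P z s) + E t s + ennreal \<alpha> * E (Suc t) (\<lambda>\<sigma>. ennreal (quad P (fst \<sigma>) + z))
        = E t (gain_bound P z s) + E t s + E t (continuation P z)"
    proof -
      have "(\<lambda>(x, u, \<mu>). \<integral>\<^sup>+ w. ennreal (quad P (f x u w) + z) \<partial>\<mu>) \<in> borel_measurable stage_space"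
        by (rule continuation_measurable) measurable
      from stage_expectation_cmult[OF this, of t "ennreal \<alpha>"]
      show ?thesis
        using stage_expectation_Suc[of "\<lambda>x. ennreal (quad P x + z)" t]
        by (simp add: E_def continuation_def split_beta')
    qed
    also have "\<dots> = E t (\<lambda>\<sigma>. gain_bound P z s \<sigma> + s \<sigma> + continuation P z \<sigma>)"
      by (simp add: E_def stage_expectation_add)
    \<comment> \<open>The bounds are the two truncated differences of V and continuation plus slack,
      so the telescoping step is an equality.\<close>
    also have "\<dots> = E t (\<lambda>\<sigma>. ennreal (quad P (fst \<sigma>) + z) + loss_bound P z s \<sigma>)"
      unfolding gain_bound_def loss_bound_def
      by (simp add: ennreal_minus_add_swap[symmetric] add.assoc add.commute[of "s _"])
    also have "\<dots> = E t (\<lambda>\<sigma>. ennreal (quad P (fst \<sigma>) + z)) + E t (loss_bound P z s)"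
      by (simp add: E_def stage_expectation_add)
    finally show "E t (gain_bound P z s) + E t s + ennreal \<alpha> * E (Suc t) (\<lambda>\<sigma>. ennreal (quad P (fst \<sigma>) + z))
      \<le> E t (\<lambda>\<sigma>. ennreal (quad P (fst \<sigma>) + z)) + E t (loss_bound P z s)" by simp
  qed
  then show "G + (\<Sum>t. ennreal \<alpha> ^ t * E t s) \<le> ennreal (quad P x0 + z) + L"
    unfolding E0 .
qed

lemma worst_payoff_gain_policy_le:
  assumes P: "admissible P" and z: "0 \<le> z"
    and super: "\<And>x. q_value P z x (gain P *v x) \<le> quad P x + z"
  shows "worst_payoff f c \<alpha> lam \<nu> (gain_policy P) x0 \<le> ereal (quad P x0 + z)"
  unfolding worst_payoff_def
proof (rule SUP_least)
  fix \<gamma> :: "(real ^ 'n, real ^ 'm, real ^ 'l) policyII" assume "\<gamma> \<in> policiesII"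
  have pen: "0 * (norm w)\<^sup>2 \<le> quad (pen P) w" for w
    using P by (simp add: admissible_def pos_def_nonneg)
  note b = gain_loss_bounds[OF P z \<open>\<gamma> \<in> policiesII\<close> super, of 0 "\<lambda>_. 0" 1 x0]
  have "0 \<le> quad P x0 + z"
    using P z by (auto simp: admissible_def pos_semidef_def)
  with b(2) pen have "gain_minus_loss
      (\<Sum>t. ennreal \<alpha> ^ t * controlled_process.stage_expectation f (gain_policy P) \<gamma> x0 t
        (gain_bound P z (slack P (0 / 1\<^sup>2) (\<lambda>_. 0))))
      (\<Sum>t. ennreal \<alpha> ^ t * controlled_process.stage_expectation f (gain_policy P) \<gamma> x0 t
        (loss_bound P z (slack P (0 / 1\<^sup>2) (\<lambda>_. 0)))) \<le> ereal (quad P x0 + z)"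
    by (intro gain_minus_loss_le) (auto intro: order_trans[OF add_increasing2[OF _ order_refl]])
  with b(1) pen show "total_payoff f c \<alpha> lam \<nu> (gain_policy P) \<gamma> x0 \<le> ereal (quad P x0 + z)"
    by auto
qed

end

section \<open>Lower bounds for the total payoff\<close>

context wasserstein_lq
begin

text \<open>Deterministic but time-dependent, since a finite-horizon answer depends on the remaining
  time.\<close>

definition markov_policyII ::
    "(nat \<Rightarrow> real ^ 'n \<Rightarrow> real ^ 'm \<Rightarrow> (real ^ 'l) measure)
      \<Rightarrow> (real ^ 'n, real ^ 'm, real ^ 'l) policyII" where
  "markov_policyII G = (\<lambda>t (h, x, u). return (prob_algebra borel) (G t x u))"

lemma markov_policyII_in_policiesII:
  assumes G: "\<And>t. (\<lambda>(x, u). G t x u) \<in> borel \<Otimes>\<^sub>M borel \<rightarrow>\<^sub>M prob_algebra borel"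
  shows "markov_policyII G \<in> policiesII"
proof -
  have "(\<lambda>p. return (prob_algebra borel) (case snd p of (x, u) \<Rightarrow> G t x u))
      \<in> (ext_hist_space t :: (real ^ 'n, real ^ 'm, real ^ 'l) ext_hist measure)
        \<rightarrow>\<^sub>M prob_algebra (prob_algebra borel)" for t
    unfolding ext_hist_space_def
    by (rule measurable_compose[OF measurable_compose[OF measurable_snd G] measurable_return_prob_space])
  then show ?thesis by (simp add: policiesII_def markov_policyII_def split_beta')
qed

text \<open>y bounds the stage payoff from below when Player II plays G; \<phi> is a value of state
  and control, and v a value of the state below \<phi> for every control. Telescoping \<phi> along
  an arbitrary \<pi> forgets the later controls but keeps the first one, so its excess survives in
  the conclusion.\<close>

lemma initial_value_le:
  fixes x0 :: "real ^ 'n" and y :: "nat \<Rightarrow> real ^ 'n \<Rightarrow> real ^ 'm \<Rightarrow> real"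
  assumes \<pi>: "\<pi> \<in> policiesI"
    and G: "\<And>t. (\<lambda>(x, u). G t x u) \<in> borel \<Otimes>\<^sub>M borel \<rightarrow>\<^sub>M prob_algebra borel"
    and y: "\<And>t. (\<lambda>(x, u). y t x u) \<in> borel_measurable (borel \<Otimes>\<^sub>M borel)"
      "\<And>t x u. ereal (y t x u) \<le> stage_payoff c lam \<nu> (x, u, G t x u)"
      "\<And>t x u. - y t x u \<le> b"
    and b: "0 \<le> b"
    and \<phi>: "\<And>t. (\<lambda>(x, u). \<phi> t x u) \<in> borel_measurable (borel \<Otimes>\<^sub>M borel)"
      "\<And>t x u. T \<le> t \<Longrightarrow> \<phi> t x u = 0"
    and v: "\<And>t. v t \<in> borel_measurable borel" "\<And>t x u. v t x \<le> \<phi> t x u"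
    and step: "\<And>t x u. \<phi> t x u + ennreal (- y t x u)
      \<le> ennreal (y t x u) + ennreal \<alpha> * (\<integral>\<^sup>+ w. v (Suc t) (f x u w) \<partial>G t x u)"
    and total: "total_payoff f c \<alpha> lam \<nu> \<pi> (markov_policyII G) x0 \<le> ereal r" and r: "0 \<le> r"
  shows "(\<integral>\<^sup>+ u. \<phi> 0 x0 u \<partial>\<pi> 0 (\<lambda>_. undefined, x0)) \<le> ennreal r"
proof -
  interpret controlled_process f \<pi> "markov_policyII G" x0
    by (rule controlled_process[OF \<pi> markov_policyII_in_policiesII[OF G]])
  have G_AE: "AE \<omega> in law. snd (snd (\<omega> t)) = G t (fst (\<omega> t)) (fst (snd (\<omega> t)))" for t
    by (rule AE_disturbance[OF _ G]) (simp add: markov_policyII_def)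
  define p q \<beta> :: "nat \<Rightarrow> (real ^ 'n, real ^ 'm, real ^ 'l) stage \<Rightarrow> ennreal" where "p = (\<lambda>t \<sigma>. ennreal (y t (fst \<sigma>) (fst (snd \<sigma>))))"
    and "q = (\<lambda>t \<sigma>. ennreal (- y t (fst \<sigma>) (fst (snd \<sigma>))))"
    and "\<beta> = (\<lambda>t \<sigma>. \<phi> t (fst \<sigma>) (fst (snd \<sigma>)))"
  have xu: "(\<lambda>\<sigma>. (fst \<sigma>, fst (snd \<sigma>))) \<in> (stage_space :: (real ^ 'n, real ^ 'm, real ^ 'l) stage measure)
      \<rightarrow>\<^sub>M borel \<Otimes>\<^sub>M borel"
    unfolding stage_space_def by measurable
  have \<beta>: "\<beta> t \<in> borel_measurable stage_space" for t
    using measurable_compose[OF xu \<phi>(1)[of t]] by (simp add: \<beta>_def)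
  have ym [measurable]: "(\<lambda>\<sigma>. y t (fst \<sigma>) (fst (snd \<sigma>))) \<in> borel_measurable
      (stage_space :: (real ^ 'n, real ^ 'm, real ^ 'l) stage measure)" for t
    using measurable_compose[OF xu y(1)[of t]] by simp
  have p: "p t \<in> borel_measurable stage_space" and q: "q t \<in> borel_measurable stage_space" for t
    unfolding p_def q_def by measurable
  have cont: "(\<lambda>(x, u, \<mu>). \<integral>\<^sup>+ w. v t (f x u w) \<partial>\<mu>) \<in> borel_measurable stage_space" for t
    by (rule continuation_measurable[OF v(1)])
  have cont': "(\<lambda>\<sigma>. ennreal \<alpha> * (case \<sigma> of (x, u, \<mu>) \<Rightarrow> \<integral>\<^sup>+ w. v t (f x u w) \<partial>\<mu>))
      \<in> borel_measurable stage_space" for t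
    using cont[of t] by measurable
  let ?G = "\<Sum>t. ennreal \<alpha> ^ t * stage_expectation t (p t)"
    and ?L = "\<Sum>t. ennreal \<alpha> ^ t * stage_expectation t (q t)"
  have "gain_minus_loss ?G ?L \<le> total_payoff f c \<alpha> lam \<nu> \<pi> (markov_policyII G) x0"
  proof (rule total_payoff_ge[OF _ p q])
    fix t
    show "AE \<omega> in law. p t (\<omega> t) \<le> e2ennreal (stage_payoff c lam \<nu> (\<omega> t))
      \<and> e2ennreal (- stage_payoff c lam \<nu> (\<omega> t)) \<le> q t (\<omega> t)"
      using G_AE[of t]
    proof eventually_elim
      case (elim \<omega>)
      obtain x u \<mu> where \<omega>: "\<omega> t = (x, u, \<mu>)" by (cases "\<omega> t")
      then have le: "ereal (y t x u) \<le> stage_payoff c lam \<nu> (\<omega> t)"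
        using elim y(2)[of t x u] by simp
      have "- stage_payoff c lam \<nu> (\<omega> t) \<le> ereal (- y t x u)"
        using le unfolding uminus_ereal.simps(1)[symmetric] by (simp only: ereal_minus_le_minus)
      from e2ennreal_mono[OF this] e2ennreal_mono[OF le] show ?case
        using \<omega> by (simp add: p_def q_def)
    qed
  qed (use \<alpha> in simp)
  then have GL: "gain_minus_loss ?G ?L \<le> ereal r" using total by (rule order_trans)
  \<comment> \<open>Losses bounded by b and \<alpha> < 1 give a finite expected loss; otherwise the
    total payoff could be -\<infinity> and carry no information.\<close>
  have "?L \<le> (\<Sum>t. ennreal \<alpha> ^ t * ennreal b)"
  proof (intro suminf_le mult_left_mono)
    fix t
    have "stage_expectation t (q t) \<le> stage_expectation t (\<lambda>_. ennreal b)"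
      using y(3) by (intro stage_expectation_mono_AE AE_I2) (auto simp: q_def intro: ennreal_leI)
    also have "\<dots> = ennreal b"
      using prob_space.emeasure_space_1[OF prob_space_law] by (simp add: stage_expectation_def)
    finally show "stage_expectation t (q t) \<le> ennreal b" .
  qed auto
  also have "\<dots> < \<infinity>" using \<alpha> b by (intro suminf_geometric_ennreal_finite) auto
  finally have L: "?L < \<infinity>" .
  have "stage_expectation 0 (\<beta> 0) + ?L \<le> ?G"
  proof (rule telescoping_lower[where v = "\<lambda>t. stage_expectation t (\<beta> t)" and T = T])
    fix t
    have "stage_expectation t (\<beta> t) + stage_expectation t (q t)
        = stage_expectation t (\<lambda>\<sigma>. \<beta> t \<sigma> + q t \<sigma>)"
      by (simp add: stage_expectation_add \<beta> q)
    also have "\<dots> \<le> stage_expectation t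
        (\<lambda>\<sigma>. p t \<sigma> + ennreal \<alpha> * (case \<sigma> of (x, u, \<mu>) \<Rightarrow> \<integral>\<^sup>+ w. v (Suc t) (f x u w) \<partial>\<mu>))"
    proof (rule stage_expectation_mono_AE)
      show "AE \<omega> in law. \<beta> t (\<omega> t) + q t (\<omega> t) \<le> p t (\<omega> t)
          + ennreal \<alpha> * (case \<omega> t of (x, u, \<mu>) \<Rightarrow> \<integral>\<^sup>+ w. v (Suc t) (f x u w) \<partial>\<mu>)"
        using G_AE[of t]
      proof eventually_elim
        case (elim \<omega>)
        then show ?case
          using step[of t "fst (\<omega> t)" "fst (snd (\<omega> t))"]
          by (simp add: \<beta>_def p_def q_def split_beta')
      qed
    qed
    also have "\<dots> = stage_expectation t (p t)
        + ennreal \<alpha> * stage_expectation (Suc t) (\<lambda>(x, u, \<mu>). v (Suc t) x)"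
      unfolding stage_expectation_Suc[OF v(1)]
      by (simp only: stage_expectation_add[OF p cont'] stage_expectation_cmult[OF cont])
    \<comment> \<open>The next control of \<pi> is unknown, but \<phi> dominates v for all of
      them.\<close>
    also have "\<dots> \<le> stage_expectation t (p t) + ennreal \<alpha> * stage_expectation (Suc t) (\<beta> (Suc t))"
      using v(2) by (intro add_left_mono mult_left_mono stage_expectation_mono_AE AE_I2)
        (auto simp: \<beta>_def split_beta')
    finally show "stage_expectation t (\<beta> t) + stage_expectation t (q t)
        \<le> stage_expectation t (p t) + ennreal \<alpha> * stage_expectation (Suc t) (\<beta> (Suc t))" .
  next
    show "stage_expectation t (\<beta> t) = 0" if "T \<le> t" for t
      using that by (simp add: stage_expectation_def \<beta>_def \<phi>(2))
  qed
  also have "?G \<le> ennreal r + ?L"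
    by (rule gain_minus_loss_leD[OF GL L r])
  finally have "stage_expectation 0 (\<beta> 0) \<le> ennreal r"
    using L by (auto simp: add.commute[of _ ?L] ennreal_add_left_cancel_le)
  then show ?thesis
    using stage_expectation_initial_control[OF \<phi>(1)[of 0]] by (simp add: \<beta>_def split_beta')
qed

text \<open>The cost restriction bounds u because R is positive definite, so (x, u) ranges over a
  bounded set, on which the continuous responses and transport costs are bounded.\<close>

lemma reachable_radius:
  assumes P: "transpose P = P" and z: "0 \<le> z" and k: "0 \<le> k"
  obtains k' where "0 \<le> k'"
    and "\<And>x u i. norm x \<le> k \<Longrightarrow> c x u < quad P x + z + 1 \<Longrightarrow> i \<in> {1..N} \<Longrightarrow>
      norm (f x u (response P' (A *v x + B *v u) (wh i))) \<le> k'"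
    and "\<And>x u. norm x \<le> k \<Longrightarrow> c x u < quad P x + z + 1 \<Longrightarrow>
      lam * transport P' (A *v x + B *v u) \<le> k'"
proof -
  have "continuous_on (cball 0 k) (quad P)" by (intro continuous_intros)
  then have "bounded (quad P ` cball 0 k)"
    by (intro compact_imp_bounded compact_continuous_image) auto
  then obtain C where "\<forall>x\<in>cball 0 k. \<bar>quad P x\<bar> \<le> C"
    by (auto simp: bounded_iff)
  then have C: "\<bar>quad P x\<bar> \<le> C" if "norm x \<le> k" for x
    using that by simp
  obtain m where m: "0 < m" "\<And>u. m * (norm u)\<^sup>2 \<le> quad R u"
    by (rule pos_def_coercive[OF R]) blast
  define \<rho> where "\<rho> = sqrt ((C + z + 1) / m)"
  have u: "norm u \<le> \<rho>" if "norm x \<le> k" "c x u < quad P x + z + 1" for x u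
  proof -
    have "m * (norm u)\<^sup>2 \<le> c x u"
      using m(2)[of u] pos_semidef_nonneg[OF Q, of x] by (simp add: quadratic_cost_def)
    also have "\<dots> \<le> C + z + 1" using that C[of x] by simp
    finally show ?thesis
      unfolding \<rho>_def using m(1) by (intro real_le_rsqrt) (simp add: field_simps)
  qed
  \<comment> \<open>One sum of nonnegative terms, so that a single compactness argument bounds each
    of them.\<close>
  define F where "F = (\<lambda>p. (\<Sum>i = 1..N. norm (f (fst p) (snd p) (response P' (A *v fst p + B *v snd p) (wh i))))
    + lam * transport P' (A *v fst p + B *v snd p))"
  have "continuous_on (cball 0 k \<times> cball 0 \<rho>) F"
    unfolding F_def linear_system_def transport_def response_def
    by (intro continuous_intros)
  then have "bounded (F ` (cball 0 k \<times> cball 0 \<rho>))"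
    by (intro compact_imp_bounded compact_continuous_image compact_Times) auto
  then obtain D where "\<forall>p\<in>cball 0 k \<times> cball 0 \<rho>. \<bar>F p\<bar> \<le> D"
    by (auto simp: bounded_iff)
  then have D: "\<bar>F (x, u)\<bar> \<le> D" if "norm x \<le> k" "norm u \<le> \<rho>" for x u
    using that by simp
  show ?thesis
  proof
    show "0 \<le> \<bar>D\<bar>" by simp
    fix x u assume *: "norm x \<le> k" "c x u < quad P x + z + 1"
    have F: "F (x, u) \<le> \<bar>D\<bar>" using D[OF *(1) u[OF *]] by simp
    have nn: "0 \<le> lam * transport P' (A *v x + B *v u)"
      using lam transport_nonneg by simp
    show "lam * transport P' (A *v x + B *v u) \<le> \<bar>D\<bar>"
      using F sum_nonneg[of "{1..N}" "\<lambda>i. norm (f x u (response P' (A *v x + B *v u) (wh i)))"]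
      by (simp add: F_def)
    show "norm (f x u (response P' (A *v x + B *v u) (wh i))) \<le> \<bar>D\<bar>" if "i \<in> {1..N}" for i
      using F nn member_le_sum[OF that, of "\<lambda>i. norm (f x u (response P' (A *v x + B *v u) (wh i)))"]
      by (simp add: F_def)
  qed
qed

lemma q_value_measurable: "(\<lambda>(x, u). q_value P z x u) \<in> borel_measurable (borel \<Otimes>\<^sub>M borel)"
  unfolding q_value_def worst_gain_def quadratic_cost_def split_beta' by measurable

lemma nn_integral_worst_distribution_cong:
  assumes "\<And>i. i \<in> {1..N} \<Longrightarrow> g (response P y (wh i)) = g' (response P y (wh i))"
    and "g \<in> borel_measurable borel" "g' \<in> borel_measurable borel"
  shows "(\<integral>\<^sup>+ w. g w \<partial>worst_distribution P y) = (\<integral>\<^sup>+ w. g' w \<partial>worst_distribution P y)"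
  unfolding worst_distribution_def using assms
  by (simp add: nn_integral_empirical_measure)

text \<open>Player II answers with the worst-case distribution of the finite-horizon problem, but only while
  the state stays in a bounded region and the control is not so expensive that its cost alone exceeds
  the value. Otherwise the losses could have infinite expectation, which would make the total payoff
  \<open>-\<infinity>\<close>.\<close>

lemma finite_horizon_bound:
  fixes x0 :: "real ^ 'n"
  assumes P: "pos_semidef P" and z: "0 \<le> z"
    and Ps: "\<And>n. admissible (Ps n)" and zs: "\<And>n. 0 \<le> zs n"
    and initial: "Ps 0 = 0" "zs 0 = 0"
    and step: "\<And>n x u. quad (Ps (Suc n)) x + zs (Suc n) \<le> q_value (Ps n) (zs n) x u"
    and le: "\<And>n x. quad (Ps n) x + zs n \<le> quad P x + z"
    and \<pi>: "\<pi> \<in> policiesI"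
    and worst: "worst_payoff f c \<alpha> lam \<nu> \<pi> x0 \<le> ereal (quad P x0 + z)"
  shows "(\<integral>\<^sup>+ u. (if c x0 u < quad P x0 + z + 1 then ennreal (q_value (Ps T) (zs T) x0 u)
      else ennreal (quad P x0 + z + 1)) \<partial>\<pi> 0 (\<lambda>_. undefined, x0)) \<le> ennreal (quad P x0 + z)"
proof -
  let ?V = "\<lambda>x. quad P x + z"
  have Vnn: "0 \<le> ?V x" for x using pos_semidef_nonneg[OF P] z by simp
  \<comment> \<open>k t is a radius for the states reachable at time t while controls stay cheap; k
    (Suc t) also bounds the transport penalty at time t. The radius at time 0 is pinned to
    \<open>norm x0\<close>.\<close>
  have "\<exists>k. \<forall>t. (0 \<le> k t \<and> (t = 0 \<longrightarrow> k t = norm x0)) \<and> (\<forall>x u. norm x \<le> k t \<longrightarrow> c x u < ?V x + 1 \<longrightarrow>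
      (\<forall>i\<in>{1..N}. norm (f x u (response (Ps (T - t)) (A *v x + B *v u) (wh i))) \<le> k (Suc t))
      \<and> lam * transport (Ps (T - t)) (A *v x + B *v u) \<le> k (Suc t))"
  proof (rule dependent_nat_choice)
    show "\<exists>k::real. 0 \<le> k \<and> ((0::nat) = 0 \<longrightarrow> k = norm x0)" by auto
    fix k :: real and t :: nat
    assume "0 \<le> k \<and> (t = 0 \<longrightarrow> k = norm x0)"
    then have "0 \<le> k" by simp
    obtain k' where "0 \<le> k'"
      and "\<And>x u i. norm x \<le> k \<Longrightarrow> c x u < ?V x + 1 \<Longrightarrow> i \<in> {1..N} \<Longrightarrow>
        norm (f x u (response (Ps (T - t)) (A *v x + B *v u) (wh i))) \<le> k'"
      and "\<And>x u. norm x \<le> k \<Longrightarrow> c x u < ?V x + 1 \<Longrightarrow>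
        lam * transport (Ps (T - t)) (A *v x + B *v u) \<le> k'"
      by (rule reachable_radius[OF pos_semidef_symmetric[OF P] z \<open>0 \<le> k\<close>, of "Ps (T - t)"]) blast
    then show "\<exists>k'. (0 \<le> k' \<and> (Suc t = 0 \<longrightarrow> k' = norm x0)) \<and> (\<forall>x u. norm x \<le> k \<longrightarrow> c x u < ?V x + 1 \<longrightarrow>
      (\<forall>i\<in>{1..N}. norm (f x u (response (Ps (T - t)) (A *v x + B *v u) (wh i))) \<le> k')
      \<and> lam * transport (Ps (T - t)) (A *v x + B *v u) \<le> k')"
      by (intro exI[of _ k']) simp
  qed
  then obtain k where k_all: "\<forall>t. (0 \<le> k t \<and> (t = 0 \<longrightarrow> k t = norm x0)) \<and>
      (\<forall>x u. norm x \<le> k t \<longrightarrow> c x u < ?V x + 1 \<longrightarrow>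
      (\<forall>i\<in>{1..N}. norm (f x u (response (Ps (T - t)) (A *v x + B *v u) (wh i))) \<le> k (Suc t))
      \<and> lam * transport (Ps (T - t)) (A *v x + B *v u) \<le> k (Suc t))" by (rule exE)
  then have k: "\<And>t. 0 \<le> k t" "k 0 = norm x0"
    by simp_all
  have reach: "\<And>t x u i. norm x \<le> k t \<Longrightarrow> c x u < ?V x + 1 \<Longrightarrow> i \<in> {1..N} \<Longrightarrow>
      norm (f x u (response (Ps (T - t)) (A *v x + B *v u) (wh i))) \<le> k (Suc t)"
    and cost: "\<And>t x u. norm x \<le> k t \<Longrightarrow> c x u < ?V x + 1 \<Longrightarrow>
      lam * transport (Ps (T - t)) (A *v x + B *v u) \<le> k (Suc t)"
    using k_all by simp_all
  \<comment> \<open>Player II departs from \<nu> only here. The margin 1 becomes the strict excess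
    of an expensive control at time 0.\<close>
  define D where "D = (\<lambda>t x u. t \<le> T \<and> norm x \<le> k t \<and> c x u < ?V x + 1)"
  define G where "G = (\<lambda>t x u. if D t x u then worst_distribution (Ps (T - t)) (A *v x + B *v u) else \<nu>)"
  define y where "y = (\<lambda>t x u. if D t x u then c x u - lam * transport (Ps (T - t)) (A *v x + B *v u)
    else c x u)"
  define \<beta> where "\<beta> = (\<lambda>t x u. if D t x u then ennreal (q_value (Ps (T - t)) (zs (T - t)) x u)
    else if t \<le> T \<and> norm x \<le> k t then ennreal (?V x + 1) else 0)"
  \<comment> \<open>Decisions are made at times 0 to T. The continuation after time t is iterate T -
    t, hence the state at time t is valued by iterate Suc T - t; from Suc T on everything is 0,
    matching \<open>Ps 0 = 0\<close>.\<close>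
  define v where "v = (\<lambda>t x. if t \<le> T \<and> norm x \<le> k t
    then ennreal (quad (Ps (Suc T - t)) x + zs (Suc T - t)) else 0)"
  define b where "b = (\<Sum>t\<le>T. k (Suc t))"
  have cm: "(\<lambda>p. c (fst p) (snd p)) \<in> borel_measurable (borel \<Otimes>\<^sub>M borel)"
    unfolding quadratic_cost_def by measurable
  have Dm: "{p \<in> space (borel \<Otimes>\<^sub>M borel). D t (fst p) (snd p)} \<in> sets (borel \<Otimes>\<^sub>M borel)" for t
    unfolding D_def using cm by measurable
  have Gm: "(\<lambda>(x, u). G t x u) \<in> borel \<Otimes>\<^sub>M borel \<rightarrow>\<^sub>M prob_algebra borel" for t
    unfolding G_def split_beta'
  proof (rule measurable_If[OF _ _ Dm])
    show "(\<lambda>p. worst_distribution (Ps (T - t)) (A *v fst p + B *v snd p))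
        \<in> borel \<Otimes>\<^sub>M borel \<rightarrow>\<^sub>M prob_algebra borel"
      by (rule worst_distribution_measurable) measurable
  qed (simp add: empirical_measure_in_prob_measures[OF N])
  have ym: "(\<lambda>(x, u). y t x u) \<in> borel_measurable (borel \<Otimes>\<^sub>M borel)" for t
    unfolding y_def split_beta'
  proof (rule measurable_If[OF _ cm Dm])
    show "(\<lambda>p. c (fst p) (snd p) - lam * transport (Ps (T - t)) (A *v fst p + B *v snd p))
        \<in> borel_measurable (borel \<Otimes>\<^sub>M borel)"
      using cm unfolding transport_def response_def
      by (simp del: transpose_matrix_vector) measurable
  qed
  have \<beta>m: "(\<lambda>(x, u). \<beta> t x u) \<in> borel_measurable (borel \<Otimes>\<^sub>M borel)" for t
    unfolding \<beta>_def split_beta'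
  proof (rule measurable_If[OF _ _ Dm])
    show "(\<lambda>p. ennreal (q_value (Ps (T - t)) (zs (T - t)) (fst p) (snd p)))
        \<in> borel_measurable (borel \<Otimes>\<^sub>M borel)"
      using q_value_measurable by (simp add: split_beta')
    show "(\<lambda>p. if t \<le> T \<and> norm (fst p) \<le> k t then ennreal (?V (fst p) + 1) else 0)
        \<in> borel_measurable (borel \<Otimes>\<^sub>M borel)"
      by measurable
  qed
  have vm [measurable]: "v t \<in> borel_measurable borel" for t
    unfolding v_def by measurable
  have payoff: "ereal (y t x u) \<le> stage_payoff c lam \<nu> (x, u, G t x u)" for t x u
  proof (cases "D t x u")
    case True
    then show ?thesis
      using stage_payoff_antimono[OF lam wasserstein_cost_worst_distribution transport_nonneg]
      by (simp add: y_def G_def)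
  next
    case False
    have "wasserstein_cost \<nu> \<nu> \<le> ennreal 0"
      using wasserstein_cost_empirical_measure[OF N, of wh wh] by simp
    from stage_payoff_antimono[OF lam this, of c x u] show ?thesis
      using False by (simp add: y_def G_def)
  qed
  have low: "- y t x u \<le> b" for t x u
  proof (cases "D t x u")
    case True
    then have "lam * transport (Ps (T - t)) (A *v x + B *v u) \<le> k (Suc t)"
      using cost by (simp add: D_def)
    also have "\<dots> \<le> b"
      unfolding b_def using True k(1) by (intro member_le_sum) (auto simp: D_def)
    finally show ?thesis using True cost_nonneg[of x u] by (simp add: y_def)
  next
    case False
    moreover have "0 \<le> b" unfolding b_def by (intro sum_nonneg k)
    ultimately show ?thesis using cost_nonneg[of x u] by (simp add: y_def)
  qed
  have v_le: "v t x \<le> \<beta> t x u" for t x u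
  proof (cases "t \<le> T \<and> norm x \<le> k t")
    case True
    then have "Suc T - t = Suc (T - t)" by (simp add: Suc_diff_le)
    \<comment> \<open>For a cheap control the iteration step applies; for an expensive one V(x) + 1
      exceeds the iterate by \<open>le\<close>.\<close>
    then show ?thesis
      using True step[of x "T - t" u] le[of x "Suc (T - t)"]
      by (auto simp: v_def \<beta>_def intro!: ennreal_leI)
  qed (auto simp: v_def)
  have ineq: "\<beta> t x u + ennreal (- y t x u)
      \<le> ennreal (y t x u) + ennreal \<alpha> * (\<integral>\<^sup>+ w. v (Suc t) (f x u w) \<partial>G t x u)" for t x u
  proof (cases "D t x u")
    case True
    let ?P = "Ps (T - t)" and ?z = "zs (T - t)" and ?y = "A *v x + B *v u"
    have "(\<integral>\<^sup>+ w. v (Suc t) (f x u w) \<partial>G t x u)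
        = (\<integral>\<^sup>+ w. v (Suc t) (f x u w) \<partial>worst_distribution ?P ?y)"
      using True by (simp add: G_def)
    \<comment> \<open>Only the atoms matter, and they lead into the ball of radius
      \<open>k (Suc t)\<close>, where v is not truncated; at t = T both sides vanish.\<close>
    also have "\<dots> = (\<integral>\<^sup>+ w. ennreal (quad ?P (?y + \<Xi> *v w) + ?z) \<partial>worst_distribution ?P ?y)"
    proof (rule nn_integral_worst_distribution_cong)
      fix i assume "i \<in> {1..N}"
      then have "norm (f x u (response ?P ?y (wh i))) \<le> k (Suc t)"
        using True reach by (simp add: D_def)
      then show "v (Suc t) (f x u (response ?P ?y (wh i)))
          = ennreal (quad ?P (?y + \<Xi> *v response ?P ?y (wh i)) + ?z)"
        using True initial by (cases "t = T") (auto simp: v_def D_def system_eq)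
    qed (unfold system_eq, measurable)
    finally have "ennreal \<alpha> * (\<integral>\<^sup>+ w. v (Suc t) (f x u w) \<partial>G t x u)
        = ennreal (worst_gain ?P ?y + \<alpha> * ?z + lam * transport ?P ?y)"
      by (simp only: continuation_worst_distribution[OF Ps zs])
    moreover have "0 \<le> worst_gain ?P ?y + \<alpha> * ?z + lam * transport ?P ?y"
      using worst_gain_nonneg[OF Ps, of "T - t" ?y] \<alpha> zs[of "T - t"] lam transport_nonneg[of ?P ?y]
      by simp
    ultimately show ?thesis
      using True q_value_nonneg[OF Ps zs, of "T - t" "T - t" x u]
      by (cases "0 \<le> y t x u")
        (auto simp: \<beta>_def y_def q_value_def ennreal_plus[symmetric] ennreal_neg intro!: ennreal_leI
          simp del: ennreal_plus)
  next
    case False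
    \<comment> \<open>Player II plays \<nu> at no transport cost and receives the cost, which is at
      least V(x) + 1 if the control is too expensive; elsewhere \<open>\<beta>\<close> is 0.\<close>
    then have "\<beta> t x u \<le> ennreal (y t x u)"
      by (auto simp: \<beta>_def y_def D_def intro!: ennreal_leI)
    then show ?thesis
      using False cost_nonneg[of x u] by (simp add: y_def ennreal_neg add_increasing2)
  qed
  have fin: "\<beta> t x u = 0" if "Suc T \<le> t" for t x u
    using that by (simp add: \<beta>_def D_def)
  have "total_payoff f c \<alpha> lam \<nu> \<pi> (markov_policyII G) x0 \<le> worst_payoff f c \<alpha> lam \<nu> \<pi> x0"
    unfolding worst_payoff_def by (intro SUP_upper markov_policyII_in_policiesII Gm)
  also note worst
  finally have "(\<integral>\<^sup>+ u. \<beta> 0 x0 u \<partial>\<pi> 0 (\<lambda>_. undefined, x0)) \<le> ennreal (?V x0)"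
    using k(1)
    by (intro initial_value_le[where G = G and y = y and b = b and \<phi> = \<beta> and T = "Suc T" and v = v]
        \<pi> Gm ym payoff low \<beta>m fin vm v_le ineq Vnn) (auto simp: b_def intro: sum_nonneg)
  then show ?thesis
    by (simp add: \<beta>_def D_def k(2) cong: if_cong)
qed

end

section \<open>Value iteration\<close>

text \<open>Polarisation, to pass from convergence of forms to convergence of entries.\<close>

lemma symmetric_entry:
  fixes M :: "real ^ 'n ^ 'n"
  assumes "transpose M = M"
  shows "M $ i $ j = (quad M (axis i 1 + axis j 1) - quad M (axis i 1) - quad M (axis j 1)) / 2"
proof -
  have "axis j 1 \<bullet> (M *v axis i 1) = M $ j $ i"
    by (simp add: matrix_vector_mult_basis inner_axis' column_def)
  moreover have "M $ j $ i = M $ i $ j"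
    using assms by (metis transpose_def vec_lambda_beta)
  ultimately show ?thesis
    using quad_add[OF assms, of "axis i 1" "axis j 1"] by simp
qed

lemma incseq_matrix_limit:
  fixes Ps :: "nat \<Rightarrow> real ^ 'n ^ 'n"
  assumes sym: "\<And>n. transpose (Ps n) = Ps n"
    and mono: "\<And>n x. quad (Ps n) x \<le> quad (Ps (Suc n)) x"
    and bound: "\<And>n x. quad (Ps n) x \<le> quad Pb x"
  obtains L where "transpose L = L" and "\<And>x. (\<lambda>n. quad (Ps n) x) \<longlonglongrightarrow> quad L x"
proof -
  have conv: "convergent (\<lambda>n. quad (Ps n) x)" for x
  proof -
    have "incseq (\<lambda>n. quad (Ps n) x)" by (intro incseq_SucI mono)
    moreover have "\<forall>n. quad (Ps n) x \<le> quad Pb x" using bound by simp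
    ultimately show ?thesis
      by (meson incseq_convergent convergent_def)
  qed
  from conv have t: "(\<lambda>n. quad (Ps n) x) \<longlonglongrightarrow> lim (\<lambda>n. quad (Ps n) x)" for x
    by (simp add: convergent_LIMSEQ_iff)
  have "convergent (\<lambda>n. Ps n $ i $ j)" for i j
    unfolding symmetric_entry[OF sym] 
    by (rule convergentI, rule tendsto_divide[OF tendsto_diff[OF tendsto_diff[OF t t] t] tendsto_const]) simp
  then have lim: "(\<lambda>n. Ps n $ i $ j) \<longlonglongrightarrow> lim (\<lambda>n. Ps n $ i $ j)" for i j
    by (simp add: convergent_LIMSEQ_iff)
  define L :: "real ^ 'n ^ 'n" where "L = (\<chi> i j. lim (\<lambda>n. Ps n $ i $ j))"
  have "Ps n $ i $ j = Ps n $ j $ i" for n i j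
    using sym[of n] by (metis transpose_def vec_lambda_beta)
  then have "transpose L = L"
    by (simp add: L_def transpose_def)
  moreover have "(\<lambda>n. quad (Ps n) x) \<longlonglongrightarrow> quad L x" for x
    unfolding inner_vec_def matrix_vector_mult_def
    using lim by (auto simp: L_def intro!: tendsto_intros)
  ultimately show ?thesis by (rule that)
qed

section \<open>Monotonicity of the one-stage operators\<close>

context wasserstein_lq
begin

lemma inner_pen: "x \<bullet> (pen P *v y) = lam * (x \<bullet> y) - \<alpha> * ((\<Xi> *v x) \<bullet> (P *v (\<Xi> *v y)))"
  using inner_transpose_mult[of \<Xi> "P *v (\<Xi> *v y)" x]
  by (simp add: pen_mult inner_diff_right inner_commute del: transpose_matrix_vector)

text \<open>A smaller P subtracts less, so \<open>pen P\<close> dominates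
  \<open>pen P'\<close>.\<close>

lemma admissible_mono:
  assumes P: "pos_semidef P" and P': "admissible P'" and le: "\<And>x. quad P x \<le> quad P' x"
  shows "admissible P"
proof -
  have "transpose (pen P) = pen P"
    using inner_symmetric_mult[OF pos_semidef_symmetric[OF P]]
    by (intro symmetric_if_inner) (simp only: inner_pen inner_commute)
  moreover have "0 < quad (pen P) w" if "w \<noteq> 0" for w
  proof -
    have "0 < quad (pen P') w" using P' that by (simp add: admissible_def pos_def_def)
    also have "\<dots> \<le> quad (pen P) w"
      unfolding inner_pen using le[of "\<Xi> *v w"] \<alpha> by simp
    finally show ?thesis .
  qed
  ultimately show ?thesis using P by (simp add: admissible_def pos_def_def)
qed

lemma objective_le_max:
  assumes "admissible P'" and "\<And>x. quad P x \<le> quad P' x"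
  shows "objective P y a w \<le> objective P' y a (response P' y a)"
proof -
  have "objective P y a w \<le> objective P' y a w"
    using assms(2) \<alpha> by (simp add: objective_def)
  also have "\<dots> \<le> objective P' y a (response P' y a)"
    using assms(1) pos_def_nonneg by (subst objective_response) (auto simp: admissible_def)
  finally show ?thesis .
qed

lemma worst_gain_mono:
  assumes "admissible P" "admissible P'" and "\<And>x. quad P x \<le> quad P' x"
  shows "worst_gain P y \<le> worst_gain P' y"
  unfolding average_objective_max[OF assms(1), symmetric] average_objective_max[OF assms(2), symmetric]
  by (intro mult_left_mono sum_mono objective_le_max assms) auto

lemma noise_value_mono:
  assumes "admissible P" "admissible P'" and "\<And>x. quad P x \<le> quad P' x"
  shows "noise_value P \<le> noise_value P'"
  using worst_gain_mono[OF assms, of 0] by (simp add: worst_gain_def)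

text \<open>For the sample a = 0 the maximal objective is exactly \<alpha> times the robust form,
  which separates it from the noise term.\<close>

lemma quad_robust_matrix_mono:
  assumes "admissible P" "admissible P'" and "\<And>x. quad P x \<le> quad P' x"
  shows "quad (robust_matrix P) y \<le> quad (robust_matrix P') y"
proof -
  have max: "objective X y 0 (response X y 0) = \<alpha> * quad (robust_matrix X) y" if "admissible X" for X
  proof -
    have "transpose X = X" using that by (simp add: admissible_def pos_semidef_def)
    then show ?thesis
      unfolding objective_max[OF that] by (simp add: quad_robust_matrix quad_scaleR
          matrix_vector_mult_scaleR power2_eq_square distrib_left del: transpose_matrix_vector)
  qed
  show ?thesis
    using objective_le_max[OF assms(2,3), of y 0 "response P y 0"] \<alpha> max assms by simp
qed

text \<open>The minimiser for P' is a possibly suboptimal control for P.\<close>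

lemma quad_riccati_mono:
  assumes "admissible P" "admissible P'" and "\<And>x. quad P x \<le> quad P' x"
  shows "quad (riccati P) x \<le> quad (riccati P') x"
proof -
  let ?u = "gain P' *v x"
  have "quad (riccati P) x \<le> quad (riccati P) x + quad (ctl P) (?u - gain P *v x)"
    using pos_def_nonneg[OF pos_def_ctl[OF assms(1)]] by simp
  also have "\<dots> \<le> c x ?u + \<alpha> * quad (robust_matrix P') (A *v x + B *v ?u)"
    unfolding quad_riccati[OF assms(1), symmetric]
    using quad_robust_matrix_mono[OF assms] \<alpha> by simp
  also have "\<dots> = quad (riccati P') x"
    unfolding quad_riccati[OF assms(2)] by simp
  finally show ?thesis .
qed

lemma pos_semidef_riccati:
  assumes P: "admissible P"
  shows "pos_semidef (riccati P)"
proof -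
  note sym = symmetric_matrix_inv[OF pos_def_ctl[OF P]] symmetric_matrix_inv[of "pen P"]
    pos_semidef_symmetric[OF Q] pos_semidef_symmetric[of P]
  have "transpose (X - Y) = transpose X - transpose Y" for X Y :: "real ^ 'n ^ 'n"
    by (simp add: transpose_def vec_eq_iff)
  then have "transpose (riccati P) = riccati P"
    using P unfolding riccati_def riccati_S_def admissible_def
    by (simp add: transpose_add_matrix transpose_scalar matrix_transpose_mul matrix_mul_assoc sym)
  moreover have "0 \<le> quad (riccati P) x" for x
    using quad_riccati[OF P, of x "gain P *v x"] cost_nonneg[of x "gain P *v x"] \<alpha>
      quad_robust_matrix_nonneg[OF P, of "A *v x + B *v (gain P *v x)"]
    by (smt (verit) mult_nonneg_nonneg pos_def_ctl pos_def_nonneg matrix_vector_mult_0_right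
        right_minus_eq inner_zero_left)
  ultimately show ?thesis by (simp add: pos_semidef_def)
qed

section \<open>Value iterates from zero and their limit\<close>

primrec value_matrix :: "nat \<Rightarrow> real ^ 'n ^ 'n" where
  "value_matrix 0 = 0"
| "value_matrix (Suc n) = riccati (value_matrix n)"

primrec value_constant :: "nat \<Rightarrow> real" where
  "value_constant 0 = 0"
| "value_constant (Suc n) = noise_value (value_matrix n) + \<alpha> * value_constant n"

lemma value_iteration_step:
  assumes "admissible (value_matrix n)"
  shows "quad (value_matrix (Suc n)) x + value_constant (Suc n)
    \<le> q_value (value_matrix n) (value_constant n) x u"
  using pos_def_nonneg[OF pos_def_ctl[OF assms]] by (simp add: q_value_eq[OF assms])

text \<open>The claims need a joint induction: the bound by P makes each iterate admissible, and
  monotonicity of \<open>riccati\<close> is available only between admissible matrices.\<close>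

lemma value_matrix_mono:
  assumes P: "admissible P" and fixpoint: "riccati P = P"
  shows "admissible (value_matrix n) \<and> (\<forall>x. quad (value_matrix n) x \<le> quad P x)
    \<and> (\<forall>x. quad (value_matrix n) x \<le> quad (value_matrix (Suc n)) x)"
proof (induction n)
  case 0
  have le: "quad 0 x \<le> quad P x" for x
    using P by (simp add: admissible_def pos_semidef_def)
  have "pos_semidef (0 :: real ^ 'n ^ 'n)"
    by (simp add: pos_semidef_def transpose_def vec_eq_iff)
  then have "admissible 0" by (rule admissible_mono[OF _ P le])
  then show ?case
    using le pos_semidef_nonneg[OF pos_semidef_riccati] by simp
next
  case (Suc n)
  then have n: "admissible (value_matrix n)" "\<And>x. quad (value_matrix n) x \<le> quad P x"
    "\<And>x. quad (value_matrix n) x \<le> quad (value_matrix (Suc n)) x"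
    by auto
  have le: "quad (value_matrix (Suc n)) x \<le> quad P x" for x
    using quad_riccati_mono[OF n(1) P n(2)] by (simp add: fixpoint)
  have ad: "admissible (value_matrix (Suc n))"
    using pos_semidef_riccati[OF n(1)] by (intro admissible_mono[OF _ P le]) simp
  show ?case
    using le ad quad_riccati_mono[OF n(1) ad n(3)] by simp
qed

lemma value_constant_mono:
  assumes P: "admissible P" and fixpoint: "riccati P = P" and z: "z = noise_value P + \<alpha> * z"
  shows "0 \<le> value_constant n \<and> value_constant n \<le> z \<and> value_constant n \<le> value_constant (Suc n)"
proof (induction n)
  case 0
  have "0 \<le> (1 - \<alpha>) * z" using z noise_value_nonneg[OF P] by (simp add: left_diff_distrib)
  then have "0 \<le> z" using \<alpha> by (simp add: zero_le_mult_iff)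
  then show ?case
    using noise_value_nonneg value_matrix_mono[OF P fixpoint, of 0] by simp
next
  case (Suc n)
  note n = value_matrix_mono[OF P fixpoint, of n] and n' = value_matrix_mono[OF P fixpoint, of "Suc n"]
  have "value_constant (Suc n) \<le> noise_value P + \<alpha> * z"
    using Suc \<alpha> n P by (auto intro!: add_mono noise_value_mono)
  moreover have "value_constant (Suc n) \<le> value_constant (Suc (Suc n))"
    using Suc \<alpha> n n' by (auto intro!: add_mono noise_value_mono)
  ultimately show ?case using Suc z by linarith
qed

text \<open>At fixed disturbances the objective is affine in the form, so freezing the responses
  that are optimal for L gives lower bounds that converge to the value of L. This avoids continuity
  of the matrix inverse.\<close>

lemma q_value_limit_le:
  assumes Ps: "\<And>n. admissible (Ps n)" and L: "admissible L"
    and lim: "\<And>x. (\<lambda>n. quad (Ps n) x) \<longlonglongrightarrow> quad L x" "zs \<longlonglongrightarrow> zl"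
    and le: "\<And>n. n0 \<le> n \<Longrightarrow> q_value (Ps n) (zs n) x u \<le> C"
  shows "q_value L zl x u \<le> C"
proof -
  let ?y = "A *v x + B *v u"
  define J where "J = (\<lambda>M. 1 / N * (\<Sum>i = 1..N. objective M ?y (wh i) (response L ?y (wh i))))"
  have "J (Ps n) \<le> worst_gain (Ps n) ?y" for n
    unfolding J_def average_objective_max[OF Ps, symmetric]
    by (intro mult_left_mono sum_mono objective_le_max Ps) auto
  then have "c x u + J (Ps n) + \<alpha> * zs n \<le> C" if "n0 \<le> n" for n
    using le[OF that] by (simp add: q_value_def) (meson add_left_mono add_right_mono order_trans)
  moreover have "(\<lambda>n. c x u + J (Ps n) + \<alpha> * zs n) \<longlonglongrightarrow> c x u + J L + \<alpha> * zl"
    unfolding J_def objective_def by (intro tendsto_intros lim)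
  ultimately have "c x u + J L + \<alpha> * zl \<le> C"
    by (intro LIMSEQ_le_const2[of _ _ C]) auto
  moreover have "J L = worst_gain L ?y"
    unfolding J_def by (rule average_objective_max[OF L])
  ultimately show ?thesis by (simp add: q_value_def)
qed

lemma q_value_mono:
  assumes "admissible P" "admissible P'" and "\<And>x. quad P x \<le> quad P' x" and "z \<le> z'"
  shows "q_value P z x u \<le> q_value P' z' x u"
  using worst_gain_mono[OF assms(1-3)] assms(4) \<alpha> by (simp add: q_value_def add_mono)

lemma continuous_q_value:
  assumes "admissible P"
  shows "continuous_on UNIV (q_value P z x)"
proof -
  have "q_value P z x = (\<lambda>u. quad (riccati P) x + noise_value P + \<alpha> * z + quad (ctl P) (u - gain P *v x))"
    by (rule ext) (rule q_value_eq[OF assms])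
  then show ?thesis by (simp only:) (intro continuous_intros)
qed

text \<open>The minimisers of the value iteration at \<open>x\<close> stay bounded because \<open>R\<close> is positive definite; a limit
  point of them shows that the limit of the value iteration dominates its own Bellman update.\<close>

lemma value_iteration_limit:
  assumes P: "admissible P" and fixpoint: "riccati P = P" and z: "z = noise_value P + \<alpha> * z"
  obtains L zl where "admissible L" and "0 \<le> zl"
    and "\<And>x. (\<lambda>n. quad (value_matrix n) x) \<longlonglongrightarrow> quad L x" and "value_constant \<longlonglongrightarrow> zl"
    and "\<And>x. quad L x + zl \<le> quad P x + z"
    and "\<And>x. q_value L zl x (gain L *v x) \<le> quad L x + zl"
proof -
  let ?M = value_matrix and ?z = value_constant
  have ad: "admissible (?M n)" and le: "quad (?M n) x \<le> quad P x"
    and mono: "quad (?M n) x \<le> quad (?M (Suc n)) x" for n x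
    using value_matrix_mono[OF P fixpoint, of n] by auto
  have zn: "0 \<le> ?z n" "?z n \<le> z" "?z n \<le> ?z (Suc n)" for n
    using value_constant_mono[OF P fixpoint z, of n] by auto
  have sym: "transpose (?M n) = ?M n" for n
    using ad[of n] by (simp add: admissible_def pos_semidef_def)
  obtain L where symL: "transpose L = L" and L: "\<And>x. (\<lambda>n. quad (?M n) x) \<longlonglongrightarrow> quad L x"
    using incseq_matrix_limit[where Ps = ?M and Pb = P, OF sym mono le] by blast
  have incz: "incseq ?z" by (intro incseq_SucI zn(3))
  have "\<forall>n. ?z n \<le> z" using zn by simp
  then obtain zl where zl: "?z \<longlonglongrightarrow> zl" using incseq_convergent[OF incz] by metis
  have inc: "incseq (\<lambda>n. quad (?M n) x)" for x by (intro incseq_SucI mono)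
  have n_le_L: "quad (?M n) x \<le> quad L x" for n x by (rule incseq_le[OF inc L])
  have n_le_zl: "?z n \<le> zl" for n by (rule incseq_le[OF incz zl])
  have L_le: "quad L x \<le> quad P x" for x using LIMSEQ_le_const2[OF L] le by blast
  have zl_le: "zl \<le> z" using LIMSEQ_le_const2[OF zl] zn by blast
  have "0 \<le> quad L x" for x using n_le_L[of x 0] by simp
  then have adL: "admissible L"
    using symL by (intro admissible_mono[OF _ P L_le]) (simp add: pos_semidef_def)
  have zl0: "0 \<le> zl" using n_le_zl[of 0] by simp
  have "q_value L zl x (gain L *v x) \<le> quad L x + zl" for x
  proof -
    define u where "u = (\<lambda>n. gain (?M n) *v x)"
    \<comment> \<open>The control minimises the value built on iterate n, so it attains iterate n +
      1, which lies below the limit.\<close>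
    have un: "q_value (?M n) (?z n) x (u n) \<le> quad L x + zl" for n
      using n_le_L[of x "Suc n"] n_le_zl[of "Suc n"] by (simp add: q_value_eq[OF ad] u_def)
    obtain m where m: "0 < m" "\<And>u. m * (norm u)\<^sup>2 \<le> quad R u"
      by (rule pos_def_coercive[OF R]) blast
    have "norm (u n) \<le> sqrt ((quad L x + zl) / m)" for n
    proof -
      have "m * (norm (u n))\<^sup>2 \<le> c x (u n)"
        using m(2)[of "u n"] pos_semidef_nonneg[OF Q, of x] by (simp add: quadratic_cost_def)
      also have "\<dots> \<le> q_value (?M n) (?z n) x (u n)"
        using worst_gain_nonneg[OF ad] zn(1)[of n] \<alpha> by (simp add: q_value_def)
      also note un
      finally show ?thesis using m(1) by (intro real_le_rsqrt) (simp add: field_simps)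
    qed
    then have "bounded (range u)" by (auto simp: bounded_iff)
    from bounded_imp_convergent_subsequence[OF this] obtain u' r
      where r: "strict_mono r" "(u \<circ> r) \<longlonglongrightarrow> u'" by blast
    \<comment> \<open>The index n stays fixed while the controls move along the subsequence; for j
      \<ge> n monotonicity in the index bounds the value by that of iterate r j at its own
      minimiser.\<close>
    have "q_value (?M n) (?z n) x u' \<le> quad L x + zl" for n
    proof (rule LIMSEQ_le_const2)
      show "(\<lambda>j. q_value (?M n) (?z n) x ((u \<circ> r) j)) \<longlonglongrightarrow> q_value (?M n) (?z n) x u'"
        using continuous_on_tendsto_compose[OF continuous_q_value[OF ad] r(2)] by simp
      have "q_value (?M n) (?z n) x ((u \<circ> r) j) \<le> quad L x + zl" if "n \<le> j" for j
      proof -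
        have "n \<le> r j" using that seq_suble[OF r(1), of j] by simp
        then have "q_value (?M n) (?z n) x (u (r j)) \<le> q_value (?M (r j)) (?z (r j)) x (u (r j))"
          using inc incz by (intro q_value_mono ad) (auto simp: incseq_def)
        also note un
        finally show ?thesis by simp
      qed
      then show "\<exists>k. \<forall>j\<ge>k. q_value (?M n) (?z n) x ((u \<circ> r) j) \<le> quad L x + zl" by blast
    qed
    from q_value_limit_le[OF ad adL L zl this]
    have "q_value L zl x u' \<le> quad L x + zl" .
    moreover have "q_value L zl x (gain L *v x) \<le> q_value L zl x u'"
      using pos_def_nonneg[OF pos_def_ctl[OF adL]] by (simp add: q_value_eq[OF adL])
    ultimately show ?thesis by simp
  qed
  moreover have "quad L x + zl \<le> quad P x + z" for x using L_le zl_le by (rule add_mono)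
  ultimately show ?thesis using adL zl0 L zl by (intro that) auto
qed

end

section \<open>Optimal policies\<close>

lemma prob_measure_eq_return:
  assumes \<mu>: "\<mu> \<in> prob_measures" and ae: "AE u in \<mu>. u = a"
  shows "\<mu> = return borel a"
proof (rule measure_eqI)
  have sets: "sets \<mu> = sets borel" and "prob_space \<mu>"
    using \<mu> by (auto simp: space_prob_algebra)
  interpret prob_space \<mu> by fact
  show "sets \<mu> = sets (return borel a)" using sets by simp
  fix E assume E: "E \<in> sets \<mu>"
  have "emeasure \<mu> E = (\<integral>\<^sup>+ u. indicator E u \<partial>\<mu>)" using E by simp
  also have "\<dots> = (\<integral>\<^sup>+ u. indicator E a \<partial>\<mu>)"
    using ae by (intro nn_integral_cong_AE) (auto elim: eventually_mono)
  also have "\<dots> = emeasure (return borel a) E"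
    using E sets by (simp add: emeasure_space_1)
  finally show "emeasure \<mu> E = emeasure (return borel a) E" .
qed

context controlled_process
begin

lemma stage_expectation_Suc_feedback:
  assumes b: "b \<in> borel_measurable borel"
    and control: "AE \<omega> in law. fst (snd (\<omega> t)) = k (fst (\<omega> t))"
    and disturbance: "AE \<omega> in law. snd (snd (\<omega> t)) = g (fst (\<omega> t))"
  shows "stage_expectation (Suc t) (\<lambda>(x, u, \<mu>). b x)
    = stage_expectation t (\<lambda>(x, u, \<mu>). \<integral>\<^sup>+ w. b (f x (k x) w) \<partial>g x)"
  unfolding stage_expectation_Suc[OF b] stage_expectation_def[of t]
proof (rule nn_integral_cong_AE)
  show "AE \<omega> in law. (case \<omega> t of (x, u, \<mu>) \<Rightarrow> \<integral>\<^sup>+ w. b (f x u w) \<partial>\<mu>)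
      = (case \<omega> t of (x, u, \<mu>) \<Rightarrow> \<integral>\<^sup>+ w. b (f x (k x) w) \<partial>g x)"
    using control disturbance by eventually_elim (simp add: split_beta')
qed

end

section \<open>Uniqueness of the first control, and Player II's best answer\<close>

context wasserstein_lq
begin

text \<open>With growing horizon the finite-horizon bounds increase to at least V(x0) + e(u), with e
  the excess of the control u. Their integrals are at most V(x0) < \<infinity>, so e vanishes almost
  surely.\<close>

lemma control_determined:
  assumes P: "admissible P" and fixpoint: "riccati P = P" and z: "z = noise_value P + \<alpha> * z"
    and lim: "\<And>x. (\<lambda>n. quad (value_matrix n) x) \<longlonglongrightarrow> quad P x" "value_constant \<longlonglongrightarrow> z"
    and \<pi>: "\<pi> \<in> policiesI"
    and worst: "worst_payoff f c \<alpha> lam \<nu> \<pi> x0 \<le> ereal (quad P x0 + z)"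
  shows "\<pi> 0 (\<lambda>_. undefined, x0) = return borel (gain P *v x0)"
proof -
  let ?\<mu> = "\<pi> 0 (\<lambda>_. undefined, x0)" and ?V = "quad P x0 + z"
  have ad: "admissible (value_matrix n)" and le: "quad (value_matrix n) x \<le> quad P x"
    and mono: "quad (value_matrix n) x \<le> quad (value_matrix (Suc n)) x" for n x
    using value_matrix_mono[OF P fixpoint, of n] by auto
  have zn: "0 \<le> value_constant n" "value_constant n \<le> z"
    "value_constant n \<le> value_constant (Suc n)" for n
    using value_constant_mono[OF P fixpoint z, of n] by auto
  have z0: "0 \<le> z" using zn[of 0] by simp
  have psd: "pos_semidef P" using P by (simp add: admissible_def)
  have "(\<lambda>_. undefined, x0) \<in> space (hist_space 0)"
    by (simp add: hist_space_def space_PiM space_pair_measure)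
  then have \<mu>: "?\<mu> \<in> space (prob_algebra borel)"
    using \<pi> by (auto simp: policiesI_def dest: measurable_space)
  then have [measurable_cong]: "sets ?\<mu> = sets borel" and "prob_space ?\<mu>"
    by (auto simp: space_prob_algebra)
  interpret prob_space ?\<mu> by fact
  define b where "b = (\<lambda>n u. if c x0 u < ?V + 1
    then ennreal (q_value (value_matrix n) (value_constant n) x0 u) else ennreal (?V + 1))"
  \<comment> \<open>A cheap control costs the completed square; for an expensive one the cap V(x0) +
    1 leaves an excess of 1.\<close>
  define e where "e = (\<lambda>u. if c x0 u < ?V + 1 then quad (ctl P) (u - gain P *v x0) else 1)"
  have e: "0 \<le> e u" for u
    using pos_def_nonneg[OF pos_def_ctl[OF P]] by (simp add: e_def)
  have cm [measurable]: "c x0 \<in> borel_measurable ?\<mu>"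
    unfolding quadratic_cost_def[abs_def] by measurable
  have em [measurable]: "e \<in> borel_measurable ?\<mu>"
    unfolding e_def by measurable
  have "ennreal (?V + e u) \<le> (SUP n. b n u)" for u
  proof (cases "c x0 u < ?V + 1")
    case True
    show ?thesis
    proof (cases "SUP n. b n u" rule: ennreal_cases)
      case (real C)
      have "q_value (value_matrix n) (value_constant n) x0 u \<le> C" for n
      proof -
        have "b n u \<le> ennreal C" unfolding real(2)[symmetric] by (rule SUP_upper) simp
        then show ?thesis using True real(1) by (simp add: b_def)
      qed
      from q_value_limit_le[OF ad P lim this] have "q_value P z x0 u \<le> C" .
      moreover have "q_value P z x0 u = ?V + e u"
        using True by (simp add: q_value_eq[OF P] fixpoint e_def z[symmetric])
      ultimately show ?thesis unfolding real(2) by (simp add: ennreal_leI)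
    next
      case top
      then show ?thesis by (simp only: top_greatest)
    qed
  next
    case False
    then have "ennreal (?V + e u) = b 0 u" by (simp add: b_def e_def)
    also have "\<dots> \<le> (SUP n. b n u)" by (rule SUP_upper) simp
    finally show ?thesis .
  qed
  then have "(\<integral>\<^sup>+ u. ennreal (?V + e u) \<partial>?\<mu>) \<le> (\<integral>\<^sup>+ u. (SUP n. b n u) \<partial>?\<mu>)"
    by (intro nn_integral_mono)
  also have "\<dots> = (SUP n. \<integral>\<^sup>+ u. b n u \<partial>?\<mu>)"
  proof (rule nn_integral_monotone_convergence_SUP)
    have "b n u \<le> b (Suc n) u" for n u
      using q_value_mono[OF ad ad mono zn(3)] by (auto simp: b_def intro: ennreal_leI)
    then show "incseq b" by (intro incseq_SucI le_funI)
    show "b n \<in> borel_measurable ?\<mu>" for n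
    proof -
      have "q_value (value_matrix n) (value_constant n) x0 \<in> borel_measurable ?\<mu>"
        unfolding q_value_def[abs_def] worst_gain_def quadratic_cost_def by measurable
      then show ?thesis unfolding b_def by measurable
    qed
  qed
  also have "\<dots> \<le> ennreal ?V"
    unfolding b_def
    by (intro SUP_least finite_horizon_bound[where Ps = value_matrix and zs = value_constant]
        psd z0 ad zn value_iteration_step \<pi> worst add_mono le) simp_all
  finally have "ennreal ?V + (\<integral>\<^sup>+ u. ennreal (e u) \<partial>?\<mu>) \<le> ennreal ?V + 0"
    using e pos_semidef_nonneg[OF psd, of x0] z0 by (simp add: nn_integral_add emeasure_space_1)
  then have "(\<integral>\<^sup>+ u. ennreal (e u) \<partial>?\<mu>) = 0"
    by (simp only: ennreal_add_left_cancel_le) simp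
  then have "AE u in ?\<mu>. ennreal (e u) = 0"
    by (subst (asm) nn_integral_0_iff_AE) auto
  then have "AE u in ?\<mu>. u = gain P *v x0"
  proof eventually_elim
    case (elim u)
    then have "e u \<le> 0" by (simp add: ennreal_eq_0_iff)
    then have "quad (ctl P) (u - gain P *v x0) \<le> 0"
      by (auto simp: e_def split: if_splits)
    then show ?case
      using pos_def_ctl[OF P] unfolding pos_def_def by (meson eq_iff_diff_eq_0 not_less)
  qed
  then show ?thesis by (rule prob_measure_eq_return[OF \<mu>])
qed

text \<open>Weak duality and its equality case at the worst-case distribution leave no room between
  the pairing cost and the Wasserstein cost.\<close>

lemma stage_payoff_worst_distribution:
  assumes P: "admissible P"
  shows "stage_payoff c lam \<nu> (x, u, worst_distribution P y) = ereal (c x u - lam * transport P y)"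
proof -
  have "ennreal (worst_gain P y + \<alpha> * 0 + lam * transport P y)
      \<le> ennreal (worst_gain P y + \<alpha> * 0) + ennreal lam * wasserstein_cost (worst_distribution P y) \<nu>"
    unfolding continuation_worst_distribution[OF P order_refl, symmetric]
    by (rule weak_duality_cost[OF P order_refl worst_distribution_in_prob_measures])
  then have "ennreal lam * ennreal (transport P y)
      \<le> ennreal lam * wasserstein_cost (worst_distribution P y) \<nu>"
    using worst_gain_nonneg[OF P, of y] lam transport_nonneg[of P y]
    by (simp add: ennreal_add_left_cancel_le ennreal_mult)
  then have "ennreal (transport P y) \<le> wasserstein_cost (worst_distribution P y) \<nu>"
    using lam by (subst (asm) ennreal_mult_le_mult_iff) auto
  with wasserstein_cost_worst_distribution[of P y]
  have "wasserstein_cost (worst_distribution P y) \<nu> = ennreal (transport P y)"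
    by (rule antisym)
  then show ?thesis
    using transport_nonneg by (simp add: stage_payoff_def enn2ereal_ennreal)
qed

definition worst_feedback :: "real ^ 'n ^ 'n \<Rightarrow> real ^ 'n \<Rightarrow> (real ^ 'l) measure" where
  "worst_feedback P x = worst_distribution P (A *v x + B *v (gain P *v x))"

lemma worst_feedback_measurable: "worst_feedback P \<in> borel \<rightarrow>\<^sub>M prob_algebra borel"
  unfolding worst_feedback_def[abs_def] by (rule worst_distribution_measurable) measurable

lemma worst_feedback_in_policiesII:
  "(det_stationary_policyII (worst_feedback P) :: (real ^ 'n, real ^ 'm, real ^ 'l) policyII) \<in> policiesII"
proof -
  have "(\<lambda>(x, u :: real ^ 'm). worst_feedback P x) \<in> borel \<Otimes>\<^sub>M borel \<rightarrow>\<^sub>M prob_algebra borel"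
    unfolding split_beta' by (rule measurable_compose[OF measurable_fst worst_feedback_measurable])
  from markov_policyII_in_policiesII[OF this] show ?thesis
    by (simp add: markov_policyII_def det_stationary_policyII_def)
qed

text \<open>Attaining the value forces the slack in weak duality to vanish for all bump functions, so the
  measures played by Player II are determined.\<close>

lemma optimal_disturbance:
  assumes P: "admissible P" and z: "0 \<le> z" and \<gamma>: "\<gamma> \<in> policiesII"
    and super: "\<And>x. q_value P z x (gain P *v x) \<le> quad P x + z"
    and attained: "ereal (quad P x0 + z) \<le> total_payoff f c \<alpha> lam \<nu> (gain_policy P) \<gamma> x0"
  shows "AE \<omega> in path_law f (gain_policy P) \<gamma> x0. snd (snd (\<omega> t)) = worst_feedback P (fst (\<omega> t))"
proof -
  interpret controlled_process f "gain_policy P" \<gamma> x0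
    by (rule controlled_process[OF gain_policy_in_policiesI \<gamma>])
  have control: "AE \<omega> in law. fst (snd (\<omega> t)) = gain P *v fst (\<omega> t)"
    by (rule AE_control[OF refl]) measurable
  have V: "0 \<le> quad P x0 + z" using P z by (auto simp: admissible_def pos_semidef_def)
  obtain m where m: "0 < m" "\<And>w. m * (norm w)\<^sup>2 \<le> quad (pen P) w"
    using P by (auto simp: admissible_def elim: pos_def_coercive)
  obtain \<B> :: "(real ^ 'l) set set" where \<B>: "countable \<B>" "\<And>U. U \<in> \<B> \<Longrightarrow> open U"
    "\<And>\<mu> \<nu>. \<mu> \<in> prob_measures \<Longrightarrow> \<nu> \<in> prob_measures \<Longrightarrow>
      (\<And>U. U \<in> \<B> \<Longrightarrow> emeasure \<mu> U = emeasure \<nu> U) \<Longrightarrow> \<mu> = \<nu>"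
    by (rule countable_determining_family) blast
  have bump: "AE \<omega> in law. (\<integral>w. bump U n w \<partial>snd (snd (\<omega> t)))
      = (\<integral>w. bump U n w \<partial>worst_distribution P (A *v fst (\<omega> t) + B *v fst (snd (\<omega> t))))" for U n
  proof -
    define s where "s = slack P (m / (real (Suc n))\<^sup>2) (bump U n)"
    define G L S where "G = (\<Sum>t. ennreal \<alpha> ^ t * stage_expectation t (gain_bound P z s))"
      and "L = (\<Sum>t. ennreal \<alpha> ^ t * stage_expectation t (loss_bound P z s))"
      and "S = (\<Sum>t. ennreal \<alpha> ^ t * stage_expectation t s)"
    note bounds = gain_loss_bounds[OF P z \<gamma> super less_imp_le[OF m(1)] m(2) bump_borel bump_bound
        of_nat_0_less_iff[THEN iffD2, OF zero_less_Suc] bump_lipschitz[of U n], of x0,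
        folded s_def, folded G_def L_def S_def]
    have "ereal (quad P x0 + z) \<le> gain_minus_loss G L"
      using attained bounds(1) by (rule order_trans)
    note GL = gain_minus_loss_geD[OF this V]
    \<comment> \<open>With V the value at x0, \<open>G + S \<le> V + L\<close> by the bounds and
      \<open>V + L \<le> G\<close> by attainment; finiteness of G then forces S = 0.\<close>
    have "G + S \<le> G + 0"
      unfolding add_0_right by (rule order_trans[OF bounds(2) GL(2)])
    moreover have "G < \<infinity>"
    proof -
      have "G \<le> G + S" by simp
      also have "\<dots> \<le> ennreal (quad P x0 + z) + L" by (rule bounds(2))
      also have "\<dots> < \<infinity>" using GL(1) by (simp add: less_top)
      finally show ?thesis .
    qed
    ultimately have "S = 0" by (auto simp: ennreal_add_left_cancel_le)
    then have "ennreal \<alpha> ^ t * stage_expectation t s = 0"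
      unfolding S_def by (subst (asm) suminf_eq_zero_iff) auto
    then have "stage_expectation t s = 0"
      using \<alpha> by (simp add: ennreal_power)
    moreover have "(\<lambda>\<omega>. s (\<omega> t)) \<in> borel_measurable law"
      unfolding s_def by (intro component_measurable slack_measurable bump_borel)
    ultimately have "AE \<omega> in law. s (\<omega> t) = 0"
      unfolding stage_expectation_def by (simp add: nn_integral_0_iff_AE)
    then show ?thesis
    proof eventually_elim
      case (elim \<omega>)
      then have "m / (real (Suc n))\<^sup>2 * ((\<integral>w. bump U n w \<partial>snd (snd (\<omega> t)))
          - (\<integral>w. bump U n w \<partial>worst_distribution P (A *v fst (\<omega> t) + B *v fst (snd (\<omega> t)))))\<^sup>2 \<le> 0"
        by (simp add: s_def slack_def split_beta' ennreal_eq_0_iff)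
      then show ?case using m(1) by (simp add: mult_le_0_iff divide_le_0_iff del: of_nat_Suc)
    qed
  qed
  \<comment> \<open>Countably many sets and bumps share one null set.\<close>
  have "AE \<omega> in law. \<forall>U\<in>\<B>. \<forall>n. (\<integral>w. bump U n w \<partial>snd (snd (\<omega> t)))
      = (\<integral>w. bump U n w \<partial>worst_distribution P (A *v fst (\<omega> t) + B *v fst (snd (\<omega> t))))"
    using \<B>(1) bump by (simp add: AE_ball_countable AE_all_countable)
  then show ?thesis
    using control AE_space
  proof eventually_elim
    case (elim \<omega>)
    have "snd (snd (\<omega> t)) \<in> prob_measures"
      using space_law[OF elim(3), of t] by (auto simp: stage_space_def space_pair_measure)
    then have "snd (snd (\<omega> t)) = worst_distribution P (A *v fst (\<omega> t) + B *v fst (snd (\<omega> t)))"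
      using elim(1) \<B>(2)
      by (intro \<B>(3) emeasure_eq_if_bump worst_distribution_in_prob_measures) auto
    then show ?case using elim(2) by (simp add: worst_feedback_def)
  qed
qed

text \<open>By \<open>optimal_disturbance\<close> both answers drive the state by the same
  closed-loop kernel, hence with the same marginals, and the stage payoff is almost surely one
  function of the state.\<close>

lemma total_payoff_worst_feedback_ge:
  assumes P: "admissible P" and z: "0 \<le> z" and \<gamma>: "\<gamma> \<in> policiesII"
    and super: "\<And>x. q_value P z x (gain P *v x) \<le> quad P x + z"
    and attained: "ereal (quad P x0 + z) \<le> total_payoff f c \<alpha> lam \<nu> (gain_policy P) \<gamma> x0"
  shows "ereal (quad P x0 + z)
    \<le> total_payoff f c \<alpha> lam \<nu> (gain_policy P) (det_stationary_policyII (worst_feedback P)) x0"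
proof -
  let ?k = "\<lambda>x. gain P *v x" and ?g = "worst_feedback P"
  interpret C: controlled_process f "gain_policy P" \<gamma> x0
    by (rule controlled_process[OF gain_policy_in_policiesI \<gamma>])
  interpret C': controlled_process f "gain_policy P" "det_stationary_policyII ?g" x0
    by (rule controlled_process[OF gain_policy_in_policiesI worst_feedback_in_policiesII])
  have control: "AE \<omega> in C.law. fst (snd (\<omega> t)) = ?k (fst (\<omega> t))"
    and control': "AE \<omega> in C'.law. fst (snd (\<omega> t)) = ?k (fst (\<omega> t))" for t
    by (rule C.AE_control[OF refl], measurable) (rule C'.AE_control[OF refl], measurable)
  have disturbance: "AE \<omega> in C.law. snd (snd (\<omega> t)) = ?g (fst (\<omega> t))" for t
    by (rule optimal_disturbance[OF P z \<gamma> super attained])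
  have disturbance': "AE \<omega> in C'.law. snd (snd (\<omega> t)) = ?g (fst (\<omega> t))" for t
  proof (rule C'.AE_disturbance)
    show "(\<lambda>(x, u). ?g x) \<in> borel \<Otimes>\<^sub>M borel \<rightarrow>\<^sub>M prob_algebra borel"
      unfolding split_beta' by (rule measurable_compose[OF measurable_fst worst_feedback_measurable])
  qed (simp add: det_stationary_policyII_def)
  \<comment> \<open>b varies in the induction because one step replaces it by its image under the
    transition kernel.\<close>
  have marginal: "C.stage_expectation t (\<lambda>(x, u, \<mu>). b x) = C'.stage_expectation t (\<lambda>(x, u, \<mu>). b x)"
    if "b \<in> borel_measurable borel" for b t
    using that
  proof (induction t arbitrary: b)
    case 0
    then show ?case
      by (simp only: C.stage_expectation_initial_state C'.stage_expectation_initial_state)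
  next
    case (Suc t)
    have "(\<lambda>p. (fst p, ?k (fst p), snd p)) \<in> borel \<Otimes>\<^sub>M borel \<rightarrow>\<^sub>M borel \<Otimes>\<^sub>M borel \<Otimes>\<^sub>M borel"
      by measurable
    from measurable_compose[OF measurable_compose[OF this system_measurable] Suc.prems]
    have "(\<lambda>(x, w). b (f x (?k x) w)) \<in> borel_measurable (borel \<Otimes>\<^sub>M borel)"
      by (simp add: split_beta')
    from nn_integral_measurable_subprob_algebra2[OF this measurable_prob_algebraD[OF worst_feedback_measurable]]
    have "(\<lambda>x. \<integral>\<^sup>+ w. b (f x (?k x) w) \<partial>?g x) \<in> borel_measurable borel" .
    from Suc.IH[OF this] show ?case
      by (simp only: C.stage_expectation_Suc_feedback[OF Suc.prems control disturbance]
          C'.stage_expectation_Suc_feedback[OF Suc.prems control' disturbance'])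
  qed
  define y where "y = (\<lambda>x. c x (?k x) - lam * transport P (A *v x + B *v ?k x))"
  have y [measurable]: "y \<in> borel_measurable borel"
    unfolding y_def transport_def response_def quadratic_cost_def
    by (simp del: transpose_matrix_vector) measurable
  define p q :: "(real ^ 'n, real ^ 'm, real ^ 'l) stage \<Rightarrow> ennreal"
    where "p = (\<lambda>(x, u, \<mu>). ennreal (y x))" and "q = (\<lambda>(x, u, \<mu>). ennreal (- y x))"
  have p [measurable]: "p \<in> borel_measurable stage_space" and q [measurable]: "q \<in> borel_measurable stage_space"
    unfolding p_def q_def stage_space_def by measurable
  have payoff: "stage_payoff c lam \<nu> \<sigma> = ereal (y (fst \<sigma>))"
    if "fst (snd \<sigma>) = ?k (fst \<sigma>)" "snd (snd \<sigma>) = ?g (fst \<sigma>)" for \<sigma>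
    using that stage_payoff_worst_distribution[OF P]
    by (cases \<sigma>) (simp add: y_def worst_feedback_def)
  have "total_payoff f c \<alpha> lam \<nu> (gain_policy P) \<gamma> x0 \<le> gain_minus_loss
      (\<Sum>t. ennreal \<alpha> ^ t * C.stage_expectation t p) (\<Sum>t. ennreal \<alpha> ^ t * C.stage_expectation t q)"
  proof (rule C.total_payoff_le[OF _ p q])
    show "AE \<omega> in C.law. e2ennreal (stage_payoff c lam \<nu> (\<omega> t)) \<le> p (\<omega> t)
      \<and> q (\<omega> t) \<le> e2ennreal (- stage_payoff c lam \<nu> (\<omega> t))" for t
      using control[of t] disturbance[of t] by eventually_elim (simp add: payoff p_def q_def split_beta')
  qed (use \<alpha> in simp)
  also have "\<dots> = gain_minus_loss
      (\<Sum>t. ennreal \<alpha> ^ t * C'.stage_expectation t p) (\<Sum>t. ennreal \<alpha> ^ t * C'.stage_expectation t q)"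
    unfolding p_def q_def by (simp add: marginal)
  also have "\<dots> \<le> total_payoff f c \<alpha> lam \<nu> (gain_policy P) (det_stationary_policyII ?g) x0"
  proof (rule C'.total_payoff_ge[OF _ p q])
    show "AE \<omega> in C'.law. p (\<omega> t) \<le> e2ennreal (stage_payoff c lam \<nu> (\<omega> t))
      \<and> e2ennreal (- stage_payoff c lam \<nu> (\<omega> t)) \<le> q (\<omega> t)" for t
      using control'[of t] disturbance'[of t] by eventually_elim (simp add: payoff p_def q_def split_beta')
  qed (use \<alpha> in simp)
  finally show ?thesis using attained by (rule order_trans[rotated])
qed

end

theorem theorem4:
  fixes A :: "real ^ 'n ^ 'n" and B :: "real ^ 'm ^ 'n" and \<Xi> :: "real ^ 'l ^ 'n"
    and Q :: "real ^ 'n ^ 'n" and R :: "real ^ 'm ^ 'm" and P :: "real ^ 'n ^ 'n"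
    and K :: "real ^ 'n ^ 'm" and \<alpha> lam z :: real
    and N :: nat and wh :: "nat \<Rightarrow> real ^ 'l" and \<nu> :: "(real ^ 'l) measure"
    and f :: "real ^ 'n \<Rightarrow> real ^ 'm \<Rightarrow> real ^ 'l \<Rightarrow> real ^ 'n"
    and c :: "real ^ 'n \<Rightarrow> real ^ 'm \<Rightarrow> real"
    and v :: "real ^ 'n \<Rightarrow> ereal"
    and \<pi>' :: "(real ^ 'n, real ^ 'm) policyI"
    and g :: "real ^ 'n \<Rightarrow> (real ^ 'l) measure"
    and \<gamma>' :: "(real ^ 'n, real ^ 'm, real ^ 'l) policyII"
  assumes "0 < \<alpha>" and "\<alpha> < 1" and "0 < lam"
    and "pos_semidef Q" and "pos_def R"
    and "1 \<le> N" and "(1 / N) *\<^sub>R (\<Sum>i = 1..N. wh i) = 0"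
    and f: "f = linear_system A B \<Xi>"
    and c: "c = quadratic_cost Q R"
    and \<nu>: "\<nu> = empirical_measure N wh"
    and "pos_semidef P" and "pos_def (penalty_matrix \<alpha> lam \<Xi> P)"
    and "riccati_equation \<alpha> lam A B \<Xi> Q R P"
    and z: "z = value_offset \<alpha> lam \<Xi> (sample_covariance N wh) P"
    and v: "v = (\<lambda>x. ereal (x \<bullet> (P *v x) + z))"
    and K: "K = gain_matrix \<alpha> lam A B \<Xi> R P"
    and \<pi>': "\<pi>' = det_stationary_policyI (\<lambda>x. K *v x)"
    and g: "g = (\<lambda>x. empirical_measure N (worst_sample \<alpha> lam A B \<Xi> P K wh x))"
    and \<gamma>': "\<gamma>' = det_stationary_policyII g"
  shows "v = bellman_operator f c \<alpha> lam \<nu> v \<and>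
    (v = optimal_value f c \<alpha> lam \<nu> \<longrightarrow>
      optimal_policyI f c \<alpha> lam \<nu> \<pi>' \<and>
      stationary_policyI \<pi>' \<and>
      (\<forall>\<pi>. stationary_policyI \<pi> \<and> optimal_policyI f c \<alpha> lam \<nu> \<pi> \<longrightarrow>
         (\<forall>t. \<forall>h\<in>space (hist_space t). \<pi> t h = \<pi>' t h)) \<and>
      (\<forall>\<pi>. optimal_policyI f c \<alpha> lam \<nu> \<pi> \<longrightarrow>
         (\<forall>h\<in>space (hist_space 0). \<pi> 0 h = \<pi>' 0 h)) \<and>
      \<gamma>' \<in> policiesII \<and>
      (\<forall>x. worst_case_distribution f c \<alpha> lam \<nu> v x (K *v x) (g x)) \<and>
      (\<forall>x. (\<exists>\<gamma>. optimal_policyII_at f c \<alpha> lam \<nu> \<pi>' \<gamma> x) \<longrightarrow>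
         optimal_policyII_at f c \<alpha> lam \<nu> \<pi>' \<gamma>' x))"
proof -
  interpret wasserstein_lq A B \<Xi> Q R \<alpha> lam N wh
    using assms(1-7) by unfold_locales auto
  have P: "admissible P"
    using \<open>pos_semidef P\<close> \<open>pos_def (penalty_matrix \<alpha> lam \<Xi> P)\<close> by (simp add: admissible_def)
  have fixpoint: "riccati P = P"
    using \<open>riccati_equation \<alpha> lam A B \<Xi> Q R P\<close> by (simp add: riccati_def riccati_equation_def)
  have "(1 - \<alpha>) * z = noise_value P"
    using \<open>\<alpha> < 1\<close> by (simp add: z value_offset_def noise_value_def)
  then have z_eq: "z = noise_value P + \<alpha> * z" by (simp add: algebra_simps)
  have z0: "0 \<le> z" using value_constant_mono[OF P fixpoint z_eq, of 0] by simp
  have q_gain: "q_value P z x (gain P *v x) = quad P x + z" for x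
    using z_eq by (simp add: q_value_eq[OF P] fixpoint)
  have g_eq: "g = worst_feedback P"
  proof (rule ext)
    fix x
    have "worst_sample \<alpha> lam A B \<Xi> P K wh x i = response P (A *v x + B *v (gain P *v x)) (wh i)" for i
      by (simp add: worst_sample_def response_def K matrix_vector_mul_assoc[symmetric]
          matrix_vector_mult_add_rdistrib del: transpose_matrix_vector)
    then have "worst_sample \<alpha> lam A B \<Xi> P K wh x
        = (\<lambda>i. response P (A *v x + B *v (gain P *v x)) (wh i))" by (rule ext)
    then show "g x = worst_feedback P x"
      by (simp add: g worst_feedback_def worst_distribution_def)
  qed
  have \<pi>'_eq: "\<pi>' = gain_policy P" by (simp add: \<pi>' K)
  have bellman: "v = bellman_operator f c \<alpha> lam \<nu> v"
    unfolding f c \<nu> v using z_eq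
    by (auto simp: bellman_operator_eq[OF P z0] fixpoint)
  have worst_le: "worst_payoff f c \<alpha> lam \<nu> \<pi>' x \<le> v x" for x
    unfolding f c \<nu> v \<pi>'_eq by (rule worst_payoff_gain_policy_le[OF P z0]) (simp add: q_gain)
  have \<pi>'_in: "\<pi>' \<in> policiesI" unfolding \<pi>'_eq by (rule gain_policy_in_policiesI)
  have \<gamma>'_in: "\<gamma>' \<in> policiesII" unfolding \<gamma>' g_eq by (rule worst_feedback_in_policiesII)
  have stationary: "stationary_policyI \<pi>'"
    unfolding stationary_policyI_def \<pi>'
    by (intro exI[of _ "\<lambda>x. return borel (K *v x)"]) (auto simp: det_stationary_policyI_def)
  have worst_case: "worst_case_distribution f c \<alpha> lam \<nu> v x (K *v x) (g x)" for x
    unfolding worst_case_distribution_def f c \<nu> v g_eq worst_feedback_def K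
      SUP_bellman_payoff[OF P z0] bellman_payoff_worst_distribution[OF P z0]
    by (simp add: worst_distribution_in_prob_measures)
  have "optimal_policyI f c \<alpha> lam \<nu> \<pi>' \<and>
      stationary_policyI \<pi>' \<and>
      (\<forall>\<pi>. stationary_policyI \<pi> \<and> optimal_policyI f c \<alpha> lam \<nu> \<pi> \<longrightarrow>
         (\<forall>t. \<forall>h\<in>space (hist_space t). \<pi> t h = \<pi>' t h)) \<and>
      (\<forall>\<pi>. optimal_policyI f c \<alpha> lam \<nu> \<pi> \<longrightarrow>
         (\<forall>h\<in>space (hist_space 0). \<pi> 0 h = \<pi>' 0 h)) \<and>
      \<gamma>' \<in> policiesII \<and>
      (\<forall>x. worst_case_distribution f c \<alpha> lam \<nu> v x (K *v x) (g x)) \<and>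
      (\<forall>x. (\<exists>\<gamma>. optimal_policyII_at f c \<alpha> lam \<nu> \<pi>' \<gamma> x) \<longrightarrow>
         optimal_policyII_at f c \<alpha> lam \<nu> \<pi>' \<gamma>' x)"
    if optimal: "v = optimal_value f c \<alpha> lam \<nu>"
  proof -
    have value_le: "v x \<le> worst_payoff f c \<alpha> lam \<nu> \<pi> x" if "\<pi> \<in> policiesI" for \<pi> x
      unfolding optimal optimal_value_def using that by (rule INF_lower)
    obtain L zl where L: "admissible L" "0 \<le> zl"
      "\<And>x. (\<lambda>n. quad (value_matrix n) x) \<longlonglongrightarrow> quad L x" "value_constant \<longlonglongrightarrow> zl"
      "\<And>x. quad L x + zl \<le> quad P x + z"
      "\<And>x. q_value L zl x (gain L *v x) \<le> quad L x + zl"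
      by (rule value_iteration_limit[OF P fixpoint z_eq]) blast
    \<comment> \<open>The feedback of L guarantees Player I the value of L, which the optimal value
      V therefore cannot exceed.\<close>
    have limit_eq: "quad L x + zl = quad P x + z" for x
    proof (rule antisym[OF L(5)])
      have "v x \<le> worst_payoff f c \<alpha> lam \<nu> (gain_policy L) x"
        by (rule value_le[OF gain_policy_in_policiesI])
      also have "\<dots> \<le> ereal (quad L x + zl)"
        unfolding f c \<nu> by (rule worst_payoff_gain_policy_le[OF L(1,2,6)])
      finally show "quad P x + z \<le> quad L x + zl" by (simp add: v)
    qed
    \<comment> \<open>At x = 0 only the constants remain.\<close>
    from limit_eq[of 0] have "zl = z" by simp
    with limit_eq have "quad L x = quad P x" for x by simp
    with L(3,4) \<open>zl = z\<close>
    have lim: "\<And>x. (\<lambda>n. quad (value_matrix n) x) \<longlonglongrightarrow> quad P x" "value_constant \<longlonglongrightarrow> z"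
      by simp_all
    have worst_eq: "worst_payoff f c \<alpha> lam \<nu> \<pi>' x = v x" for x
      by (rule antisym[OF worst_le value_le[OF \<pi>'_in]])
    have initial: "\<pi> 0 (\<lambda>_. undefined, x) = return borel (K *v x)"
      if "optimal_policyI f c \<alpha> lam \<nu> \<pi>" for \<pi> x
    proof -
      have "\<pi> \<in> policiesI" and "worst_payoff f c \<alpha> lam \<nu> \<pi> x \<le> v x"
        using that optimal by (simp_all add: optimal_policyI_def)
      then show ?thesis
        unfolding f c \<nu> v K by (intro control_determined[OF P fixpoint z_eq lim])
    qed
    have "\<pi> t h = \<pi>' t h" if stat: "stationary_policyI \<pi>" and opt: "optimal_policyI f c \<alpha> lam \<nu> \<pi>"
      and h: "h \<in> space (hist_space t)" for \<pi> t h
    proof -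
      obtain \<phi> where "\<forall>t. \<forall>(h, x)\<in>space (hist_space t). \<pi> t (h, x) = \<phi> x"
        using stat unfolding stationary_policyI_def by blast
      then have \<phi>: "\<pi> t (h, x) = \<phi> x" if "(h, x) \<in> space (hist_space t)" for t h x
        using that by (metis (mono_tags, lifting) case_prodD)
      obtain h' x where hx: "h = (h', x)" by (cases h)
      \<comment> \<open>Histories at time 0 differ only in the current state, so the kernel found
        there is the stationary kernel at every state.\<close>
      have "(\<lambda>_. undefined, x) \<in> space (hist_space 0)"
        by (simp add: hist_space_def space_PiM space_pair_measure)
      from \<phi>[OF this] \<phi>[OF h[unfolded hx]] initial[OF opt, of x] show ?thesis
        by (simp add: hx \<pi>' det_stationary_policyI_def)
    qed
    moreover have "\<pi> 0 h = \<pi>' 0 h" if "optimal_policyI f c \<alpha> lam \<nu> \<pi>"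
      and "h \<in> space (hist_space 0)" for \<pi> h
      using that initial[OF that(1)]
      by (auto simp: hist_space_def space_PiM space_pair_measure \<pi>' det_stationary_policyI_def)
    moreover have "optimal_policyII_at f c \<alpha> lam \<nu> \<pi>' \<gamma>' x"
      if "optimal_policyII_at f c \<alpha> lam \<nu> \<pi>' \<gamma> x" for \<gamma> x
    proof -
      have \<gamma>: "\<gamma> \<in> policiesII" and "total_payoff f c \<alpha> lam \<nu> \<pi>' \<gamma> x = v x"
        using that worst_eq by (simp_all add: optimal_policyII_at_def)
      then have "v x \<le> total_payoff f c \<alpha> lam \<nu> \<pi>' \<gamma>' x"
        unfolding f c \<nu> v \<pi>'_eq \<gamma>' g_eq
        by (intro total_payoff_worst_feedback_ge[OF P z0 \<gamma>]) (simp_all add: q_gain)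
      moreover have "total_payoff f c \<alpha> lam \<nu> \<pi>' \<gamma>' x \<le> worst_payoff f c \<alpha> lam \<nu> \<pi>' x"
        unfolding worst_payoff_def by (rule SUP_upper[OF \<gamma>'_in])
      ultimately show ?thesis
        using \<gamma>'_in worst_eq by (simp add: optimal_policyII_at_def)
    qed
    moreover have "optimal_policyI f c \<alpha> lam \<nu> \<pi>'"
      using \<pi>'_in worst_eq by (simp add: optimal_policyI_def optimal[symmetric])
    ultimately show ?thesis
      using \<gamma>'_in stationary worst_case by blast
  qed
  with bellman show ?thesis by blast
qed

end
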